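(* Let $f_i$, $l_i$, $g_i(t,z,\Sigma)$, $G(t,z,\Sigma)$, $\bar Z$, $V$ and $\Sigma(t)$ be as in the context, and let $Y(t)=\bar Z(t)+V(t)$. Then $$E[Y(t)]=\bar Z(t)\qquad\text{and}\qquad \mathrm{Cov}[Y(t),Y(t)]=\mathrm{Cov}[V(t),V(t)]=\Sigma(t),$$ and $\bar Z(t)$ and $\Sigma(t)$ solve simultaneously the ordinary differential equations, with initial values $\bar Z(0)=x_0$ and $\Sigma(0)=0$, $$\frac{d}{dt}\bar Z(t)=\sum_{i=1}^k l_i\,g_i\big(t,\bar Z(t),\Sigma(t)\big),$$ $$\frac{d}{dt}\Sigma(t)=A(t)\Sigma(t)+\Sigma(t)A(t)'+B(t)B(t)',$$ where $A(t)$ is the gradient (Jacobian) matrix of $G(t,z,\Sigma(t))$ with respect to $z$ evaluated at $z=\bar Z(t)$, and $B(t)$ is the $d\times k$ matrix whose $i$-th column is $l_i\sqrt{g_i(t,\bar Z(t),\Sigma(t))}$.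
   Context: Fix $T<\infty$, $d,k\ge1$, $x_0\in\mathbb{R}^d$, constant vectors $l_1,\dots,l_k\in\mathbb{Z}^d$, and continuous functions $f_i:[0,T]\times\mathbb{R}^d\to\mathbb{R}$ with $|f_i(t,x)|\le C_i(1+|x|)$ and such that $F(t,x)=\sum_i l_if_i(t,x)$ satisfies $|F(t,x)-F(t,y)|\le M|x-y|$ for $t\le T$ (finite $C_i,M$). For $z\in\mathbb{R}^d$ and a covariance matrix $\Sigma$, $g_i(t,z,\Sigma)=E[f_i(t,\xi)]$ with $\xi\sim N(z,\Sigma)$, and $G(t,z,\Sigma)=\sum_{i=1}^k l_ig_i(t,z,\Sigma)$. The adjusted fluid and diffusion models are coupled through the covariance $\Sigma(t)$: $\bar Z$ (deterministic) and $V$ are continuous in $t\in[0,T]$ and satisfy $$\bar Z(t)=x_0+\sum_{i=1}^k l_i\int_0^t g_i\big(s,\bar Z(s),\Sigma(s)\big)\,ds,$$ $$V(t)=\sum_{i=1}^k l_i\int_0^t\sqrt{g_i\big(s,\bar Z(s),\Sigma(s)\big)}\,dW_i(s)+\int_0^t A(s)V(s)\,ds,$$ with $W_1,\dots,W_k$ independent standard Brownian motions, $A(s)=\partial_zG(s,z,\Sigma(s))|_{z=\bar Z(s)}$, and where the covariance $\Sigma(t)$ used in the functions $g_i$ is the covariance matrix of $V(t)$. In particular $V(0)=0$. It is understood that $\Sigma(t)$ is positive definite for $0<t\le T$ (so that the Gaussian density exists and $A(t)$ is defined), that $g_i(t,\bar Z(t),\Sigma(t))\ge 0$, and the differential equations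 are for $0<t\le T$. A prime denotes transpose. *)

theory Defs
  imports "HOL-Probability.Probability"
begin

section \<open>Multivariate normal distributions\<close>

definition std_mvnormal :: "(real ^ 'd) measure" where
  "std_mvnormal = density lborel (\<lambda>x. ennreal (\<Prod>j\<in>UNIV. std_normal_density (x $ j)))"

text \<open>
  \<open>N(z, S)\<close> is the law of \<open>z + Q \<xi>\<close> with \<open>\<xi>\<close> standard normal and \<open>Q Q' = S\<close>; this law does not
  depend on the choice of \<open>Q\<close>. The matrix \<open>S\<close> may be singular (\<open>S = 0\<close> gives the point mass
  at \<open>z\<close>). The definition is meaningful only if \<open>S\<close> is symmetric and positive semidefinite.
\<close>

definition mvnormal :: "real ^ 'd \<Rightarrow> real ^ 'd ^ 'd \<Rightarrow> (real ^ 'd) measure" where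
  "mvnormal z S =
     distr std_mvnormal borel (\<lambda>x. z + (SOME Q :: real ^ 'd ^ 'd. Q ** transpose Q = S) *v x)"

definition positive_definite :: "real ^ 'd ^ 'd \<Rightarrow> bool" where
  "positive_definite S \<longleftrightarrow> transpose S = S \<and> (\<forall>x. x \<noteq> 0 \<longrightarrow> 0 < x \<bullet> (S *v x))"

definition cov_matrix :: "'w measure \<Rightarrow> ('w \<Rightarrow> real ^ 'd) \<Rightarrow> ('w \<Rightarrow> real ^ 'd) \<Rightarrow> real ^ 'd ^ 'd" where
  "cov_matrix M X Y = (\<chi> a b. \<integral>\<omega>. (X \<omega> $ a - (\<integral>\<eta>. X \<eta> $ a \<partial>M)) * (Y \<omega> $ b - (\<integral>\<eta>. Y \<eta> $ b \<partial>M)) \<partial>M)"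

section \<open>Brownian motion and stochastic integrals of deterministic integrands\<close>

definition standard_brownian_motion :: "'w measure \<Rightarrow> (real \<Rightarrow> 'w \<Rightarrow> real) \<Rightarrow> bool" where
  "standard_brownian_motion M W \<longleftrightarrow>
     prob_space M \<and>
     (\<forall>t\<ge>0. W t \<in> borel_measurable M) \<and>
     (AE \<omega> in M. W 0 \<omega> = 0) \<and>
     (\<forall>s t. 0 \<le> s \<longrightarrow> s < t \<longrightarrow>
        distributed M lborel (\<lambda>\<omega>. W t \<omega> - W s \<omega>) (\<lambda>x. ennreal (normal_density 0 (sqrt (t - s)) x))) \<and>
     (\<forall>(n::nat) \<tau>. 0 \<le> \<tau> 0 \<longrightarrow> (\<forall>j<n. \<tau> j < \<tau> (Suc j)) \<longrightarrow>
        prob_space.indep_vars M (\<lambda>_. borel) (\<lambda>j \<omega>. W (\<tau> (Suc j)) \<omega> - W (\<tau> j) \<omega>) {..<n}) \<and>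
     (AE \<omega> in M. continuous_on {0..} (\<lambda>t. W t \<omega>))"

text \<open>
  Independence of processes: each \<open>W i\<close> is viewed as one random element of the space of
  functions on \<open>[0,\<infinity>)\<close> with the product sigma-algebra.
\<close>

definition independent_brownian_motions ::
    "'w measure \<Rightarrow> ('k \<Rightarrow> real \<Rightarrow> 'w \<Rightarrow> real) \<Rightarrow> bool" where
  "independent_brownian_motions M W \<longleftrightarrow>
     (\<forall>i. standard_brownian_motion M (W i)) \<and>
     prob_space.indep_vars M (\<lambda>_. \<Pi>\<^sub>M t\<in>{0..}. (borel :: real measure))
       (\<lambda>i \<omega>. \<lambda>t\<in>{0..}. W i t \<omega>) UNIV"

definition step_function :: "nat \<Rightarrow> (nat \<Rightarrow> real) \<Rightarrow> (nat \<Rightarrow> real) \<Rightarrow> real \<Rightarrow> real" where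
  "step_function n \<tau> c s = (\<Sum>j<n. c j * indicator {\<tau> j<..\<tau> (Suc j)} s)"

definition step_integral ::
    "(real \<Rightarrow> 'w \<Rightarrow> real) \<Rightarrow> nat \<Rightarrow> (nat \<Rightarrow> real) \<Rightarrow> (nat \<Rightarrow> real) \<Rightarrow> 'w \<Rightarrow> real" where
  "step_integral W n \<tau> c \<omega> = (\<Sum>j<n. c j * (W (\<tau> (Suc j)) \<omega> - W (\<tau> j) \<omega>))"

text \<open>
  \<open>J\<close> is (a version of) the stochastic integral of the deterministic function \<open>h\<close> with respect to
  \<open>W\<close> over \<open>[0,t]\<close>: the limit in \<open>L\<^sup>2(M)\<close> of the integrals of step functions that converge to \<open>h\<close>
  in \<open>L\<^sup>2[0,t]\<close>. By the isometry of the integral, the limit is almost surely unique and does not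
  depend on the approximating sequence.
\<close>

definition has_stochastic_integral ::
    "'w measure \<Rightarrow> (real \<Rightarrow> 'w \<Rightarrow> real) \<Rightarrow> (real \<Rightarrow> real) \<Rightarrow> real \<Rightarrow> ('w \<Rightarrow> real) \<Rightarrow> bool" where
  "has_stochastic_integral M W h t J \<longleftrightarrow>
     set_borel_measurable lborel {0..t} h \<and> J \<in> borel_measurable M \<and>
     (\<exists>n \<tau> c.
        (\<forall>m. 0 \<le> \<tau> m 0 \<and> (\<forall>j<n m. \<tau> m j \<le> \<tau> m (Suc j)) \<and> \<tau> m (n m) \<le> t) \<and>
        (\<lambda>m. \<integral>\<^sup>+s\<in>{0..t}. ennreal ((step_function (n m) (\<tau> m) (c m) s - h s)\<^sup>2) \<partial>lborel)
          \<longlonglongrightarrow> 0 \<and>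
        (\<lambda>m. \<integral>\<^sup>+\<omega>. ennreal ((step_integral W (n m) (\<tau> m) (c m) \<omega> - J \<omega>)\<^sup>2) \<partial>M)
          \<longlonglongrightarrow> 0)"

section \<open>Rate functions of the adjusted model\<close>

definition real_vec :: "int ^ 'd \<Rightarrow> real ^ 'd" where
  "real_vec v = (\<chi> j. real_of_int (v $ j))"

definition drift ::
    "('k::finite \<Rightarrow> int ^ 'd) \<Rightarrow> ('k \<Rightarrow> real \<Rightarrow> real ^ 'd \<Rightarrow> real) \<Rightarrow> real \<Rightarrow> real ^ 'd \<Rightarrow> real ^ 'd" where
  "drift l f t x = (\<Sum>i\<in>UNIV. f i t x *\<^sub>R real_vec (l i))"

definition gauss_rate ::
    "('k \<Rightarrow> real \<Rightarrow> real ^ 'd \<Rightarrow> real) \<Rightarrow> 'k \<Rightarrow> real \<Rightarrow> real ^ 'd \<Rightarrow> real ^ 'd ^ 'd \<Rightarrow> real" where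
  "gauss_rate f i t z S = (\<integral>\<xi>. f i t \<xi> \<partial>mvnormal z S)"

definition gauss_drift ::
    "('k::finite \<Rightarrow> int ^ 'd) \<Rightarrow> ('k \<Rightarrow> real \<Rightarrow> real ^ 'd \<Rightarrow> real) \<Rightarrow>
     real \<Rightarrow> real ^ 'd \<Rightarrow> real ^ 'd ^ 'd \<Rightarrow> real ^ 'd" where
  "gauss_drift l f t z S = (\<Sum>i\<in>UNIV. gauss_rate f i t z S *\<^sub>R real_vec (l i))"

text \<open>
  The matrix \<open>A(t)\<close>. For positive definite \<open>S t\<close> and \<open>f\<close> of linear growth the map
  \<open>z \<mapsto> G(t, z, S t)\<close> is differentiable, so the library Jacobian is the actual one; the value at
  \<open>t = 0\<close>, where \<open>S 0 = 0\<close>, is irrelevant.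
\<close>

definition drift_jacobian ::
    "('k::finite \<Rightarrow> int ^ 'd) \<Rightarrow> ('k \<Rightarrow> real \<Rightarrow> real ^ 'd \<Rightarrow> real) \<Rightarrow>
     (real \<Rightarrow> real ^ 'd) \<Rightarrow> (real \<Rightarrow> real ^ 'd ^ 'd) \<Rightarrow> real \<Rightarrow> real ^ 'd ^ 'd" where
  "drift_jacobian l f Z S t = jacobian (\<lambda>z. gauss_drift l f t z (S t)) (at (Z t))"

definition diffusion_matrix ::
    "('k \<Rightarrow> int ^ 'd) \<Rightarrow> ('k \<Rightarrow> real \<Rightarrow> real ^ 'd \<Rightarrow> real) \<Rightarrow>
     (real \<Rightarrow> real ^ 'd) \<Rightarrow> (real \<Rightarrow> real ^ 'd ^ 'd) \<Rightarrow> real \<Rightarrow> real ^ 'k ^ 'd" where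
  "diffusion_matrix l f Z S t =
     (\<chi> j i. real_vec (l i) $ j * sqrt (gauss_rate f i t (Z t) (S t)))"

end

theory Submission
  imports Defs
begin

text \<open>
  In mean square, the stochastic integrals \<open>J\<^sub>i(t)\<close> are centred with
  \<open>E[J\<^sub>i(s) J\<^sub>j(t)] = \<delta>\<^sub>i\<^sub>j \<integral>\<^sub>0\<^bsup>min(s,t)\<^esup> g\<^sub>i\<close>. Write \<open>V = N + U\<close> with \<open>N = \<Sum>\<^sub>i J\<^sub>i l\<^sub>i\<close> and
  \<open>U(t) = \<integral>\<^sub>0\<^bsup>t\<^esup> A V\<close>. Gronwall's inequality along paths bounds \<open>E |V(t)|\<^sup>2\<close> uniformly in \<open>t\<close>, and
  applied to \<open>E[(N(t) - N(s)) V(r)]\<close>, \<open>r \<le> s\<close>, it shows that \<open>V(s)\<close> is orthogonal to the later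
  increments of \<open>N\<close>. Expanding \<open>E[V V']\<close> with Fubini's theorem gives
  \<open>\<Sigma>(t) = \<integral>\<^sub>0\<^bsup>t\<^esup> (A \<Sigma> + \<Sigma> A' + B B')\<close>, so no stochastic product rule is needed.

  To differentiate at \<open>t > 0\<close> the integrand must be continuous there. For positive definite
  \<open>\<Sigma>\<close> Gaussian integration by parts gives \<open>A \<Sigma> = E[F(t, Z + \<xi>) \<xi>']\<close> with \<open>\<xi> \<sim> N(0, \<Sigma>)\<close>, and
  Gaussian means depend continuously on \<open>(t, z, \<Sigma>)\<close>: roots of a convergent sequence of covariance
  matrices have convergent subsequences, and the law does not depend on the root.
\<close>

section \<open>Gaussian measures\<close>

text \<open>The obstacle is the starting time, where \<open>\<Sigma> 0 = 0\<close>: there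
  \<open>A\<close> has no meaning, and near it integration by parts controls \<open>A\<close> only
  through the inverse of a degenerating covariance. What survives is the Lipschitz constant of the
  drift. Averaging preserves it, so the entries of \<open>A\<close> are bounded by \<open>K\<close>
  uniformly on \<open>{0<..T}\<close>; this supplies the constant in Gronwall's inequality and makes
  the integrals from \<open>0\<close> converge.

  There is also an apparent circle: \<open>A\<close> is built from \<open>\<Sigma>\<close>, whose
  continuity is to follow from an integral equation that contains \<open>A\<close>. Measurability
  breaks it. \<open>\<Sigma>\<close> is measurable because a continuous version of \<open>V\<close>
  is jointly measurable, and \<open>A\<close> is then a limit of measurable difference quotients;
  with \<open>A\<close> bounded and measurable the integral equation can be derived, and continuity
  of \<open>\<Sigma>\<close> comes out of it.\<close>

lemma prod_Basis_vec: "(\<Prod>b\<in>(Basis::(real^'d) set). h b) = (\<Prod>j\<in>UNIV. h (axis j 1))"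
proof -
  have *: "(Basis::(real^'d) set) = range (\<lambda>j. axis j 1)"
    by (auto simp: Basis_vec_def)
  have "inj (\<lambda>j::'d. axis j (1::real))"
    by (auto simp: inj_def axis_eq_axis)
  from prod.reindex[OF this, of h] show ?thesis
    unfolding * by (simp only: o_def)
qed

text \<open>The variance is left free for two uses: \<open>\<sigma> = 1\<close> normalizes the
  standard law, and \<open>\<sigma> = sqrt 2\<close> supplies an integrable majorant for its
  exponential moments.\<close>

lemma nn_integral_prod_normal_density:
  assumes "\<sigma> > 0"
  shows "(\<integral>\<^sup>+x. (\<Prod>j\<in>UNIV. ennreal (normal_density 0 \<sigma> ((x::real^'d) $ j))) \<partial>lborel) = 1"
proof -
  have "(\<integral>\<^sup>+x. ennreal (normal_density 0 \<sigma> x) \<partial>lborel) = 1"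
    using assms by (subst nn_integral_eq_integral) (auto simp: integral_normal_density)
  moreover have "(\<integral>\<^sup>+x. (\<Prod>b\<in>Basis. ennreal (normal_density 0 \<sigma> ((x::real^'d) \<bullet> b))) \<partial>lborel)
     = (\<Prod>b\<in>(Basis::(real^'d) set). \<integral>\<^sup>+x. ennreal (normal_density 0 \<sigma> x) \<partial>lborel)"
    by (rule nn_integral_lborel_prod) auto
  ultimately show ?thesis
    by (simp add: prod_Basis_vec inner_axis)
qed

text \<open>That the density depends on \<open>norm x\<close> alone yields invariance under
  orthogonal maps, and it reduces translations to completing a square.\<close>

lemma prod_normal_density:
  fixes x :: "real^'d"
  shows "(\<Prod>j\<in>UNIV. normal_density 0 \<sigma> (x $ j)) =
    (1 / sqrt (2 * pi * \<sigma>\<^sup>2)) ^ CARD('d) * exp (- (norm x)\<^sup>2 / (2 * \<sigma>\<^sup>2))"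
proof -
  have "(norm x)\<^sup>2 = (\<Sum>j\<in>UNIV. (x $ j)\<^sup>2)"
    unfolding power2_norm_eq_inner inner_vec_def by (simp add: power2_eq_square)
  then have "(\<Prod>j\<in>UNIV. exp (- (x $ j)\<^sup>2 / (2 * \<sigma>\<^sup>2))) = exp (- (norm x)\<^sup>2 / (2 * \<sigma>\<^sup>2))"
    by (simp add: exp_sum[symmetric] sum_negf sum_divide_distrib)
  then show ?thesis
    unfolding normal_density_def prod.distrib by simp
qed

section \<open>The standard normal law and its exponential moments\<close>

lemma space_std_mvnormal [simp]: "space std_mvnormal = UNIV"
  and sets_std_mvnormal [measurable_cong, simp]: "sets std_mvnormal = sets borel"
  by (auto simp: std_mvnormal_def)

lemma prod_std_normal_measurable [measurable]:
  "(\<lambda>x. \<Prod>j\<in>UNIV. std_normal_density ((x::real^'d) $ j)) \<in> borel_measurable borel"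
  by (intro borel_measurable_prod) (auto intro!: borel_measurable_continuous_onI continuous_intros simp: normal_density_def)

lemma prob_space_std_mvnormal: "prob_space (std_mvnormal :: (real^'d) measure)"
proof
  show "emeasure (std_mvnormal :: (real^'d) measure) (space std_mvnormal) = 1"
    using nn_integral_prod_normal_density[of 1, where 'd='d]
    by (simp add: std_mvnormal_def emeasure_density prod_ennreal)
qed

text \<open>Half of the Gaussian exponent absorbs the weight up to the constant
  \<open>exp (a^2)\<close>; the other half is the density with variance 2. Bounds of this
  exponential form survive translations, linear maps and multiplication by coordinates, which makes
  them the common majorant for all Gaussian integrals.\<close>

lemma integrable_std_mvnormal_exp:
  "integrable std_mvnormal (\<lambda>x::real^'d. exp (a * norm x))"
proof -
  \<comment> \<open>The normalizing constants of the densities with variances 1 and 2.\<close>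
  let ?c = "(1 / sqrt (2 * pi)) ^ CARD('d)" and ?e = "(1 / sqrt (2 * pi * 2)) ^ CARD('d)"
  have le: "(\<Prod>j\<in>UNIV. std_normal_density (x $ j)) * exp (a * norm x) \<le>
      (exp (a\<^sup>2) * ?c / ?e) * (\<Prod>j\<in>UNIV. normal_density 0 (sqrt 2) (x $ j))" for x :: "real^'d"
  proof -
    have "a * norm x - (norm x)\<^sup>2 / 2 \<le> a\<^sup>2 - (norm x)\<^sup>2 / 4"
      using zero_le_power2[of "a - norm x / 2"] by (simp add: power2_diff power_divide)
    then have "exp (- (norm x)\<^sup>2 / 2) * exp (a * norm x) \<le> exp (a\<^sup>2) * exp (- (norm x)\<^sup>2 / 4)"
      by (simp add: exp_add[symmetric] algebra_simps)
    then have "?c * (exp (- (norm x)\<^sup>2 / 2) * exp (a * norm x)) \<le> ?c * (exp (a\<^sup>2) * exp (- (norm x)\<^sup>2 / 4))"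
      by (intro mult_left_mono) auto
    then show ?thesis
      unfolding prod_normal_density by (simp add: algebra_simps)
  qed
  have "(\<integral>\<^sup>+x. ennreal (norm (exp (a * norm x))) \<partial>(std_mvnormal :: (real^'d) measure))
     = (\<integral>\<^sup>+x. ennreal ((\<Prod>j\<in>UNIV. std_normal_density (x $ j)) * exp (a * norm x)) \<partial>(lborel :: (real^'d) measure))"
    unfolding std_mvnormal_def by (subst nn_integral_density) (auto simp: ennreal_mult'' prod_nonneg)
  also have "\<dots> \<le> (\<integral>\<^sup>+x. ennreal (exp (a\<^sup>2) * ?c / ?e) * (\<Prod>j\<in>UNIV. ennreal (normal_density 0 (sqrt 2) ((x::real^'d) $ j))) \<partial>lborel)"
    using le by (intro nn_integral_mono) (auto simp: prod_ennreal ennreal_mult[symmetric] prod_nonneg intro!: ennreal_leI)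
  also have "\<dots> = ennreal (exp (a\<^sup>2) * ?c / ?e)"
    by (subst nn_integral_cmult, measurable) (simp add: nn_integral_prod_normal_density)
  also have "\<dots> < \<infinity>" by simp
  finally show ?thesis
    by (intro integrableI_bounded) (auto intro!: borel_measurable_continuous_onI continuous_intros)
qed

section \<open>Invariance under orthogonal maps\<close>

lemma measurable_matrix_vector_mult [measurable]:
  "(\<lambda>x::real^'d. (B::real^'d^'e) *v x) \<in> borel_measurable borel"
  by (intro borel_measurable_continuous_onI matrix_vector_mult_linear_continuous_on)

lemma norm_orthogonal_matrix_mult:
  fixes R :: "real^'d^'d"
  assumes "orthogonal_matrix R"
  shows "norm (R *v x) = norm x"
  using assms orthogonal_transformation_norm
  by (metis matrix_of_matrix_vector_mul matrix_vector_mul_linear orthogonal_transformation_matrix)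

text \<open>
  The uniqueness argument for Haar measure: by Tonelli and translation invariance, the pushforward
  \<open>\<mu>\<close> of Lebesgue measure satisfies \<open>\<mu>(f) \<lambda>(g) = \<mu>(g) \<lambda>(f)\<close>, and a Gaussian \<open>g\<close> has \<open>\<mu>(g) = \<lambda>(g)\<close>.
\<close>

lemma nn_integral_lborel_orthogonal:
  fixes R :: "real^'d^'d" and f :: "real^'d \<Rightarrow> ennreal"
  assumes R: "orthogonal_matrix R" and f [measurable]: "f \<in> borel_measurable borel"
  shows "(\<integral>\<^sup>+x. f (R *v x) \<partial>lborel) = (\<integral>\<^sup>+x. f x \<partial>lborel)"
proof -
  let ?g = "\<lambda>x::real^'d. ennreal (\<Prod>j\<in>UNIV. std_normal_density (x $ j))"
  have shift: "(\<integral>\<^sup>+x. h (x + c) \<partial>lborel) = (\<integral>\<^sup>+x. h x \<partial>lborel)"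
    if [measurable]: "h \<in> borel_measurable borel" for h :: "real^'d \<Rightarrow> ennreal" and c
    by (subst (2) lborel_distr_plus[of c, symmetric], subst nn_integral_distr) (auto simp: add.commute)
  have refl: "(\<integral>\<^sup>+x. h (c - x) \<partial>lborel) = (\<integral>\<^sup>+x. h x \<partial>lborel)"
    if [measurable]: "h \<in> borel_measurable borel" for h :: "real^'d \<Rightarrow> ennreal" and c
    by (subst (2) lborel_affine[of "-1" c])
       (auto simp: nn_integral_density nn_integral_distr)
  have RR: "R *v (transpose R *v y) = y" for y
    using R unfolding orthogonal_matrix_def by (metis matrix_vector_mul_assoc matrix_vector_mul_lid)
  have gR: "?g (R *v x) = ?g x" for x
    by (simp only: prod_normal_density norm_orthogonal_matrix_mult[OF R])
  have g1: "(\<integral>\<^sup>+x. ?g x \<partial>lborel) = 1"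
    using nn_integral_prod_normal_density[of 1, where 'd='d] by (simp add: prod_ennreal)
  have "(\<integral>\<^sup>+x. f (R *v x) \<partial>lborel) = (\<integral>\<^sup>+x. f (R *v x) * (\<integral>\<^sup>+y. ?g (y + R *v x) \<partial>lborel) \<partial>lborel)"
    by (subst shift) (auto simp: g1)
  also have "\<dots> = (\<integral>\<^sup>+x. (\<integral>\<^sup>+y. f (R *v x) * ?g (y + R *v x) \<partial>lborel) \<partial>lborel)"
    by (intro nn_integral_cong nn_integral_cmult[symmetric]) measurable
  also have "\<dots> = (\<integral>\<^sup>+y. (\<integral>\<^sup>+x. f (R *v x) * ?g (y + R *v x) \<partial>lborel) \<partial>lborel)"
    by (rule lborel_pair.Fubini'[symmetric]) measurable
  also have "\<dots> = (\<integral>\<^sup>+y. (\<integral>\<^sup>+x. f (R *v x - y) * ?g (R *v x) \<partial>lborel) \<partial>lborel)"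
  proof (rule nn_integral_cong)
    fix y
    \<comment> \<open>Translating \<open>x\<close> by \<open>transpose R *v y\<close> adds
      \<open>y\<close> to \<open>R *v x\<close>, which moves \<open>y\<close> out of
      \<open>f\<close> and into the density.\<close>
    have "(\<integral>\<^sup>+x. f (R *v x - y) * ?g (R *v x) \<partial>lborel)
      = (\<integral>\<^sup>+x. f (R *v (x + transpose R *v y) - y) * ?g (R *v (x + transpose R *v y)) \<partial>lborel)"
      by (rule shift[symmetric]) measurable
    moreover have "\<dots> = (\<integral>\<^sup>+x. f (R *v x) * ?g (y + R *v x) \<partial>lborel)"
      by (simp only: matrix_vector_right_distrib RR add_diff_cancel_right' add.commute[of y])
    ultimately show "(\<integral>\<^sup>+x. f (R *v x) * ?g (y + R *v x) \<partial>lborel) = (\<integral>\<^sup>+x. f (R *v x - y) * ?g (R *v x) \<partial>lborel)"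
      by simp
  qed
  also have "\<dots> = (\<integral>\<^sup>+x. (\<integral>\<^sup>+y. f (R *v x - y) * ?g (R *v x) \<partial>lborel) \<partial>lborel)"
    by (rule lborel_pair.Fubini') measurable
  also have "\<dots> = (\<integral>\<^sup>+x. (\<integral>\<^sup>+y. f y \<partial>lborel) * ?g x \<partial>lborel)"
    by (intro nn_integral_cong, subst nn_integral_multc) (auto simp: refl gR)
  also have "\<dots> = (\<integral>\<^sup>+y. f y \<partial>lborel)"
    by (subst nn_integral_cmult) (auto simp: g1)
  finally show ?thesis .
qed

text \<open>Lebesgue measure and the density are both invariant. Orthogonal maps are exactly the
  ambiguity in an invertible root of a covariance matrix.\<close>

lemma distr_std_mvnormal_orthogonal:
  fixes R :: "real^'d^'d"
  assumes R: "orthogonal_matrix R"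
  shows "distr std_mvnormal borel (\<lambda>x. R *v x) = std_mvnormal"
proof (rule measure_eqI)
  fix A :: "(real^'d) set" assume "A \<in> sets (distr std_mvnormal borel (\<lambda>x. R *v x))"
  then have [measurable]: "A \<in> sets borel" by simp
  let ?g = "\<lambda>x::real^'d. ennreal (\<Prod>j\<in>UNIV. std_normal_density (x $ j))"
  have gR: "?g (R *v x) = ?g x" for x
    by (simp only: prod_normal_density norm_orthogonal_matrix_mult[OF R])
  have "emeasure (distr std_mvnormal borel (\<lambda>x. R *v x)) A = emeasure std_mvnormal ((\<lambda>x. R *v x) -` A)"
    by (simp add: emeasure_distr)
  also have "\<dots> = (\<integral>\<^sup>+x. ?g (R *v x) * indicator A (R *v x) \<partial>lborel)"
  proof -
    have "(\<lambda>x. R *v x) -` A \<in> sets borel"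
      using measurable_sets[of "\<lambda>x. R *v x" borel borel A] by simp
    then show ?thesis
      unfolding std_mvnormal_def
      by (subst emeasure_density) (auto simp: gR intro!: nn_integral_cong split: split_indicator)
  qed
  also have "\<dots> = (\<integral>\<^sup>+x. ?g x * indicator A x \<partial>lborel)"
    by (rule nn_integral_lborel_orthogonal[OF R]) measurable
  also have "\<dots> = emeasure std_mvnormal A"
    by (simp add: std_mvnormal_def emeasure_density)
  finally show "emeasure (distr std_mvnormal borel (\<lambda>x. R *v x)) A = emeasure std_mvnormal A" .
qed simp

section \<open>Roots of positive definite matrices\<close>

lemma positive_definite_symmetric:
  assumes "positive_definite S"
  shows "x \<bullet> (S *v y) = y \<bullet> (S *v x)"
  using assms unfolding positive_definite_def
  by (metis dot_lmul_matrix inner_commute transpose_matrix_vector)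

text \<open>Gram-Schmidt for the inner product given by \<open>S\<close>, by induction on the index
  set. It leads to a root of \<open>S\<close> without eigenvalues.\<close>

lemma positive_definite_orthonormal_family:
  fixes S :: "real^'d^'d" and I :: "'d set"
  assumes S: "positive_definite S"
  shows "\<exists>b. \<forall>i\<in>I. \<forall>j\<in>I. b i \<bullet> (S *v b j) = (if i = j then 1 else 0)"
proof -
  have "finite I" by simp
  then show ?thesis
  proof (induction I rule: finite_induct)
    case empty
    then show ?case by simp
  next
    case (insert k I)
    then obtain b where b: "\<And>i j. i \<in> I \<Longrightarrow> j \<in> I \<Longrightarrow> b i \<bullet> (S *v b j) = (if i = j then 1 else 0)"
      by metis
    \<comment> \<open>Fewer than \<open>CARD('d)\<close> vectors cannot span, so some
      \<open>v\<close> remains from which a nonzero orthogonal remainder \<open>u\<close> can be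
      formed.\<close>
    have "dim (b ` I) \<le> card (b ` I)"
      by (rule dim_le_card') simp
    also have "\<dots> \<le> card I"
      by (rule card_image_le) simp
    also have "\<dots> < card (UNIV :: 'd set)"
      using insert(2) by (intro psubset_card_mono) auto
    also have "\<dots> = dim (UNIV :: (real^'d) set)"
      by simp
    finally have "span (b ` I) \<noteq> UNIV"
      by (metis dim_span less_irrefl)
    then obtain v where v: "v \<notin> span (b ` I)" by blast
    define u where "u = v - (\<Sum>i\<in>I. (b i \<bullet> (S *v v)) *\<^sub>R b i)"
    have "(\<Sum>i\<in>I. (b i \<bullet> (S *v v)) *\<^sub>R b i) \<in> span (b ` I)"
      by (intro span_sum span_mul span_base) auto
    with v have "u \<noteq> 0"
      unfolding u_def by auto
    then have pos: "0 < u \<bullet> (S *v u)"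
      using S unfolding positive_definite_def by blast
    have orth: "b j \<bullet> (S *v u) = 0" if "j \<in> I" for j
    proof -
      have "b j \<bullet> (S *v u) = b j \<bullet> (S *v v) - (\<Sum>i\<in>I. (b i \<bullet> (S *v v)) * (b j \<bullet> (S *v b i)))"
        unfolding u_def
        by (simp add: matrix_vector_mult_diff_distrib inner_diff_right linear_sum[OF matrix_vector_mul_linear]
            matrix_vector_mult_scaleR inner_sum_right)
      also have "(\<Sum>i\<in>I. (b i \<bullet> (S *v v)) * (b j \<bullet> (S *v b i))) = (\<Sum>i\<in>I. if j = i then b i \<bullet> (S *v v) else 0)"
        using that by (intro sum.cong) (auto simp: b)
      also have "b j \<bullet> (S *v v) - \<dots> = 0"
        using that by simp
      finally show ?thesis .
    qed
    have orth': "u \<bullet> (S *v b j) = 0" if "j \<in> I" for j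
      using orth[OF that] positive_definite_symmetric[OF S] by metis
    define c where "c = b(k := (1 / sqrt (u \<bullet> (S *v u))) *\<^sub>R u)"
    have "c i \<bullet> (S *v c j) = (if i = j then 1 else 0)" if "i \<in> insert k I" "j \<in> insert k I" for i j
      using that insert(2) pos by (auto simp: c_def matrix_vector_mult_scaleR b orth orth')
    then show ?case by blast
  qed
qed

text \<open>Take \<open>S\<close>-orthonormal vectors as the rows of \<open>B\<close>, so that
  \<open>B S B' = 1\<close>. Then \<open>R = S B'\<close> is the inverse of \<open>B\<close>, and
  \<open>R R' = R (B S) = S\<close>.\<close>

lemma positive_definite_root:
  fixes S :: "real^'d^'d"
  assumes S: "positive_definite S"
  obtains Q :: "real^'d^'d" where "Q ** transpose Q = S"
proof -
  have sym: "transpose S = S"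
    using S by (simp add: positive_definite_def)
  obtain b :: "'d \<Rightarrow> real^'d" where b: "\<And>i j. b i \<bullet> (S *v b j) = (if i = j then 1 else 0)"
    using positive_definite_orthonormal_family[OF S, of UNIV] by auto
  define B :: "real^'d^'d" where "B = (\<chi> i. b i)"
  define R where "R = S ** transpose B"
  have "B ** R = mat 1"
  proof -
    have "(B ** R) $ i $ j = b i \<bullet> (S *v b j)" for i j
    proof -
      have "column j R = S *v b j"
        unfolding R_def
        by (simp add: vec_eq_iff column_def matrix_matrix_mult_def matrix_vector_mult_def transpose_def B_def)
      then show ?thesis
        by (simp add: matrix_matrix_mult_def inner_vec_def B_def column_def vec_eq_iff)
    qed
    then show ?thesis
      by (simp add: vec_eq_iff b mat_def)
  qed
  then have "R ** B = mat 1"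
    by (simp add: matrix_left_right_inverse)
  moreover have "transpose R = B ** S"
    by (simp add: R_def matrix_transpose_mul sym)
  ultimately have "R ** transpose R = S"
    by (simp add: matrix_mul_assoc)
  then show ?thesis
    using that by blast
qed

text \<open>A vector killed by \<open>transpose Q\<close> is killed by the product
  \<open>Q ** transpose Q\<close>, whose kernel is trivial.\<close>

lemma positive_definite_root_invertible:
  fixes Q :: "real^'d^'d"
  assumes "positive_definite (Q ** transpose Q)"
  shows "invertible Q"
proof -
  have "x = 0" if "transpose Q *v x = 0" for x
  proof -
    have "(Q ** transpose Q) *v x = 0"
      using that by (simp only: matrix_vector_mul_assoc[symmetric] matrix_vector_mult_0_right)
    then show ?thesis
      using assms unfolding positive_definite_def by force
  qed
  then have "\<exists>B. B ** transpose Q = mat 1"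
    by (simp only: matrix_left_invertible_ker) blast
  then obtain B where "B ** transpose Q = mat 1"
    by blast
  then have "transpose (B ** transpose Q) = mat 1"
    by simp
  then have "Q ** transpose B = mat 1"
    by (simp only: matrix_transpose_mul transpose_transpose)
  moreover from this have "transpose B ** Q = mat 1"
    by (rule matrix_left_right_inverse[THEN iffD1])
  ultimately show ?thesis
    unfolding invertible_def by blast
qed

text \<open>The root \<open>P\<close> selected in \<open>mvnormal\<close> and the given
  \<open>Q\<close> differ by \<open>R = C ** P\<close>, where \<open>C\<close> is the inverse of
  \<open>Q\<close>. Equality of \<open>P P'\<close> and \<open>Q Q'\<close> makes \<open>R\<close>
  orthogonal, and the standard law does not see \<open>R\<close>.\<close>

lemma integral_mvnormal:
  fixes f :: "real^'d \<Rightarrow> real" and Q :: "real^'d^'d"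
  assumes S: "positive_definite (Q ** transpose Q)" and f [measurable]: "f \<in> borel_measurable borel"
  shows "(\<integral>x. f x \<partial>mvnormal z (Q ** transpose Q)) = (\<integral>x. f (z + Q *v x) \<partial>std_mvnormal)"
proof -
  define P where "P = (SOME P :: real^'d^'d. P ** transpose P = Q ** transpose Q)"
  have P: "P ** transpose P = Q ** transpose Q"
    unfolding P_def by (rule someI) simp
  obtain C where C: "Q ** C = mat 1" "C ** Q = mat 1"
    using positive_definite_root_invertible[OF S] by (auto simp: invertible_def)
  define R where "R = C ** P"
  have "R ** transpose R = C ** (P ** transpose P) ** transpose C"
    by (simp add: R_def matrix_transpose_mul matrix_mul_assoc)
  also have "\<dots> = (C ** Q) ** transpose (C ** Q)"
    by (simp add: P matrix_transpose_mul matrix_mul_assoc)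
  finally have R: "orthogonal_matrix R"
    using C by (simp add: orthogonal_matrix_def matrix_left_right_inverse)
  have QR: "Q ** R = P"
    by (simp add: R_def matrix_mul_assoc C)
  have "(\<integral>x. f x \<partial>mvnormal z (Q ** transpose Q)) = (\<integral>x. f (z + P *v x) \<partial>std_mvnormal)"
    unfolding mvnormal_def P_def[symmetric] by (subst integral_distr) auto
  also have "\<dots> = (\<integral>x. f (z + Q *v (R *v x)) \<partial>std_mvnormal)"
    by (simp add: matrix_vector_mul_assoc QR)
  also have "\<dots> = (\<integral>x. f (z + Q *v x) \<partial>distr std_mvnormal borel (\<lambda>x. R *v x))"
    by (subst integral_distr) auto
  finally show ?thesis
    by (simp add: distr_std_mvnormal_orthogonal[OF R])
qed

text \<open>The norm of a matrix is here the Euclidean norm of its entries, so this is the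
  Cauchy-Schwarz inequality row by row.\<close>

lemma norm_matrix_vector_mult_le:
  fixes Q :: "real^'n^'m"
  shows "norm (Q *v x) \<le> norm Q * norm x"
proof -
  have "(norm (Q *v x))\<^sup>2 = (\<Sum>i\<in>UNIV. (Q $ i \<bullet> x)\<^sup>2)"
    unfolding power2_norm_eq_inner inner_vec_def matrix_vector_mult_def
    by (simp add: power2_eq_square inner_vec_def mult.commute)
  also have "\<dots> \<le> (\<Sum>i\<in>UNIV. (norm (Q $ i) * norm x)\<^sup>2)"
    by (intro sum_mono) (simp add: abs_le_square_iff[symmetric] Cauchy_Schwarz_ineq2)
  also have "\<dots> = (\<Sum>i\<in>UNIV. (norm (Q $ i))\<^sup>2) * (norm x)\<^sup>2"
    by (simp add: power_mult_distrib sum_distrib_right)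
  also have "(\<Sum>i\<in>UNIV. (norm (Q $ i))\<^sup>2) = (norm Q)\<^sup>2"
    by (simp add: power2_norm_eq_inner inner_vec_def)
  finally show ?thesis
    by (metis mult_nonneg_nonneg norm_ge_zero power2_le_imp_le power_mult_distrib)
qed

section \<open>Differentiating Gaussian integrals with respect to the mean\<close>

lemma integrable_std_mvnormal_exp_bound:
  fixes k :: "real^'d \<Rightarrow> real"
  assumes "k \<in> borel_measurable borel" and "\<And>x. \<bar>k x\<bar> \<le> C * exp (a * norm x)"
  shows "integrable std_mvnormal k"
proof (rule Bochner_Integration.integrable_bound)
  show "integrable std_mvnormal (\<lambda>x::real^'d. C * exp (a * norm x))"
    by (intro integrable_mult_right integrable_std_mvnormal_exp)
  show "k \<in> borel_measurable std_mvnormal"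
    using assms(1) by simp
  have "\<bar>k x\<bar> \<le> \<bar>C * exp (a * norm x)\<bar>" for x
    using assms(2)[of x] by linarith
  then show "AE x in std_mvnormal. norm (k x) \<le> norm (C * exp (a * norm x))"
    by simp
qed

text \<open>The translation is moved from the integrand to the density, as in the Cameron-Martin
  formula. Smoothness in \<open>v\<close> then comes from the exponential weight, although
  \<open>k\<close> is merely measurable.\<close>

lemma integral_std_mvnormal_shift:
  fixes k :: "real^'d \<Rightarrow> real"
  assumes k [measurable]: "k \<in> borel_measurable borel"
  shows "(\<integral>x. k (x + v) \<partial>std_mvnormal) = (\<integral>x. k x * exp (x \<bullet> v - (norm v)\<^sup>2 / 2) \<partial>std_mvnormal)"
proof -
  let ?g = "\<lambda>x::real^'d. \<Prod>j\<in>UNIV. std_normal_density (x $ j)"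
  have g: "?g (x - v) = ?g x * exp (x \<bullet> v - (norm v)\<^sup>2 / 2)" for x
  proof -
    have "- (norm (x - v))\<^sup>2 / 2 = - (norm x)\<^sup>2 / 2 + (x \<bullet> v - (norm v)\<^sup>2 / 2)"
      by (simp add: power2_norm_eq_inner inner_diff_left inner_diff_right inner_commute field_simps)
    then show ?thesis
      unfolding prod_normal_density by (simp add: exp_add[symmetric])
  qed
  have "(\<integral>x. k (x + v) \<partial>std_mvnormal) = (\<integral>x. ?g x * k (x + v) \<partial>lborel)"
    unfolding std_mvnormal_def by (subst integral_density) (auto simp: prod_nonneg)
  also have "\<dots> = (\<integral>x. ?g (x - v) * k x \<partial>distr lborel borel ((+) v))"
    by (subst integral_distr) (auto simp: add.commute)
  also have "\<dots> = (\<integral>x. ?g x * (k x * exp (x \<bullet> v - (norm v)\<^sup>2 / 2)) \<partial>lborel)"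
    unfolding lborel_distr_plus g by (simp add: ac_simps)
  also have "\<dots> = (\<integral>x. k x * exp (x \<bullet> v - (norm v)\<^sup>2 / 2) \<partial>std_mvnormal)"
    unfolding std_mvnormal_def by (subst integral_density) (auto simp: prod_nonneg)
  finally show ?thesis .
qed

text \<open>Everything follows from \<open>1 + u \<le> exp u\<close>. Applied to \<open>- u\<close>
  it gives \<open>exp u - 1 \<le> u * exp u\<close>, hence
  \<open>exp u - 1 - u \<le> u * (exp u - 1)\<close>, and a second application bounds the last
  factor according to the sign of \<open>u\<close>.\<close>

lemma exp_second_order_bound: "\<bar>exp u - 1 - u\<bar> \<le> u\<^sup>2 * exp \<bar>u\<bar>" for u :: real
proof -
  have "1 - u \<le> exp (- u)"
    using exp_ge_add_one_self[of "- u"] by simp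
  then have "(1 - u) * exp u \<le> 1"
    by (metis exp_ge_zero exp_minus_inverse mult.commute mult_left_mono)
  then have le: "exp u - 1 \<le> u * exp u"
    by (simp add: algebra_simps)
  have "exp u - 1 - u \<le> u\<^sup>2 * exp \<bar>u\<bar>"
  proof (cases "0 \<le> u")
    case True
    then have "u * (exp u - 1) \<le> u * (u * exp u)"
      using le by (intro mult_left_mono)
    with le True show ?thesis
      by (simp add: power2_eq_square algebra_simps)
  next
    case False
    have "u * (exp u - 1) \<le> u * u"
    proof (rule mult_left_mono_neg)
      show "u \<le> exp u - 1"
        using exp_ge_add_one_self[of u] by linarith
    qed (use False in simp)
    moreover have "u\<^sup>2 * 1 \<le> u\<^sup>2 * exp \<bar>u\<bar>"
      by (intro mult_left_mono) auto
    ultimately show ?thesis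
      using le by (simp add: power2_eq_square algebra_simps)
  qed
  moreover have "0 \<le> exp u - 1 - u"
    using exp_ge_add_one_self[of u] by linarith
  ultimately show ?thesis by linarith
qed

text \<open>The Cameron-Martin weight is \<open>1 + x \<bullet> v\<close> up to an error of order
  \<open>(norm v)^2\<close> with an exponentially bounded factor in \<open>x\<close>. The linear
  term is the derivative, and the error is integrable against \<open>k\<close>.\<close>

lemma std_mvnormal_shift_has_derivative:
  fixes k :: "real^'d \<Rightarrow> real"
  assumes k [measurable]: "k \<in> borel_measurable borel" and bound: "\<And>x. \<bar>k x\<bar> \<le> C * exp (a * norm x)"
  shows "((\<lambda>v. \<integral>x. k (x + v) \<partial>std_mvnormal) has_derivative
      (\<lambda>v. \<integral>x. k x * (x \<bullet> v) \<partial>std_mvnormal)) (at 0)"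
proof -
  have C: "0 \<le> C"
    using bound[of 0] by simp
  have norm1: "1 + t \<le> exp t" for t :: real
    using exp_ge_add_one_self[of t] by simp
  have lin_bound: "\<bar>k x * (x \<bullet> v)\<bar> \<le> (C * norm v) * exp ((a + 1) * norm x)" for x v
  proof -
    have "\<bar>x \<bullet> v\<bar> \<le> norm x * norm v"
      by (rule Cauchy_Schwarz_ineq2)
    also have "\<dots> \<le> exp (norm x) * norm v"
      using norm1[of "norm x"] by (intro mult_right_mono norm_ge_zero) linarith
    finally have "\<bar>k x\<bar> * \<bar>x \<bullet> v\<bar> \<le> (C * exp (a * norm x)) * (exp (norm x) * norm v)"
      using C by (intro mult_mono bound) auto
    then show ?thesis
      by (simp add: abs_mult exp_add ring_distribs ac_simps)
  qed
  have int_lin: "integrable std_mvnormal (\<lambda>x. k x * (x \<bullet> v))" for v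
    by (rule integrable_std_mvnormal_exp_bound[OF _ lin_bound]) measurable
  have int_k: "integrable std_mvnormal k"
    by (rule integrable_std_mvnormal_exp_bound[OF _ bound]) measurable
  \<comment> \<open>Of the exponent \<open>3 * norm x\<close>, two parts bound the square of
    \<open>1 + norm x\<close> and one comes from the exponential factor of the remainder. The factor
    \<open>2\<close> absorbs the term \<open>(norm v)^2 / 2\<close> by which the exponent differs
    from \<open>x \<bullet> v\<close>.\<close>
  have exp_bound: "\<bar>exp (x \<bullet> v - (norm v)\<^sup>2 / 2) - 1 - x \<bullet> v\<bar> \<le> (norm v)\<^sup>2 * (2 * exp 1 * exp (3 * norm x))"
    if v: "norm v \<le> 1" for x v :: "real^'d"
  proof -
    let ?u = "x \<bullet> v - (norm v)\<^sup>2 / 2"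
    have v2: "(norm v)\<^sup>2 \<le> norm v"
      using v by (simp add: power2_eq_square mult_left_le)
    have "\<bar>?u\<bar> \<le> norm x * norm v + (norm v)\<^sup>2"
      using Cauchy_Schwarz_ineq2[of x v] zero_le_power2[of "norm v"] by linarith
    then have u: "\<bar>?u\<bar> \<le> norm v * (1 + norm x)"
      using v2 by (simp add: algebra_simps)
    then have u1: "\<bar>?u\<bar> \<le> 1 + norm x"
      using v mult_right_mono[of "norm v" 1 "1 + norm x"] by simp
    have "\<bar>exp ?u - 1 - ?u\<bar> \<le> ?u\<^sup>2 * exp \<bar>?u\<bar>"
      by (rule exp_second_order_bound)
    also have "\<dots> \<le> (norm v * (1 + norm x))\<^sup>2 * exp (1 + norm x)"
      using u u1 by (intro mult_mono) (auto simp: abs_le_square_iff[symmetric])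
    also have "\<dots> \<le> (norm v)\<^sup>2 * (exp (norm x))\<^sup>2 * exp (1 + norm x)"
      unfolding power_mult_distrib using norm1[of "norm x"]
      by (intro mult_right_mono mult_left_mono power_mono) auto
    also have "\<dots> = (norm v)\<^sup>2 * (exp 1 * exp (3 * norm x))"
      by (simp add: power2_eq_square exp_add[symmetric])
    finally have "\<bar>exp ?u - 1 - x \<bullet> v\<bar> \<le> (norm v)\<^sup>2 * (exp 1 * exp (3 * norm x)) + (norm v)\<^sup>2 / 2"
      using zero_le_power2[of "norm v"] by linarith
    also have "\<dots> \<le> (norm v)\<^sup>2 * (exp 1 * exp (3 * norm x)) + (norm v)\<^sup>2 * (exp 1 * exp (3 * norm x))"
    proof -
      have "1 / 2 \<le> exp (1 + 3 * norm x)"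
        using norm1[of "1 + 3 * norm x"] norm_ge_zero[of x] by linarith
      then have "(norm v)\<^sup>2 * (1 / 2) \<le> (norm v)\<^sup>2 * exp (1 + 3 * norm x)"
        by (intro mult_left_mono) auto
      then show ?thesis by (simp add: exp_add ac_simps)
    qed
    finally show ?thesis by (simp add: ac_simps)
  qed
  define B where "B = (\<integral>x. (2 * exp 1 * C) * exp ((a + 3) * norm x) \<partial>(std_mvnormal :: (real^'d) measure))"
  show ?thesis
  proof (rule has_derivativeI_sandwich[where e = 1 and H = "\<lambda>v. B * norm v"])
    show "bounded_linear (\<lambda>v. \<integral>x. k x * (x \<bullet> v) \<partial>std_mvnormal)"
      unfolding linear_conv_bounded_linear[symmetric]
      by (rule linearI) (simp_all add: int_lin inner_add_right distrib_left mult.left_commute)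
    show "((\<lambda>v. B * norm v) \<longlongrightarrow> 0) (at 0)"
      by (auto intro!: tendsto_eq_intros)
  next
    fix v :: "real^'d" assume v: "v \<noteq> 0" "dist v 0 < 1"
    have bd: "\<bar>k x * (exp (x \<bullet> v - (norm v)\<^sup>2 / 2) - 1 - x \<bullet> v)\<bar>
        \<le> (norm v)\<^sup>2 * ((2 * exp 1 * C) * exp ((a + 3) * norm x))" for x
    proof -
      have "\<bar>k x\<bar> * \<bar>exp (x \<bullet> v - (norm v)\<^sup>2 / 2) - 1 - x \<bullet> v\<bar>
          \<le> (C * exp (a * norm x)) * ((norm v)\<^sup>2 * (2 * exp 1 * exp (3 * norm x)))"
        using C v by (intro mult_mono bound exp_bound) auto
      also have "\<dots> = (norm v)\<^sup>2 * ((2 * exp 1 * C) * exp ((a + 3) * norm x))"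
        by (simp add: exp_add ring_distribs ac_simps)
      finally show ?thesis
        by (simp only: abs_mult)
    qed
    then have int_rem: "integrable std_mvnormal (\<lambda>x. k x * (exp (x \<bullet> v - (norm v)\<^sup>2 / 2) - 1 - x \<bullet> v))"
      by (intro integrable_std_mvnormal_exp_bound[where C = "(norm v)\<^sup>2 * (2 * exp 1 * C)" and a = "a + 3"])
         (auto simp: mult.assoc)
    have "(\<integral>x. k (x + v) \<partial>std_mvnormal)
        = (\<integral>x. k x * (exp (x \<bullet> v - (norm v)\<^sup>2 / 2) - 1 - x \<bullet> v) + (k x + k x * (x \<bullet> v)) \<partial>std_mvnormal)"
      unfolding integral_std_mvnormal_shift[OF k] by (simp add: algebra_simps)
    also have "\<dots> = (\<integral>x. k x * (exp (x \<bullet> v - (norm v)\<^sup>2 / 2) - 1 - x \<bullet> v) \<partial>std_mvnormal)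
        + ((\<integral>x. k x \<partial>std_mvnormal) + (\<integral>x. k x * (x \<bullet> v) \<partial>std_mvnormal))"
      using int_rem int_k int_lin by simp
    finally have "norm ((\<integral>x. k (x + v) \<partial>std_mvnormal) - (\<integral>x. k (x + 0) \<partial>std_mvnormal)
        - (\<integral>x. k x * (x \<bullet> (v - 0)) \<partial>std_mvnormal))
        = \<bar>\<integral>x. k x * (exp (x \<bullet> v - (norm v)\<^sup>2 / 2) - 1 - x \<bullet> v) \<partial>std_mvnormal\<bar>"
      by simp
    also have "\<dots> \<le> (\<integral>x. \<bar>k x * (exp (x \<bullet> v - (norm v)\<^sup>2 / 2) - 1 - x \<bullet> v)\<bar> \<partial>std_mvnormal)"
      by (rule integral_abs_bound)
    also have "\<dots> \<le> (\<integral>x. (norm v)\<^sup>2 * ((2 * exp 1 * C) * exp ((a + 3) * norm x)) \<partial>(std_mvnormal :: (real^'d) measure))"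
    proof (rule integral_mono)
      show "integrable std_mvnormal (\<lambda>x. \<bar>k x * (exp (x \<bullet> v - (norm v)\<^sup>2 / 2) - 1 - x \<bullet> v)\<bar>)"
        by (rule integrable_abs[OF int_rem])
      show "integrable std_mvnormal (\<lambda>x::real^'d. (norm v)\<^sup>2 * ((2 * exp 1 * C) * exp ((a + 3) * norm x)))"
        by (intro integrable_mult_right integrable_std_mvnormal_exp)
    qed (rule bd)
    also have "\<dots> = (norm v)\<^sup>2 * B"
      by (simp add: B_def)
    finally show "norm ((\<integral>x. k (x + v) \<partial>std_mvnormal) - (\<integral>x. k (x + 0) \<partial>std_mvnormal)
        - (\<integral>x. k x * (x \<bullet> (v - 0)) \<partial>std_mvnormal)) / norm (v - 0) \<le> B * norm v"
      using v by (simp add: divide_le_eq power2_eq_square mult.commute mult.left_commute)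
  qed simp
qed

text \<open>
  Differentiating in the mean under the density, applied in the direction \<open>S h\<close>, is Gaussian
  integration by parts; writing it this way avoids the inverse of \<open>S\<close>.
\<close>

lemma mvnormal_mean_has_derivative:
  fixes f :: "real^'d \<Rightarrow> real"
  assumes S: "positive_definite S"
    and f [measurable]: "f \<in> borel_measurable borel" and bound: "\<And>x. \<bar>f x\<bar> \<le> C * exp (a * norm x)" and a: "0 \<le> a"
  obtains D where "((\<lambda>z. \<integral>x. f x \<partial>mvnormal z S) has_derivative D) (at z0)"
    and "\<And>h. D (S *v h) = (\<integral>x. f (z0 + x) * (x \<bullet> h) \<partial>mvnormal 0 S)"
proof -
  obtain Q :: "real^'d^'d" where Q: "Q ** transpose Q = S"
    using positive_definite_root[OF S] .
  obtain R where R: "Q ** R = mat 1" "R ** Q = mat 1"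
    using positive_definite_root_invertible[of Q] S Q by (auto simp: invertible_def)
  note int = integral_mvnormal[of Q, unfolded Q, OF S]
  let ?k = "\<lambda>x. f (z0 + Q *v x)"
  have C: "0 \<le> C"
    using bound[of 0] by simp
  have kb: "\<bar>?k x\<bar> \<le> (C * exp (a * norm z0)) * exp ((a * norm Q) * norm x)" for x
  proof -
    have "norm (z0 + Q *v x) \<le> norm z0 + norm Q * norm x"
      using norm_triangle_ineq[of z0 "Q *v x"] norm_matrix_vector_mult_le[of Q x] by linarith
    then have "a * norm (z0 + Q *v x) \<le> a * norm z0 + (a * norm Q) * norm x"
      using a mult_left_mono by (fastforce simp: algebra_simps)
    then have "C * exp (a * norm (z0 + Q *v x)) \<le> C * exp (a * norm z0 + (a * norm Q) * norm x)"
      using C by (intro mult_left_mono) auto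
    then show ?thesis
      using bound[of "z0 + Q *v x"] by (simp add: exp_add mult.assoc)
  qed
  \<comment> \<open>Since \<open>R\<close> inverts \<open>Q\<close>,
    \<open>z + Q x = z0 + Q (x + R (z - z0))\<close>: moving the mean is a translation of the
    standard normal variable.\<close>
  have "((\<lambda>z. \<integral>x. ?k (x + R *v (z - z0)) \<partial>std_mvnormal) has_derivative
     (\<lambda>h. \<integral>x. ?k x * (x \<bullet> (R *v h)) \<partial>std_mvnormal)) (at z0)"
  proof -
    have "((\<lambda>z. R *v (z - z0)) has_derivative (\<lambda>h. R *v h)) (at z0)"
      by (intro bounded_linear.has_derivative[OF matrix_vector_mul_bounded_linear] derivative_eq_intros) auto
    moreover have "((\<lambda>v. \<integral>x. ?k (x + v) \<partial>std_mvnormal) has_derivative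
        (\<lambda>v. \<integral>x. ?k x * (x \<bullet> v) \<partial>std_mvnormal)) (at (R *v (z0 - z0)))"
      using std_mvnormal_shift_has_derivative[OF _ kb] by simp
    ultimately show ?thesis
      using has_derivative_compose by fast
  qed
  moreover have "(\<integral>x. ?k (x + R *v (z - z0)) \<partial>std_mvnormal) = (\<integral>x. f x \<partial>mvnormal z S)" for z
  proof -
    have "z0 + Q *v (x + R *v (z - z0)) = z + Q *v x" for x
      by (simp add: matrix_vector_right_distrib matrix_vector_mul_assoc R)
    then show ?thesis
      by (simp add: int)
  qed
  ultimately have "((\<lambda>z. \<integral>x. f x \<partial>mvnormal z S) has_derivative
     (\<lambda>h. \<integral>x. ?k x * (x \<bullet> (R *v h)) \<partial>std_mvnormal)) (at z0)"
    by simp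
  moreover have "(\<integral>x. ?k x * (x \<bullet> (R *v (S *v h))) \<partial>std_mvnormal)
      = (\<integral>x. f (z0 + x) * (x \<bullet> h) \<partial>mvnormal 0 S)" for h
  proof -
    have "R *v (S *v h) = transpose Q *v h"
      unfolding Q[symmetric] by (simp only: matrix_vector_mul_assoc matrix_mul_assoc R matrix_mul_lid)
    moreover have "x \<bullet> (transpose Q *v h) = (Q *v x) \<bullet> h" for x
      by (metis dot_lmul_matrix inner_commute transpose_matrix_vector transpose_transpose)
    ultimately show ?thesis
      by (simp add: int)
  qed
  ultimately show ?thesis
    using that by blast
qed

text \<open>The mean is fixed at zero because a variable mean can be made part of the parameter
  \<open>p\<close>, through an integrand such as \<open>f (z + x)\<close>. All integrals are pulled
  back to the fixed standard law, where dominated convergence applies.\<close>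

lemma continuous_on_mvnormal_integral:
  fixes k :: "'p::metric_space \<Rightarrow> real^'d \<Rightarrow> real"
  assumes k: "continuous_on (D \<times> UNIV) (\<lambda>(p, x). k p x)"
    and B: "continuous_on D B" and a: "0 \<le> a"
    and bound: "\<And>p x. p \<in> D \<Longrightarrow> \<bar>k p x\<bar> \<le> B p * exp (a * norm x)"
  shows "continuous_on (D \<times> Collect positive_definite) (\<lambda>(p, S). \<integral>x. k p x \<partial>mvnormal 0 S)"
proof (rule continuous_on_sequentiallyI)
  fix u and q :: "'p \<times> (real^'d^'d)"
  assume u: "\<forall>n. u n \<in> D \<times> Collect positive_definite" and q: "q \<in> D \<times> Collect positive_definite"
    and lim: "u \<longlonglongrightarrow> q"
  let ?I = "\<lambda>(p, S). \<integral>x. k p x \<partial>mvnormal 0 S"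
  define p S where "p n = fst (u n)" and "S n = snd (u n)" for n
  have p: "p n \<in> D" and S: "positive_definite (S n)" for n
    using u by (auto simp: p_def S_def mem_Times_iff)
  have p_lim: "p \<longlonglongrightarrow> fst q" and S_lim: "S \<longlonglongrightarrow> snd q"
    using lim unfolding p_def S_def by (auto intro!: tendsto_intros)
  have [measurable]: "k r \<in> borel_measurable borel" if "r \<in> D" for r
  proof -
    have "continuous_on UNIV ((\<lambda>(p, x). k p x) \<circ> (\<lambda>x. (r, x)))"
      using that by (intro continuous_on_compose continuous_intros continuous_on_subset[OF k]) auto
    then show ?thesis
      by (intro borel_measurable_continuous_onI) (simp add: o_def)
  qed
  have "\<exists>Q::real^'d^'d. Q ** transpose Q = S n" for n
    using positive_definite_root[OF S] by blast
  then obtain Q :: "nat \<Rightarrow> real^'d^'d" where Q: "\<And>n. Q n ** transpose (Q n) = S n"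
    by metis
  have int: "?I (r, P ** transpose P) = (\<integral>x. k r (P *v x) \<partial>std_mvnormal)"
    if "r \<in> D" "positive_definite (P ** transpose P)" for r and P :: "real^'d^'d"
    using that by (simp add: integral_mvnormal)
  \<comment> \<open>The squared norm of a root is the trace of the matrix, so roots along a
    convergent sequence stay bounded.\<close>
  have normQ: "(norm (Q n))\<^sup>2 = (\<Sum>i\<in>UNIV. S n $ i $ i)" for n
    unfolding Q[symmetric] by (simp add: power2_norm_eq_inner inner_vec_def matrix_matrix_mult_def transpose_def)
  have "(\<lambda>n. \<Sum>i\<in>UNIV. S n $ i $ i) \<longlonglongrightarrow> (\<Sum>i\<in>UNIV. snd q $ i $ i)"
    by (intro tendsto_intros S_lim)
  then have "Bseq (\<lambda>n. (norm (Q n))\<^sup>2)"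
    unfolding normQ by (intro convergent_imp_Bseq) (auto simp: convergent_def)
  then obtain K0 where K0: "\<And>n. (norm (Q n))\<^sup>2 \<le> K0"
    by (auto simp: Bseq_def)
  define K where "K = sqrt K0"
  have K: "norm (Q n) \<le> K" for n
    unfolding K_def by (rule real_le_rsqrt[OF K0])
  have "(\<lambda>n. B (p n)) \<longlonglongrightarrow> B (fst q)"
    using continuous_on_tendsto_compose[OF B p_lim] q p by (auto simp: mem_Times_iff)
  then have "Bseq (\<lambda>n. B (p n))"
    by (intro convergent_imp_Bseq) (auto simp: convergent_def)
  then obtain b where b: "\<And>n. \<bar>B (p n)\<bar> \<le> b"
    by (auto simp: Bseq_def)
  \<comment> \<open>Convergence is first shown along indices for which the chosen roots converge;
    their limit \<open>P\<close> is then a root of the limiting matrix.\<close>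
  have sub: "(\<lambda>n. ?I (u (r n))) \<longlonglongrightarrow> ?I q" if r: "strict_mono r" and Qr: "(Q \<circ> r) \<longlonglongrightarrow> P" for r P
  proof -
    have "(\<lambda>n. (Q \<circ> r) n ** transpose ((Q \<circ> r) n)) \<longlonglongrightarrow> P ** transpose P"
      unfolding matrix_matrix_mult_def transpose_def by (intro tendsto_intros Qr)
    moreover have "(\<lambda>n. (Q \<circ> r) n ** transpose ((Q \<circ> r) n)) \<longlonglongrightarrow> snd q"
      using LIMSEQ_subseq_LIMSEQ[OF S_lim r] by (simp add: Q o_def)
    ultimately have P: "P ** transpose P = snd q"
      by (rule LIMSEQ_unique)
    have "(\<lambda>n. \<integral>x. k (p (r n)) (Q (r n) *v x) \<partial>std_mvnormal) \<longlonglongrightarrow> (\<integral>x. k (fst q) (P *v x) \<partial>std_mvnormal)"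
    proof (rule integral_dominated_convergence[where w = "\<lambda>x. b * exp ((a * K) * norm x)"])
      show "integrable (std_mvnormal :: (real^'d) measure) (\<lambda>x. b * exp ((a * K) * norm x))"
        by (intro integrable_mult_right integrable_std_mvnormal_exp)
      show "(\<lambda>x. k (p (r n)) (Q (r n) *v x)) \<in> borel_measurable std_mvnormal" for n
        using p by measurable
      show "(\<lambda>x. k (fst q) (P *v x)) \<in> borel_measurable std_mvnormal"
        using q by (auto simp: mem_Times_iff)
      show "AE x in std_mvnormal. (\<lambda>n. k (p (r n)) (Q (r n) *v x)) \<longlonglongrightarrow> k (fst q) (P *v x)"
      proof (rule AE_I2)
        fix x :: "real^'d"
        have "(\<lambda>n. (p (r n), Q (r n) *v x)) \<longlonglongrightarrow> (fst q, P *v x)"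
          using LIMSEQ_subseq_LIMSEQ[OF p_lim r] Qr
          unfolding matrix_vector_mult_def by (intro tendsto_intros) (auto simp: o_def)
        from continuous_on_tendsto_compose[OF k this] show "(\<lambda>n. k (p (r n)) (Q (r n) *v x)) \<longlonglongrightarrow> k (fst q) (P *v x)"
          using p q by (auto simp: mem_Times_iff)
      qed
      show "AE x in std_mvnormal. norm (k (p (r n)) (Q (r n) *v x)) \<le> b * exp ((a * K) * norm x)" for n
      proof (rule AE_I2)
        fix x :: "real^'d"
        have "norm (Q (r n) *v x) \<le> K * norm x"
          using norm_matrix_vector_mult_le[of "Q (r n)" x] mult_right_mono[OF K[of "r n"], of "norm x"] by simp
        then have "a * norm (Q (r n) *v x) \<le> (a * K) * norm x"
          using mult_left_mono[OF _ a] by (fastforce simp: mult.assoc)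
        moreover have "B (p (r n)) \<le> b" "0 \<le> b"
          using b[of "r n"] by auto
        ultimately have "B (p (r n)) * exp (a * norm (Q (r n) *v x)) \<le> b * exp ((a * K) * norm x)"
          by (intro mult_mono) auto
        then show "norm (k (p (r n)) (Q (r n) *v x)) \<le> b * exp ((a * K) * norm x)"
          using bound[OF p[of "r n"], of "Q (r n) *v x"] by simp
      qed
    qed
    moreover have "?I (u (r n)) = (\<integral>x. k (p (r n)) (Q (r n) *v x) \<partial>std_mvnormal)" for n
      using int[of "p (r n)" "Q (r n)"] p S by (simp add: Q p_def S_def)
    moreover have "?I q = (\<integral>x. k (fst q) (P *v x) \<partial>std_mvnormal)"
      using int[of "fst q" P] q by (simp add: P mem_Times_iff)
    ultimately show ?thesis by simp
  qed
  show "(\<lambda>n. ?I (u n)) \<longlonglongrightarrow> ?I q"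
  \<comment> \<open>A subsequence staying at distance \<open>e\<close> from the limit would have, by
    compactness, a further subsequence with convergent roots, against \<open>sub\<close>.\<close>
  proof (rule ccontr)
    assume "\<not> ?thesis"
    then obtain e where e: "e > 0" "\<not> (\<forall>\<^sub>F n in sequentially. dist (?I (u n)) (?I q) < e)"
      by (auto simp: tendsto_iff)
    obtain r :: "nat \<Rightarrow> nat" where r: "strict_mono r" "\<And>n. \<not> dist (?I (u (r n))) (?I q) < e"
      using not_eventually_sequentiallyD[OF e(2)] by blast
    have "bounded (range (Q \<circ> r))"
      using K by (auto simp: bounded_iff)
    then obtain P s where s: "strict_mono s" "(Q \<circ> r \<circ> s) \<longlonglongrightarrow> P"
      using bounded_imp_convergent_subsequence by blast
    have "(\<lambda>n. ?I (u ((r \<circ> s) n))) \<longlonglongrightarrow> ?I q"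
      using s r by (intro sub[where P = P]) (simp_all only: strict_mono_o o_assoc)
    then have "\<forall>\<^sub>F n in sequentially. dist (?I (u ((r \<circ> s) n))) (?I q) < e"
      using e(1) by (rule tendstoD)
    then show False
      using r(2) by (auto simp: eventually_sequentially)
  qed
qed

section \<open>Gaussian means of the rate functions\<close>

text \<open>The factor \<open>1\<close> keeps the bound in the shape
  \<open>C * exp (a * norm x)\<close> that the Gaussian lemmas expect.\<close>

lemma linear_growth_exp:
  fixes C :: real
  assumes "\<And>x. \<bar>h x\<bar> \<le> C * (1 + norm (x::'a::real_normed_vector))"
  shows "\<bar>h x\<bar> \<le> C * exp (1 * norm x)"
proof -
  have "0 \<le> C"
    using assms[of 0] by simp
  then have "C * (1 + norm x) \<le> C * exp (norm x)"
    by (intro mult_left_mono exp_ge_add_one_self)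
  with assms[of x] show ?thesis
    by simp
qed

lemma sets_mvnormal [measurable_cong, simp]: "sets (mvnormal z S) = sets borel"
  and space_mvnormal [simp]: "space (mvnormal z S) = UNIV"
  by (auto simp: mvnormal_def)

lemma prob_space_mvnormal: "prob_space (mvnormal z S :: (real^'d) measure)"
  unfolding mvnormal_def by (rule prob_space.prob_space_distr[OF prob_space_std_mvnormal]) measurable

text \<open>Whatever matrix \<open>P\<close> the choice in \<open>mvnormal\<close> yields, composing
  \<open>k\<close> with it only multiplies the rate \<open>a\<close> by
  \<open>norm P\<close>.\<close>

lemma integrable_mvnormal_exp_bound:
  fixes k :: "real^'d \<Rightarrow> real"
  assumes [measurable]: "k \<in> borel_measurable borel" and bound: "\<And>x. \<bar>k x\<bar> \<le> C * exp (a * norm x)" and a: "0 \<le> a"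
  shows "integrable (mvnormal 0 S) k"
proof -
  define P where "P = (SOME P :: real^'d^'d. P ** transpose P = S)"
  have C: "0 \<le> C"
    using bound[of 0] by simp
  have "integrable std_mvnormal (\<lambda>x. k (0 + P *v x))"
  proof (rule integrable_std_mvnormal_exp_bound)
    fix x :: "real^'d"
    have "C * exp (a * norm (P *v x)) \<le> C * exp (a * (norm P * norm x))"
      using C a norm_matrix_vector_mult_le[of P x] by (intro mult_left_mono) (auto intro: mult_left_mono)
    then show "\<bar>k (0 + P *v x)\<bar> \<le> C * exp ((a * norm P) * norm x)"
      using bound[of "P *v x"] by (simp add: mult.assoc)
  qed measurable
  then show ?thesis
    unfolding mvnormal_def P_def[symmetric] by (subst integrable_distr_eq) auto
qed

lemma integral_mvnormal_shift:
  fixes f :: "real^'d \<Rightarrow> real"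
  assumes S: "positive_definite S" and [measurable]: "f \<in> borel_measurable borel"
  shows "(\<integral>x. f x \<partial>mvnormal z S) = (\<integral>x. f (z + x) \<partial>mvnormal 0 S)"
proof -
  obtain Q :: "real^'d^'d" where Q: "Q ** transpose Q = S"
    using positive_definite_root[OF S] .
  show ?thesis
    using integral_mvnormal[of Q f z] integral_mvnormal[of Q "\<lambda>x. f (z + x)" 0] S by (simp add: Q)
qed

locale rate_functions =
  fixes T :: real
    and l :: "'k::finite \<Rightarrow> int ^ 'd"
    and f :: "'k \<Rightarrow> real \<Rightarrow> real ^ 'd \<Rightarrow> real"
    and C :: "'k \<Rightarrow> real" and K :: real
  assumes f_cont: "\<And>i. continuous_on ({0..T} \<times> UNIV) (\<lambda>(t, x). f i t x)"
    and f_growth: "\<And>i t x. t \<in> {0..T} \<Longrightarrow> \<bar>f i t x\<bar> \<le> C i * (1 + norm x)"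
    and F_lipschitz:
      "\<And>t x y. t \<in> {0..T} \<Longrightarrow> norm (drift l f t x - drift l f t y) \<le> K * norm (x - y)"
begin

lemma f_measurable:
  assumes "t \<in> {0..T}"
  shows "f i t \<in> borel_measurable borel"
proof -
  have "continuous_on UNIV ((\<lambda>(t, x). f i t x) \<circ> (\<lambda>x. (t, x)))"
    using assms by (intro continuous_on_compose continuous_intros continuous_on_subset[OF f_cont]) auto
  then show ?thesis
    by (intro borel_measurable_continuous_onI) (simp add: o_def)
qed

lemma f_exp_bound:
  assumes "t \<in> {0..T}"
  shows "\<bar>f i t x\<bar> \<le> C i * exp (1 * norm x)"
  by (rule linear_growth_exp) (rule f_growth[OF assms])

lemma C_nonneg:
  assumes "t \<in> {0..T}"
  shows "0 \<le> C i"
  using f_growth[OF assms, of i 0] by simp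

lemma f_shift_exp_bound:
  assumes "t \<in> {0..T}"
  shows "\<bar>f i t (z + x)\<bar> \<le> (C i * exp (norm z)) * exp (1 * norm x)"
proof -
  have "C i * exp (norm (z + x)) \<le> C i * exp (norm z + norm x)"
    using C_nonneg[OF assms] norm_triangle_ineq by (intro mult_left_mono) auto
  with f_exp_bound[OF assms, of i "z + x"] show ?thesis
    by (simp add: exp_add mult.assoc)
qed

lemma f_moment_exp_bound:
  assumes "t \<in> {0..T}"
  shows "\<bar>f i t (z + x) * x $ b\<bar> \<le> (C i * exp (norm z)) * exp (2 * norm x)"
proof -
  have "\<bar>x $ b\<bar> \<le> exp (norm x)"
    using component_le_norm_cart[of x b] exp_ge_add_one_self[of "norm x"] by linarith
  then have "\<bar>f i t (z + x)\<bar> * \<bar>x $ b\<bar> \<le> ((C i * exp (norm z)) * exp (1 * norm x)) * exp (norm x)"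
    using C_nonneg[OF assms] by (intro mult_mono f_shift_exp_bound[OF assms]) auto
  also have "\<dots> = (C i * exp (norm z)) * exp (2 * norm x)"
    by (simp add: exp_add[symmetric] mult.assoc)
  finally show ?thesis
    by (simp add: abs_mult)
qed

lemma gauss_rate_shift:
  assumes "t \<in> {0..T}" and "positive_definite S"
  shows "gauss_rate f i t z S = (\<integral>x. f i t (z + x) \<partial>mvnormal 0 S)"
  unfolding gauss_rate_def by (rule integral_mvnormal_shift[OF assms(2) f_measurable[OF assms(1)]])

lemma continuous_on_f_shift:
  "continuous_on (({0..T} \<times> UNIV) \<times> UNIV) (\<lambda>(p, x). f i (fst p) (snd p + x))"
proof -
  have "continuous_on (({0..T} \<times> UNIV) \<times> UNIV) (\<lambda>q. (\<lambda>(t, x). f i t x) (fst (fst q), snd (fst q) + snd q))"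
    by (rule continuous_on_compose2[OF f_cont]) (auto intro!: continuous_intros)
  then show ?thesis
    by (simp add: case_prod_beta)
qed

lemma continuous_on_gauss_rate:
  "continuous_on (({0..T} \<times> UNIV) \<times> Collect positive_definite) (\<lambda>(p, S). gauss_rate f i (fst p) (snd p) S)"
proof -
  have "continuous_on (({0..T} \<times> UNIV) \<times> Collect positive_definite)
      (\<lambda>(p, S). \<integral>x. f i (fst p) (snd p + x) \<partial>mvnormal 0 S)"
    by (rule continuous_on_mvnormal_integral[where B = "\<lambda>p. C i * exp (norm (snd p))" and a = 1])
      (use continuous_on_f_shift f_shift_exp_bound in \<open>auto intro!: continuous_intros\<close>)
  then show ?thesis
    by (rule continuous_on_cong[THEN iffD1, rotated 2]) (auto simp: gauss_rate_shift)
qed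

text \<open>For positive definite \<open>S\<close>, integration by parts makes this the
  \<open>b\<close>-th entry of \<open>S\<close> applied to the gradient of \<open>gauss_rate\<close>
  in \<open>z\<close>. In this form joint continuity in all arguments can be read off from the
  integral.\<close>

definition moment :: "'k \<Rightarrow> real \<Rightarrow> real ^ 'd \<Rightarrow> real ^ 'd ^ 'd \<Rightarrow> 'd \<Rightarrow> real" where
  "moment i t z S b = (\<integral>x. f i t (z + x) * x $ b \<partial>mvnormal 0 S)"

lemma continuous_on_moment:
  "continuous_on (({0..T} \<times> UNIV) \<times> Collect positive_definite) (\<lambda>(p, S). moment i (fst p) (snd p) S b)"
  unfolding moment_def
proof (rule continuous_on_mvnormal_integral[where B = "\<lambda>p. C i * exp (norm (snd p))" and a = 2])
  have "continuous_on (({0..T} \<times> UNIV) \<times> UNIV)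
      (\<lambda>q. (\<lambda>(p, x). f i (fst p) (snd p + x)) q * snd q $ b)"
    by (intro continuous_on_mult continuous_on_f_shift continuous_intros)
  then show "continuous_on (({0..T} \<times> UNIV) \<times> UNIV) (\<lambda>(p, x). f i (fst p) (snd p + x) * x $ b)"
    by (simp add: case_prod_beta)
qed (use f_moment_exp_bound in \<open>auto intro!: continuous_intros\<close>)

lemma integrable_f_shift:
  assumes "t \<in> {0..T}"
  shows "integrable (mvnormal 0 S) (\<lambda>x. f i t (z + x))"
proof (rule integrable_mvnormal_exp_bound[OF _ f_shift_exp_bound[OF assms]])
  note [measurable] = f_measurable[OF assms]
  show "(\<lambda>x. f i t (z + x)) \<in> borel_measurable borel" by measurable
qed simp

section \<open>The averaged drift and its Jacobian\<close>

lemma gauss_drift_component: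
  assumes "t \<in> {0..T}" and "positive_definite S"
  shows "gauss_drift l f t z S $ a = (\<integral>x. drift l f t (z + x) $ a \<partial>mvnormal 0 S)"
  unfolding gauss_drift_def drift_def using assms integrable_f_shift[OF assms(1)]
  by (simp add: gauss_rate_shift)

text \<open>Both values are averages over the same noise \<open>x\<close>, so the Lipschitz constant
  passes through the integral. It is a property of the weighted sum and not of the single rates,
  hence the detour through components of \<open>drift\<close>.\<close>

lemma gauss_drift_lipschitz:
  assumes t: "t \<in> {0..T}" and S: "positive_definite S"
  shows "\<bar>gauss_drift l f t z S $ a - gauss_drift l f t w S $ a\<bar> \<le> K * norm (z - w)"
proof -
  interpret prob_space "mvnormal 0 S :: (real^'d) measure"
    by (rule prob_space_mvnormal)
  have int: "integrable (mvnormal 0 S) (\<lambda>x. drift l f t (z + x) $ a)" for z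
    unfolding drift_def using integrable_f_shift[OF t] by simp
  have "\<bar>gauss_drift l f t z S $ a - gauss_drift l f t w S $ a\<bar>
      = \<bar>\<integral>x. drift l f t (z + x) $ a - drift l f t (w + x) $ a \<partial>mvnormal 0 S\<bar>"
    using int by (simp add: gauss_drift_component[OF t S])
  also have "\<dots> \<le> (\<integral>x. \<bar>drift l f t (z + x) $ a - drift l f t (w + x) $ a\<bar> \<partial>mvnormal 0 S)"
    by (rule integral_abs_bound)
  also have "\<dots> \<le> (\<integral>x. K * norm (z - w) \<partial>(mvnormal 0 S :: (real^'d) measure))"
  proof (rule integral_mono)
    show "integrable (mvnormal 0 S) (\<lambda>x. \<bar>drift l f t (z + x) $ a - drift l f t (w + x) $ a\<bar>)"
      using int by simp
    fix x
    have "\<bar>(drift l f t (z + x) - drift l f t (w + x)) $ a\<bar> \<le> norm (drift l f t (z + x) - drift l f t (w + x))"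
      by (rule component_le_norm_cart)
    also have "\<dots> \<le> K * norm (z + x - (w + x))"
      by (rule F_lipschitz[OF t])
    finally show "\<bar>drift l f t (z + x) $ a - drift l f t (w + x) $ a\<bar> \<le> K * norm (z - w)"
      by simp
  qed simp
  also have "\<dots> = K * norm (z - w)"
    using prob_space by simp
  finally show ?thesis .
qed

text \<open>Differentiability of each Gaussian mean makes the chosen Jacobian the true derivative.
  Column \<open>b\<close> of the product is this derivative in the direction
  \<open>S t *v axis b 1\<close>, precisely where integration by parts gives a moment.\<close>

lemma
  assumes t: "t \<in> {0..T}" and S: "positive_definite (S t)"
  shows gauss_drift_has_derivative:
      "((\<lambda>z. gauss_drift l f t z (S t)) has_derivative (\<lambda>h. drift_jacobian l f Z S t *v h)) (at (Z t))"
    and drift_jacobian_mult: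
      "(drift_jacobian l f Z S t ** S t) $ a $ b = (\<Sum>i\<in>UNIV. moment i t (Z t) (S t) b * real_vec (l i) $ a)"
proof -
  let ?A = "drift_jacobian l f Z S t"
  have "\<exists>D. ((\<lambda>z. gauss_rate f i t z (S t)) has_derivative D) (at (Z t)) \<and>
      (\<forall>h. D (S t *v h) = (\<integral>x. f i t (Z t + x) * (x \<bullet> h) \<partial>mvnormal 0 (S t)))" for i
    unfolding gauss_rate_def
    by (rule mvnormal_mean_has_derivative[OF S f_measurable[OF t] f_exp_bound[OF t]]) auto
  then obtain D where D: "\<And>i. ((\<lambda>z. gauss_rate f i t z (S t)) has_derivative D i) (at (Z t))"
    and DS: "\<And>i h. D i (S t *v h) = (\<integral>x. f i t (Z t + x) * (x \<bullet> h) \<partial>mvnormal 0 (S t))"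
    by metis
  have G: "((\<lambda>z. gauss_drift l f t z (S t)) has_derivative (\<lambda>h. \<Sum>i\<in>UNIV. D i h *\<^sub>R real_vec (l i))) (at (Z t))"
    unfolding gauss_drift_def by (intro has_derivative_sum has_derivative_scaleR_left D)
  then show A: "((\<lambda>z. gauss_drift l f t z (S t)) has_derivative (\<lambda>h. ?A *v h)) (at (Z t))"
    unfolding drift_jacobian_def jacobian_works[symmetric] by (rule differentiableI)
  have "?A *v h = (\<Sum>i\<in>UNIV. D i h *\<^sub>R real_vec (l i))" for h
    using fun_cong[OF has_derivative_unique[OF A G]] .
  then have "(?A *v (S t *v axis b 1)) $ a = (\<Sum>i\<in>UNIV. moment i t (Z t) (S t) b * real_vec (l i) $ a)"
    by (simp add: DS moment_def inner_axis)
  moreover have "(?A ** S t) $ a $ b = (?A *v (S t *v axis b 1)) $ a"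
    by (subst matrix_vector_mul_assoc) (simp add: matrix_vector_mult_basis column_def)
  ultimately show "(?A ** S t) $ a $ b = (\<Sum>i\<in>UNIV. moment i t (Z t) (S t) b * real_vec (l i) $ a)"
    by simp
qed

text \<open>A countable limit representation of the entries, through which both bounds and
  measurability pass from the averaged drift to its Jacobian.\<close>

lemma drift_jacobian_difference_quotient:
  assumes t: "t \<in> {0..T}" and S: "positive_definite (S t)"
  shows "(\<lambda>n. (gauss_drift l f t (Z t + (1 / Suc n) *\<^sub>R axis b 1) (S t) $ a - gauss_drift l f t (Z t) (S t) $ a) * Suc n)
    \<longlonglongrightarrow> drift_jacobian l f Z S t $ a $ b"
proof -
  let ?A = "drift_jacobian l f Z S t"
  let ?e = "axis b 1 :: real^'d"
  have "((\<lambda>s. gauss_drift l f t (Z t + s *\<^sub>R ?e) (S t)) has_derivative (\<lambda>s. ?A *v (s *\<^sub>R ?e))) (at 0)"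
    by (rule has_derivative_compose[where g = "\<lambda>z. gauss_drift l f t z (S t)"])
      (use gauss_drift_has_derivative[of t S Z, OF t S] in \<open>auto intro!: derivative_eq_intros\<close>)
  then have "((\<lambda>s. gauss_drift l f t (Z t + s *\<^sub>R ?e) (S t) $ a) has_derivative (\<lambda>s. (?A *v (s *\<^sub>R ?e)) $ a)) (at 0)"
    by (rule bounded_linear.has_derivative[OF bounded_linear_vec_nth])
  moreover have "(?A *v (s *\<^sub>R ?e)) $ a = ?A $ a $ b * s" for s
    by (simp add: matrix_vector_mult_scaleR matrix_vector_mult_basis column_def)
  ultimately have "((\<lambda>s. gauss_drift l f t (Z t + s *\<^sub>R ?e) (S t) $ a) has_field_derivative ?A $ a $ b) (at 0)"
    by (simp add: has_field_derivative_def)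
  then have lim: "((\<lambda>h. (gauss_drift l f t (Z t + h *\<^sub>R ?e) (S t) $ a - gauss_drift l f t (Z t) (S t) $ a) / h)
      \<longlongrightarrow> ?A $ a $ b) (at 0)"
    by (simp add: DERIV_def)
  have "filterlim (\<lambda>n. 1 / real (Suc n)) (at 0) sequentially"
    unfolding filterlim_at using LIMSEQ_inverse_real_of_nat by (auto simp: inverse_eq_divide)
  from filterlim_compose[OF lim this] show ?thesis
    by (simp add: mult.commute)
qed

text \<open>Difference quotients of a Lipschitz function are bounded by its constant. The bound is
  independent of \<open>S t\<close> and therefore uniform as \<open>t\<close> tends to
  \<open>0\<close>, where the Gaussian law degenerates.\<close>

lemma drift_jacobian_bound:
  assumes t: "t \<in> {0..T}" and S: "positive_definite (S t)"
  shows "\<bar>drift_jacobian l f Z S t $ a $ b\<bar> \<le> K"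
proof (rule LIMSEQ_le_const2[OF tendsto_rabs[OF drift_jacobian_difference_quotient[of t S Z b a]]])
  have "\<bar>gauss_drift l f t (Z t + (1 / Suc n) *\<^sub>R axis b 1) (S t) $ a - gauss_drift l f t (Z t) (S t) $ a\<bar> * Suc n
      \<le> (K * (1 / Suc n)) * Suc n" for n
    using gauss_drift_lipschitz[OF t S, of "Z t + (1 / Suc n) *\<^sub>R axis b 1" a "Z t"]
    by (intro mult_right_mono) (auto simp: norm_axis_1)
  then show "\<exists>N. \<forall>n\<ge>N. \<bar>(gauss_drift l f t (Z t + (1 / Suc n) *\<^sub>R axis b 1) (S t) $ a
      - gauss_drift l f t (Z t) (S t) $ a) * Suc n\<bar> \<le> K"
    by (simp add: abs_mult)
qed (use assms in auto)

text \<open>Stated for merely measurable \<open>S\<close>, because continuity of the covariance is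
  obtained only after the equation containing the Jacobian is available.\<close>

lemma drift_jacobian_measurable:
  assumes Z: "continuous_on {0..T} Z"
    and S: "S \<in> borel_measurable (restrict_space borel {0<..T})"
    and pos: "\<And>t. t \<in> {0<..T} \<Longrightarrow> positive_definite (S t)"
  shows "(\<lambda>t. drift_jacobian l f Z S t $ a $ b) \<in> borel_measurable (restrict_space borel {0<..T})"
proof (rule borel_measurable_LIMSEQ_real)
  let ?M = "restrict_space borel {0<..T} :: real measure"
  have G: "(\<lambda>t. gauss_drift l f t (Z t + h) (S t) $ a) \<in> borel_measurable ?M" for h
  proof -
    have Zm: "Z \<in> borel_measurable ?M"
      by (rule borel_measurable_continuous_on_restrict[OF continuous_on_subset[OF Z]]) auto
    have "(\<lambda>t. gauss_rate f i t (Z t + h) (S t)) \<in> borel_measurable ?M" for i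
    proof -
      let ?P = "({0..T} \<times> UNIV) \<times> Collect positive_definite :: ((real \<times> (real^'d)) \<times> (real^'d^'d)) set"
      \<comment> \<open>Continuity of the Gaussian means is known on \<open>?P\<close> only, so the
        path has to be measurable into that restricted space before composing.\<close>
      have "(\<lambda>t. ((t, Z t + h), S t)) \<in> ?M \<rightarrow>\<^sub>M restrict_space borel ?P"
      proof (rule measurable_restrict_space2)
        show "(\<lambda>t. ((t, Z t + h), S t)) \<in> borel_measurable ?M"
          using Zm S by (intro borel_measurable_Pair borel_measurable_add)
            (auto intro: measurable_restrict_space1)
      qed (use pos in \<open>auto simp: space_restrict_space\<close>)
      from measurable_compose[OF this borel_measurable_continuous_on_restrict[OF continuous_on_gauss_rate[of i]]]
      show ?thesis by simp
    qed
    then show ?thesis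
      unfolding gauss_drift_def by simp
  qed
  show "(\<lambda>t. (gauss_drift l f t (Z t + (1 / Suc n) *\<^sub>R axis b 1) (S t) $ a - gauss_drift l f t (Z t) (S t) $ a) * Suc n)
      \<in> borel_measurable ?M" for n
    using G[of "(1 / Suc n) *\<^sub>R axis b 1"] G[of 0] by simp
  show "(\<lambda>n. (gauss_drift l f t (Z t + (1 / Suc n) *\<^sub>R axis b 1) (S t) $ a - gauss_drift l f t (Z t) (S t) $ a) * Suc n)
      \<longlonglongrightarrow> drift_jacobian l f Z S t $ a $ b" if "t \<in> space ?M" for t
    using that pos by (intro drift_jacobian_difference_quotient) (auto simp: space_restrict_space)
qed

end

section \<open>Square-integrable functions and stochastic integrals\<close>

text \<open>Used both for random variables and for functions of time under Lebesgue measure, so that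
  the same limit lemmas serve the two sides of the stochastic isometry.\<close>

definition sq_integrable :: "'a measure \<Rightarrow> ('a \<Rightarrow> real) \<Rightarrow> bool" where
  "sq_integrable M X \<longleftrightarrow> X \<in> borel_measurable M \<and> integrable M (\<lambda>x. (X x)\<^sup>2)"

lemma sq_integrable_measurable [measurable_dest]: "sq_integrable M X \<Longrightarrow> X \<in> borel_measurable M"
  and sq_integrable_square: "sq_integrable M X \<Longrightarrow> integrable M (\<lambda>x. (X x)\<^sup>2)"
  by (auto simp: sq_integrable_def)

lemma sq_integrable_mult:
  assumes "sq_integrable M X" "sq_integrable M Y"
  shows "integrable M (\<lambda>x. X x * Y x)"
proof (rule Bochner_Integration.integrable_bound)
  note [measurable] = assms[THEN sq_integrable_measurable]
  show "integrable M (\<lambda>x. (X x)\<^sup>2 + (Y x)\<^sup>2)"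
    using assms by (intro Bochner_Integration.integrable_add sq_integrable_square)
  show "(\<lambda>x. X x * Y x) \<in> borel_measurable M" by measurable
  have "\<bar>a * b\<bar> \<le> a\<^sup>2 + b\<^sup>2" for a b :: real
  proof -
    have "0 \<le> (\<bar>a\<bar> - \<bar>b\<bar>)\<^sup>2 + a\<^sup>2 + b\<^sup>2" by simp
    then show ?thesis by (simp add: power2_diff abs_mult)
  qed
  then show "AE x in M. norm (X x * Y x) \<le> norm ((X x)\<^sup>2 + (Y x)\<^sup>2)" by simp
qed

lemma sq_integrable_add:
  assumes "sq_integrable M X" "sq_integrable M Y"
  shows "sq_integrable M (\<lambda>x. X x + Y x)"
  using assms sq_integrable_mult[OF assms] by (auto simp: sq_integrable_def power2_sum mult.assoc)

lemma sq_integrable_cmult: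
  assumes "sq_integrable M X"
  shows "sq_integrable M (\<lambda>x. c * X x)"
  using assms by (auto simp: sq_integrable_def power_mult_distrib)

lemma sq_integrable_diff:
  assumes "sq_integrable M X" "sq_integrable M Y"
  shows "sq_integrable M (\<lambda>x. X x - Y x)"
  using sq_integrable_add[OF assms(1) sq_integrable_cmult[OF assms(2), of "-1"]] by simp

lemma sq_integrable_sum:
  assumes "\<And>i. i \<in> I \<Longrightarrow> sq_integrable M (X i)"
  shows "sq_integrable M (\<lambda>x. \<Sum>i\<in>I. X i x)"
proof -
  have "sq_integrable M (\<lambda>x. 0)"
    by (simp add: sq_integrable_def)
  with assms show ?thesis
    by (induction I rule: infinite_finite_induct) (auto intro: sq_integrable_add)
qed

lemma sq_integrable_cong_AE:
  assumes "sq_integrable M X" "AE x in M. X x = Y x" "Y \<in> borel_measurable M"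
  shows "sq_integrable M Y"
proof -
  note [measurable] = sq_integrable_measurable[OF assms(1)] assms(3)
  have "integrable M (\<lambda>x. (Y x)\<^sup>2) \<longleftrightarrow> integrable M (\<lambda>x. (X x)\<^sup>2)"
    using assms(2) by (intro integrable_cong_AE) auto
  with assms show ?thesis by (simp add: sq_integrable_def)
qed

lemma (in prob_space) sq_integrable_const: "sq_integrable M (\<lambda>_. c)"
  by (simp add: sq_integrable_def)

lemma (in prob_space) sq_integrable_integrable: "sq_integrable M X \<Longrightarrow> integrable M X"
  using sq_integrable_mult[OF _ sq_integrable_const[of 1], of X] by simp

text \<open>The polynomial \<open>t \<mapsto> \<integral>(X + t Y)^2\<close> is nonnegative. It is
  evaluated at its minimizer \<open>- ?c / ?b\<close>, or, when \<open>?b = 0\<close>, it is affine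
  and so must be constant.\<close>

lemma sq_integrable_Cauchy_Schwarz:
  assumes X: "sq_integrable M X" and Y: "sq_integrable M Y"
  shows "\<bar>\<integral>x. X x * Y x \<partial>M\<bar> \<le> sqrt (\<integral>x. (X x)\<^sup>2 \<partial>M) * sqrt (\<integral>x. (Y x)\<^sup>2 \<partial>M)"
proof -
  let ?a = "\<integral>x. (X x)\<^sup>2 \<partial>M" and ?b = "\<integral>x. (Y x)\<^sup>2 \<partial>M" and ?c = "\<integral>x. X x * Y x \<partial>M"
  have nn: "0 \<le> ?a" "0 \<le> ?b" by (auto intro: integral_nonneg)
  have q: "0 \<le> ?a + 2 * t * ?c + t\<^sup>2 * ?b" for t
  proof -
    have "0 \<le> (\<integral>x. (X x + t * Y x)\<^sup>2 \<partial>M)" by (auto intro: integral_nonneg)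
    also have "\<dots> = (\<integral>x. (X x)\<^sup>2 + 2 * t * (X x * Y x) + t\<^sup>2 * (Y x)\<^sup>2 \<partial>M)"
      by (simp add: power2_sum power_mult_distrib ac_simps)
    also have "\<dots> = ?a + 2 * t * ?c + t\<^sup>2 * ?b"
      using sq_integrable_square[OF X] sq_integrable_square[OF Y] sq_integrable_mult[OF X Y] by simp
    finally show ?thesis .
  qed
  have "?c\<^sup>2 \<le> ?a * ?b"
  proof (cases "?b = 0")
    case True
    have "?c = 0"
    proof (rule ccontr)
      assume c: "?c \<noteq> 0"
      \<comment> \<open>This \<open>t\<close> is chosen so that the affine polynomial takes the
        value \<open>-1\<close>.\<close>
      have "0 \<le> ?a + 2 * (- (?a + 1) / (2 * ?c)) * ?c"
        using q[of "- (?a + 1) / (2 * ?c)"] True by simp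
      with c show False by (simp add: field_simps)
    qed
    then show ?thesis using True by simp
  next
    case False
    then have "0 \<le> (?a + 2 * (- ?c / ?b) * ?c + (- ?c / ?b)\<^sup>2 * ?b) * ?b"
      using q nn by (intro mult_nonneg_nonneg)
    also have "\<dots> = ?a * ?b - ?c\<^sup>2"
      using False by (simp add: field_simps power2_eq_square)
    finally show ?thesis by simp
  qed
  then have "\<bar>?c\<bar> \<le> sqrt (?a * ?b)"
    by (intro real_le_rsqrt) simp
  then show ?thesis
    by (simp add: real_sqrt_mult)
qed

text \<open>The hypothesis uses nonnegative integrals, which are defined without integrability. A
  value below \<open>1\<close> at some index makes \<open>X n - J\<close> square integrable, hence
  also \<open>J\<close>.\<close>

lemma sq_integrable_limit:
  assumes X: "\<And>n. sq_integrable M (X n)" and J [measurable]: "J \<in> borel_measurable M"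
    and lim: "(\<lambda>n. \<integral>\<^sup>+x. ennreal ((X n x - J x)\<^sup>2) \<partial>M) \<longlonglongrightarrow> 0"
  shows "sq_integrable M J" and "(\<lambda>n. \<integral>x. (X n x - J x)\<^sup>2 \<partial>M) \<longlonglongrightarrow> 0"
proof -
  note [measurable] = sq_integrable_measurable[OF X]
  have "\<forall>\<^sub>F n in sequentially. (\<integral>\<^sup>+x. ennreal ((X n x - J x)\<^sup>2) \<partial>M) < 1"
    using lim by (rule order_tendstoD) simp
  then obtain n where "(\<integral>\<^sup>+x. ennreal ((X n x - J x)\<^sup>2) \<partial>M) < 1"
    by (auto simp: eventually_sequentially)
  then have "integrable M (\<lambda>x. (X n x - J x)\<^sup>2)"
    by (intro integrableI_nonneg) (auto intro: order.strict_trans[OF _ ennreal_one_less_top])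
  then have "sq_integrable M (\<lambda>x. X n x - J x)"
    by (simp add: sq_integrable_def)
  from sq_integrable_diff[OF X[of n] this] show J2: "sq_integrable M J" by simp
  have "(\<integral>\<^sup>+x. ennreal ((X n x - J x)\<^sup>2) \<partial>M) = ennreal (\<integral>x. (X n x - J x)\<^sup>2 \<partial>M)" for n
    using sq_integrable_square[OF sq_integrable_diff[OF X J2]] by (intro nn_integral_eq_integral) auto
  with lim have "(\<lambda>n. ennreal (\<integral>x. (X n x - J x)\<^sup>2 \<partial>M)) \<longlonglongrightarrow> ennreal 0"
    by simp
  then show "(\<lambda>n. \<integral>x. (X n x - J x)\<^sup>2 \<partial>M) \<longlonglongrightarrow> 0"
    by (subst (asm) tendsto_ennreal_iff) (auto intro: integral_nonneg)
qed

text \<open>Continuity of the mean-square pairing: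
  \<open>X Y - J L = (X - J) (Y - L) + (X - J) L + J (Y - L)\<close>, and the Cauchy-Schwarz
  inequality bounds each term.\<close>

lemma sq_integrable_limit_mult:
  assumes X: "\<And>n. sq_integrable M (X n)" and J: "J \<in> borel_measurable M"
    and limX: "(\<lambda>n. \<integral>\<^sup>+x. ennreal ((X n x - J x)\<^sup>2) \<partial>M) \<longlonglongrightarrow> 0"
    and Y: "\<And>n. sq_integrable M (Y n)" and L: "L \<in> borel_measurable M"
    and limY: "(\<lambda>n. \<integral>\<^sup>+x. ennreal ((Y n x - L x)\<^sup>2) \<partial>M) \<longlonglongrightarrow> 0"
  shows "(\<lambda>n. \<integral>x. X n x * Y n x \<partial>M) \<longlonglongrightarrow> (\<integral>x. J x * L x \<partial>M)"
proof -
  note J2 = sq_integrable_limit(1)[OF X J limX] and X0 = sq_integrable_limit(2)[OF X J limX]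
  note L2 = sq_integrable_limit(1)[OF Y L limY] and Y0 = sq_integrable_limit(2)[OF Y L limY]
  let ?N = "\<lambda>Z. sqrt (\<integral>x. (Z x)\<^sup>2 \<partial>M)"
  let ?x = "\<lambda>n. ?N (\<lambda>x. X n x - J x)" and ?y = "\<lambda>n. ?N (\<lambda>x. Y n x - L x)"
  have lim: "(\<lambda>n. ?x n * ?y n + ?x n * ?N L + ?N J * ?y n) \<longlonglongrightarrow> sqrt 0 * sqrt 0 + sqrt 0 * ?N L + ?N J * sqrt 0"
    by (intro tendsto_intros X0 Y0)
  have bd: "\<bar>(\<integral>x. X n x * Y n x \<partial>M) - (\<integral>x. J x * L x \<partial>M)\<bar> \<le> ?x n * ?y n + ?x n * ?N L + ?N J * ?y n" for n
  proof -
    note d = sq_integrable_diff[OF X J2, of n] sq_integrable_diff[OF Y L2, of n]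
    have "(\<integral>x. X n x * Y n x \<partial>M) - (\<integral>x. J x * L x \<partial>M) = (\<integral>x. X n x * Y n x - J x * L x \<partial>M)"
      using sq_integrable_mult[OF X Y] sq_integrable_mult[OF J2 L2] by simp
    also have "\<dots> = (\<integral>x. (X n x - J x) * (Y n x - L x) + (X n x - J x) * L x + J x * (Y n x - L x) \<partial>M)"
      by (simp add: algebra_simps)
    also have "\<dots> = (\<integral>x. (X n x - J x) * (Y n x - L x) \<partial>M) + (\<integral>x. (X n x - J x) * L x \<partial>M) + (\<integral>x. J x * (Y n x - L x) \<partial>M)"
      using sq_integrable_mult[OF d(1) d(2)] sq_integrable_mult[OF d(1) L2] sq_integrable_mult[OF J2 d(2)] by simp
    finally show ?thesis
      using sq_integrable_Cauchy_Schwarz[OF d(1) d(2)] sq_integrable_Cauchy_Schwarz[OF d(1) L2]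
        sq_integrable_Cauchy_Schwarz[OF J2 d(2)] by linarith
  qed
  have "(\<lambda>n. (\<integral>x. X n x * Y n x \<partial>M) - (\<integral>x. J x * L x \<partial>M)) \<longlonglongrightarrow> 0"
  proof (rule Lim_null_comparison[OF always_eventually])
    show "(\<lambda>n. ?x n * ?y n + ?x n * ?N L + ?N J * ?y n) \<longlonglongrightarrow> 0"
      using lim by (simp only: real_sqrt_zero mult_zero_left mult_zero_right add_0)
  qed (use bd in simp)
  then show ?thesis
    by (rule LIM_zero_cancel)
qed

lemma (in prob_space) sq_integrable_limit_expectation:
  assumes X: "\<And>n. sq_integrable M (X n)" and J: "J \<in> borel_measurable M"
    and lim: "(\<lambda>n. \<integral>\<^sup>+x. ennreal ((X n x - J x)\<^sup>2) \<partial>M) \<longlonglongrightarrow> 0"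
  shows "(\<lambda>n. expectation (X n)) \<longlonglongrightarrow> expectation J"
  using sq_integrable_limit_mult[where Y = "\<lambda>_ _. 1" and L = "\<lambda>_. 1", OF X J lim sq_integrable_const] by simp

section \<open>First and second moments of Brownian motion\<close>

context
  fixes M :: "'w measure" and W :: "real \<Rightarrow> 'w \<Rightarrow> real"
  assumes bm: "standard_brownian_motion M W"
begin

interpretation prob_space M
  using bm by (simp add: standard_brownian_motion_def)

lemma brownian_measurable: "0 \<le> t \<Longrightarrow> W t \<in> borel_measurable M"
  using bm by (simp add: standard_brownian_motion_def)

lemma brownian_start: "AE \<omega> in M. W 0 \<omega> = 0"
  using bm by (simp add: standard_brownian_motion_def)

lemma brownian_increment:
  assumes "0 \<le> s" "s < t"
  shows "sq_integrable M (\<lambda>\<omega>. W t \<omega> - W s \<omega>)"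
    and "expectation (\<lambda>\<omega>. W t \<omega> - W s \<omega>) = 0"
    and "expectation (\<lambda>\<omega>. (W t \<omega> - W s \<omega>)\<^sup>2) = t - s"
proof -
  have \<sigma>: "0 < sqrt (t - s)" using assms by simp
  have D: "distributed M lborel (\<lambda>\<omega>. W t \<omega> - W s \<omega>) (normal_density 0 (sqrt (t - s)))"
    using bm assms by (simp add: standard_brownian_motion_def)
  show E: "expectation (\<lambda>\<omega>. W t \<omega> - W s \<omega>) = 0"
    by (rule normal_distributed_expectation[OF \<sigma> D])
  show "expectation (\<lambda>\<omega>. (W t \<omega> - W s \<omega>)\<^sup>2) = t - s"
    using normal_distributed_variance[OF \<sigma> D] E assms by simp
  have "integrable lborel (\<lambda>x. normal_density 0 (sqrt (t - s)) x * (x - 0) ^ 2)"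
    by (rule integrable_normal_moment[OF \<sigma>])
  then have "integrable M (\<lambda>\<omega>. (W t \<omega> - W s \<omega>)\<^sup>2)"
    using distributed_integrable[OF D, of "\<lambda>x. x\<^sup>2"] by simp
  moreover have "(\<lambda>\<omega>. W t \<omega> - W s \<omega>) \<in> borel_measurable M"
    using assms by (intro borel_measurable_diff brownian_measurable) auto
  ultimately show "sq_integrable M (\<lambda>\<omega>. W t \<omega> - W s \<omega>)"
    by (simp add: sq_integrable_def)
qed

lemma brownian_sq_integrable:
  assumes "0 \<le> t"
  shows "sq_integrable M (W t)" and "expectation (W t) = 0" and "expectation (\<lambda>\<omega>. (W t \<omega>)\<^sup>2) = t"
proof -
  note [measurable] = brownian_measurable[OF assms] brownian_measurable[of 0]
  have eq: "AE \<omega> in M. W t \<omega> - W 0 \<omega> = W t \<omega>"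
    using brownian_start by auto
  have "sq_integrable M (W t) \<and> expectation (W t) = 0 \<and> expectation (\<lambda>\<omega>. (W t \<omega>)\<^sup>2) = t"
  proof (cases "t = 0")
    case True
    have "AE \<omega> in M. 0 = W t \<omega>"
      using brownian_start True by auto
    from sq_integrable_cong_AE[OF sq_integrable_const this] integral_cong_AE[OF _ _ this]
      integral_cong_AE[of "\<lambda>_. 0" M "\<lambda>\<omega>. (W t \<omega>)\<^sup>2"] this True show ?thesis by auto
  next
    case False
    then have t: "0 < t" using assms by simp
    have "expectation (\<lambda>\<omega>. (W t \<omega> - W 0 \<omega>)\<^sup>2) = expectation (\<lambda>\<omega>. (W t \<omega>)\<^sup>2)"
      using brownian_start by (intro integral_cong_AE) auto
    moreover have "expectation (\<lambda>\<omega>. W t \<omega> - W 0 \<omega>) = expectation (W t)"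
      using brownian_start by (intro integral_cong_AE) auto
    ultimately show ?thesis
      using brownian_increment[OF _ t] sq_integrable_cong_AE[OF _ eq] by simp
  qed
  then show "sq_integrable M (W t)" and "expectation (W t) = 0" and "expectation (\<lambda>\<omega>. (W t \<omega>)\<^sup>2) = t"
    by auto
qed

lemma brownian_covariance_ordered:
  assumes "0 \<le> s" "s \<le> t"
  shows "expectation (\<lambda>\<omega>. W s \<omega> * W t \<omega>) = s"
proof -
  note [measurable] = brownian_measurable[of s] brownian_measurable[of t] brownian_measurable[of 0]
  consider "s = 0" | "s = t" | "0 < s" "s < t"
    using assms by linarith
  then show ?thesis
  proof cases
    case 1
    have "expectation (\<lambda>\<omega>. W s \<omega> * W t \<omega>) = expectation (\<lambda>_. 0)"
      using assms brownian_start 1 by (intro integral_cong_AE) auto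
    with 1 show ?thesis by simp
  next
    case 2
    then show ?thesis
      using brownian_sq_integrable(3)[OF assms(1)] by (simp add: power2_eq_square)
  next
    case 3
    \<comment> \<open>The grid \<open>0 < s < t\<close>. Independence of increments is stated for
      strictly increasing points, which is why \<open>s = 0\<close> and \<open>s = t\<close> are
      separate cases.\<close>
    define \<tau> where "\<tau> j = (if j = 0 then 0 else if j = 1 then s else t)" for j :: nat
    have "indep_vars (\<lambda>_. borel) (\<lambda>j \<omega>. W (\<tau> (Suc j)) \<omega> - W (\<tau> j) \<omega>) {..<2}"
    proof -
      have "0 \<le> \<tau> 0" "\<forall>j<2. \<tau> j < \<tau> (Suc j)"
        using 3 by (auto simp: \<tau>_def less_2_cases_iff)
      then show ?thesis
        using bm unfolding standard_brownian_motion_def by blast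
    qed
    moreover have "integrable M (\<lambda>\<omega>. W (\<tau> (Suc j)) \<omega> - W (\<tau> j) \<omega>)" if "j \<in> {..<2}" for j
      using that 3 by (intro sq_integrable_integrable brownian_increment) (auto simp: \<tau>_def less_2_cases_iff)
    ultimately have "expectation (\<lambda>\<omega>. \<Prod>j\<in>{..<2}. W (\<tau> (Suc j)) \<omega> - W (\<tau> j) \<omega>)
        = (\<Prod>j\<in>{..<2}. expectation (\<lambda>\<omega>. W (\<tau> (Suc j)) \<omega> - W (\<tau> j) \<omega>))"
      by (intro indep_vars_lebesgue_integral) auto
    then have "expectation (\<lambda>\<omega>. (W s \<omega> - W 0 \<omega>) * (W t \<omega> - W s \<omega>)) = 0"
      using brownian_increment(2)[of 0 s] 3
      by (simp add: numeral_2_eq_2 lessThan_Suc \<tau>_def mult.commute)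
    moreover have "expectation (\<lambda>\<omega>. (W s \<omega> - W 0 \<omega>) * (W t \<omega> - W s \<omega>)) = expectation (\<lambda>\<omega>. W s \<omega> * W t \<omega> - (W s \<omega>)\<^sup>2)"
      using brownian_start assms by (intro integral_cong_AE) (auto simp: algebra_simps power2_eq_square)
    moreover have "expectation (\<lambda>\<omega>. W s \<omega> * W t \<omega> - (W s \<omega>)\<^sup>2) = expectation (\<lambda>\<omega>. W s \<omega> * W t \<omega>) - s"
      using assms brownian_sq_integrable(1)[of s] brownian_sq_integrable(1)[of t] brownian_sq_integrable(3)[of s]
      by (subst Bochner_Integration.integral_diff) (auto intro: sq_integrable_mult sq_integrable_square)
    ultimately show ?thesis by simp
  qed
qed

lemma brownian_covariance:
  assumes "0 \<le> s" "0 \<le> t"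
  shows "expectation (\<lambda>\<omega>. W s \<omega> * W t \<omega>) = min s t"
  using brownian_covariance_ordered[of s t] brownian_covariance_ordered[of t s] assms
  by (cases "s \<le> t") (auto simp: mult.commute)

end

lemma independent_brownian_motions_covariance:
  assumes W: "independent_brownian_motions M W" and "0 \<le> s" "0 \<le> t"
  shows "(\<integral>\<omega>. W i s \<omega> * W j t \<omega> \<partial>M) = (if i = j then min s t else 0)"
proof (cases "i = j")
  case True
  then show ?thesis
    using W assms by (simp add: independent_brownian_motions_def brownian_covariance)
next
  case False
  have bm: "standard_brownian_motion M (W i)" for i
    using W by (simp add: independent_brownian_motions_def)
  interpret prob_space M
    using bm[of i] by (simp add: standard_brownian_motion_def)
  \<comment> \<open>Independence is given for whole paths. Evaluating path \<open>i\<close> at time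
    \<open>s\<close> and path \<open>j\<close> at time \<open>t\<close> is a measurable map of each
    path, so it is inherited by the two values.\<close>
  define r where "r k = (if k = i then s else t)" for k
  have r: "0 \<le> r k" for k
    using assms by (simp add: r_def)
  have "indep_vars (\<lambda>_. \<Pi>\<^sub>M t\<in>{0..}. (borel :: real measure)) (\<lambda>i \<omega>. \<lambda>t\<in>{0..}. W i t \<omega>) UNIV"
    using W unfolding independent_brownian_motions_def by (rule conjunct2)
  from indep_vars_subset[OF this subset_UNIV, of "{i, j}"]
  have "indep_vars (\<lambda>_. borel) (\<lambda>k \<omega>. (\<lambda>p. p (r k)) (\<lambda>t\<in>{0..}. W k t \<omega>)) {i, j}"
    by (rule indep_vars_compose2[where Y = "\<lambda>k p. p (r k)"]) (use r in auto)
  then have "indep_vars (\<lambda>_. borel) (\<lambda>k \<omega>. W k (r k) \<omega>) {i, j}"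
    using r by simp
  then have "expectation (\<lambda>\<omega>. \<Prod>k\<in>{i, j}. W k (r k) \<omega>) = (\<Prod>k\<in>{i, j}. expectation (\<lambda>\<omega>. W k (r k) \<omega>))"
    using bm r by (intro indep_vars_lebesgue_integral) (auto intro!: sq_integrable_integrable brownian_sq_integrable)
  with False show ?thesis
    using brownian_sq_integrable(2)[OF bm assms(2)] by (simp add: r_def)
qed

section \<open>The isometry for step functions and its limit\<close>

lemma monotone_steps:
  fixes \<tau> :: "nat \<Rightarrow> real"
  assumes "\<forall>j<n. \<tau> j \<le> \<tau> (Suc j)" and "i \<le> j" "j \<le> n"
  shows "\<tau> i \<le> \<tau> j"
  using assms(2,3)
proof (induction j rule: dec_induct)
  case (step k)
  then show ?case using assms(1) by (meson Suc_leD Suc_le_lessD order_trans)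
qed simp

context
  fixes M :: "'w measure" and W :: "'k \<Rightarrow> real \<Rightarrow> 'w \<Rightarrow> real"
  assumes W: "independent_brownian_motions M W"
begin

interpretation prob_space M
  using W by (simp add: independent_brownian_motions_def standard_brownian_motion_def)

lemma independent_brownian_motion: "standard_brownian_motion M (W i)"
  using W by (simp add: independent_brownian_motions_def)

text \<open>The covariance is the length of the overlap of the two intervals. Written as an integral
  of indicators, it extends to step functions by bilinearity.\<close>

lemma increment_covariance:
  assumes "0 \<le> a" "a \<le> b" "0 \<le> c" "c \<le> d"
  shows "expectation (\<lambda>\<omega>. (W i b \<omega> - W i a \<omega>) * (W j d \<omega> - W j c \<omega>))
    = (if i = j then \<integral>x. indicator {a<..b} x * indicator {c<..d} x \<partial>lborel else 0)"
proof -
  note sq = brownian_sq_integrable(1)[OF independent_brownian_motion]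
  have "expectation (\<lambda>\<omega>. (W i b \<omega> - W i a \<omega>) * (W j d \<omega> - W j c \<omega>))
    = expectation (\<lambda>\<omega>. W i b \<omega> * W j d \<omega> - W i b \<omega> * W j c \<omega> - W i a \<omega> * W j d \<omega> + W i a \<omega> * W j c \<omega>)"
    by (simp add: algebra_simps)
  also have "\<dots> = expectation (\<lambda>\<omega>. W i b \<omega> * W j d \<omega>) - expectation (\<lambda>\<omega>. W i b \<omega> * W j c \<omega>)
      - expectation (\<lambda>\<omega>. W i a \<omega> * W j d \<omega>) + expectation (\<lambda>\<omega>. W i a \<omega> * W j c \<omega>)"
    using assms by (simp add: sq_integrable_mult sq)
  also have "\<dots> = (if i = j then min b d - min b c - min a d + min a c else 0)"
    using assms by (simp add: independent_brownian_motions_covariance[OF W])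
  also have "min b d - min b c - min a d + min a c = (\<integral>x. indicator {a<..b} x * indicator {c<..d} x \<partial>lborel)"
  proof -
    have "(\<integral>x. indicator {a<..b} x * indicator {c<..d} x \<partial>lborel) = (\<integral>x. indicator {max a c<..min b d} x \<partial>lborel :: real)"
      by (intro Bochner_Integration.integral_cong) (auto split: split_indicator)
    also have "\<dots> = measure lborel {max a c<..min b d}"
      by simp
    also have "\<dots> = min b d - min b c - min a d + min a c"
      using assms by (cases "max a c \<le> min b d") (auto simp: measure_def min_def max_def split: if_splits)
    finally show ?thesis by simp
  qed
  finally show ?thesis .
qed

lemma step_integral_sq_integrable:
  assumes "0 \<le> \<tau> 0" "\<forall>j<n. \<tau> j \<le> \<tau> (Suc j)"
  shows "sq_integrable M (step_integral (W i) n \<tau> c)" and "expectation (step_integral (W i) n \<tau> c) = 0"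
proof -
  have nn: "0 \<le> \<tau> j" if "j \<le> n" for j
    using monotone_steps[OF assms(2) _ that, of 0] assms(1) by simp
  note sq = brownian_sq_integrable[OF independent_brownian_motion]
  show "sq_integrable M (step_integral (W i) n \<tau> c)"
    unfolding step_integral_def[abs_def]
    using nn by (intro sq_integrable_sum sq_integrable_cmult sq_integrable_diff sq) auto
  have "integrable M (W i (\<tau> j))" if "j \<le> n" for j
    using nn that by (intro sq_integrable_integrable sq) auto
  then show "expectation (step_integral (W i) n \<tau> c) = 0"
    unfolding step_integral_def[abs_def] using nn by (simp add: sq)
qed

text \<open>Both products are expanded into pairs of steps and compared pairwise, so the two grids
  may be arbitrary and no common refinement is formed.\<close>

lemma step_integral_covariance:
  assumes "0 \<le> \<tau> 0" "\<forall>j<n. \<tau> j \<le> \<tau> (Suc j)" "0 \<le> \<sigma> 0" "\<forall>j<m. \<sigma> j \<le> \<sigma> (Suc j)"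
  shows "expectation (\<lambda>\<omega>. step_integral (W i) n \<tau> c \<omega> * step_integral (W j) m \<sigma> e \<omega>)
    = (if i = j then \<integral>x. step_function n \<tau> c x * step_function m \<sigma> e x \<partial>lborel else 0)"
proof -
  have t: "0 \<le> \<tau> p" if "p \<le> n" for p
    using monotone_steps[OF assms(2) _ that, of 0] assms(1) by simp
  have s: "0 \<le> \<sigma> p" if "p \<le> m" for p
    using monotone_steps[OF assms(4) _ that, of 0] assms(3) by simp
  note sq = brownian_sq_integrable(1)[OF independent_brownian_motion]
  have int: "integrable M (\<lambda>\<omega>. (c p * (W i (\<tau> (Suc p)) \<omega> - W i (\<tau> p) \<omega>)) * (e q * (W j (\<sigma> (Suc q)) \<omega> - W j (\<sigma> q) \<omega>)))"
    if "p < n" "q < m" for p q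
    using that s t by (intro sq_integrable_mult sq_integrable_cmult sq_integrable_diff sq) auto
  have "expectation (\<lambda>\<omega>. step_integral (W i) n \<tau> c \<omega> * step_integral (W j) m \<sigma> e \<omega>)
    = expectation (\<lambda>\<omega>. \<Sum>p<n. \<Sum>q<m. (c p * (W i (\<tau> (Suc p)) \<omega> - W i (\<tau> p) \<omega>)) * (e q * (W j (\<sigma> (Suc q)) \<omega> - W j (\<sigma> q) \<omega>)))"
    by (simp add: step_integral_def sum_product)
  also have "\<dots> = (\<Sum>p<n. \<Sum>q<m. expectation (\<lambda>\<omega>. (c p * (W i (\<tau> (Suc p)) \<omega> - W i (\<tau> p) \<omega>)) * (e q * (W j (\<sigma> (Suc q)) \<omega> - W j (\<sigma> q) \<omega>))))"
    using int by (subst Bochner_Integration.integral_sum; (intro sum.cong refl Bochner_Integration.integral_sum Bochner_Integration.integrable_sum)?) auto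
  also have "\<dots> = (\<Sum>p<n. \<Sum>q<m. if i = j then \<integral>x. (c p * indicator {\<tau> p<..\<tau> (Suc p)} x) * (e q * indicator {\<sigma> q<..\<sigma> (Suc q)} x) \<partial>lborel else 0)"
  proof (intro sum.cong refl)
    fix p q assume p: "p \<in> {..<n}" and q: "q \<in> {..<m}"
    have "expectation (\<lambda>\<omega>. (c p * (W i (\<tau> (Suc p)) \<omega> - W i (\<tau> p) \<omega>)) * (e q * (W j (\<sigma> (Suc q)) \<omega> - W j (\<sigma> q) \<omega>)))
      = (c p * e q) * expectation (\<lambda>\<omega>. (W i (\<tau> (Suc p)) \<omega> - W i (\<tau> p) \<omega>) * (W j (\<sigma> (Suc q)) \<omega> - W j (\<sigma> q) \<omega>))"
      by (subst integral_mult_right_zero[symmetric]) (simp add: ac_simps)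
    also have "\<dots> = (if i = j then (c p * e q) * (\<integral>x. indicator {\<tau> p<..\<tau> (Suc p)} x * indicator {\<sigma> q<..\<sigma> (Suc q)} x \<partial>lborel) else 0)"
      using p q s t assms by (subst increment_covariance) auto
    also have "\<dots> = (if i = j then \<integral>x. (c p * indicator {\<tau> p<..\<tau> (Suc p)} x) * (e q * indicator {\<sigma> q<..\<sigma> (Suc q)} x) \<partial>lborel else 0)"
      by (subst integral_mult_right_zero[symmetric]) (simp add: ac_simps)
    finally show "expectation (\<lambda>\<omega>. (c p * (W i (\<tau> (Suc p)) \<omega> - W i (\<tau> p) \<omega>)) * (e q * (W j (\<sigma> (Suc q)) \<omega> - W j (\<sigma> q) \<omega>)))
      = (if i = j then \<integral>x. (c p * indicator {\<tau> p<..\<tau> (Suc p)} x) * (e q * indicator {\<sigma> q<..\<sigma> (Suc q)} x) \<partial>lborel else 0)" .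
  qed
  also have "\<dots> = (if i = j then \<integral>x. step_function n \<tau> c x * step_function m \<sigma> e x \<partial>lborel else 0)"
  proof -
    have int: "integrable lborel (\<lambda>x. (c p * indicator {\<tau> p<..\<tau> (Suc p)} x) * (e q * indicator {\<sigma> q<..\<sigma> (Suc q)} x) :: real)" for p q
    proof -
      have "sq_integrable lborel (\<lambda>x. indicator {a<..b} x :: real)" for a b :: real
        by (cases "a \<le> b") (auto simp: sq_integrable_def power2_eq_square indicator_inter_arith[symmetric])
      then show ?thesis
        by (intro sq_integrable_mult sq_integrable_cmult)
    qed
    have "(\<integral>x. step_function n \<tau> c x * step_function m \<sigma> e x \<partial>lborel)
        = (\<integral>x. (\<Sum>p<n. \<Sum>q<m. (c p * indicator {\<tau> p<..\<tau> (Suc p)} x) * (e q * indicator {\<sigma> q<..\<sigma> (Suc q)} x)) \<partial>lborel)"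
      by (simp only: step_function_def sum_product)
    also have "\<dots> = (\<Sum>p<n. \<Sum>q<m. \<integral>x. (c p * indicator {\<tau> p<..\<tau> (Suc p)} x) * (e q * indicator {\<sigma> q<..\<sigma> (Suc q)} x) \<partial>lborel)"
      by (simp only: Bochner_Integration.integral_sum Bochner_Integration.integrable_sum int)
    finally show ?thesis
      by (cases "i = j") (simp_all only: if_True if_False sum.neutral_const simp_thms)
  qed
  finally show ?thesis .
qed

lemma step_function_sq_integrable: "sq_integrable lborel (step_function n \<tau> c)"
proof -
  have "sq_integrable lborel (\<lambda>x. indicator {a<..b} x :: real)" for a b :: real
    by (cases "a \<le> b") (auto simp: sq_integrable_def power2_eq_square indicator_inter_arith[symmetric])
  then show ?thesis
    unfolding step_function_def[abs_def] by (intro sq_integrable_sum sq_integrable_cmult)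
qed

text \<open>The grids lie in \<open>{0..t}\<close>, so the step functions vanish outside it.
  Extending \<open>h\<close> by zero turns the convergence into one on the whole line, where
  integrands with different end times can be paired.\<close>

lemma stochastic_integral_approximation:
  assumes J: "has_stochastic_integral M (W i) h t J"
  obtains n \<tau> c where "\<And>m. 0 \<le> \<tau> m 0" "\<And>m. \<forall>j<n m. \<tau> m j \<le> \<tau> m (Suc j)"
    and "(\<lambda>m. \<integral>\<^sup>+x. ennreal ((step_function (n m) (\<tau> m) (c m) x - indicator {0..t} x * h x)\<^sup>2) \<partial>lborel) \<longlonglongrightarrow> 0"
    and "(\<lambda>m. \<integral>\<^sup>+\<omega>. ennreal ((step_integral (W i) (n m) (\<tau> m) (c m) \<omega> - J \<omega>)\<^sup>2) \<partial>M) \<longlonglongrightarrow> 0"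
proof -
  obtain n \<tau> c where \<tau>: "\<And>m. 0 \<le> \<tau> m 0" "\<And>m. \<forall>j<n m. \<tau> m j \<le> \<tau> m (Suc j)" "\<And>m. \<tau> m (n m) \<le> t"
    and lim: "(\<lambda>m. \<integral>\<^sup>+s\<in>{0..t}. ennreal ((step_function (n m) (\<tau> m) (c m) s - h s)\<^sup>2) \<partial>lborel) \<longlonglongrightarrow> 0"
    and limJ: "(\<lambda>m. \<integral>\<^sup>+\<omega>. ennreal ((step_integral (W i) (n m) (\<tau> m) (c m) \<omega> - J \<omega>)\<^sup>2) \<partial>M) \<longlonglongrightarrow> 0"
    using J unfolding has_stochastic_integral_def by blast
  have out: "step_function (n m) (\<tau> m) (c m) x = 0" if "x \<notin> {0..t}" for m x
  proof -
    have "x \<notin> {\<tau> m j<..\<tau> m (Suc j)}" if "j < n m" for j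
    proof -
      have "0 \<le> \<tau> m j" "\<tau> m (Suc j) \<le> t"
        using monotone_steps[OF \<tau>(2), of 0 j m] monotone_steps[OF \<tau>(2), of "Suc j" "n m" m] \<tau>(1)[of m] \<tau>(3)[of m] that
        by auto
      then show ?thesis using \<open>x \<notin> {0..t}\<close> by auto
    qed
    then show ?thesis by (auto simp: step_function_def intro!: sum.neutral)
  qed
  have "(\<integral>\<^sup>+s\<in>{0..t}. ennreal ((step_function (n m) (\<tau> m) (c m) s - h s)\<^sup>2) \<partial>lborel)
      = (\<integral>\<^sup>+x. ennreal ((step_function (n m) (\<tau> m) (c m) x - indicator {0..t} x * h x)\<^sup>2) \<partial>lborel)" for m
    by (intro nn_integral_cong) (auto simp: out split: split_indicator)
  with lim have "(\<lambda>m. \<integral>\<^sup>+x. ennreal ((step_function (n m) (\<tau> m) (c m) x - indicator {0..t} x * h x)\<^sup>2) \<partial>lborel) \<longlonglongrightarrow> 0"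
    by simp
  from that[OF \<tau>(1,2) this limJ] show ?thesis .
qed

lemma stochastic_integral_moments:
  assumes J: "has_stochastic_integral M (W i) h t J"
  shows "sq_integrable M J" and "expectation J = 0"
    and "sq_integrable lborel (\<lambda>x. indicator {0..t} x * h x)"
proof -
  obtain n \<tau> c where \<tau>: "\<And>m. 0 \<le> \<tau> m 0" "\<And>m. \<forall>j<n m. \<tau> m j \<le> \<tau> m (Suc j)"
    and lim: "(\<lambda>m. \<integral>\<^sup>+x. ennreal ((step_function (n m) (\<tau> m) (c m) x - indicator {0..t} x * h x)\<^sup>2) \<partial>lborel) \<longlonglongrightarrow> 0"
    and limJ: "(\<lambda>m. \<integral>\<^sup>+\<omega>. ennreal ((step_integral (W i) (n m) (\<tau> m) (c m) \<omega> - J \<omega>)\<^sup>2) \<partial>M) \<longlonglongrightarrow> 0"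
    by (rule stochastic_integral_approximation[OF J]) blast
  have Jm: "J \<in> borel_measurable M" and h: "(\<lambda>x. indicator {0..t} x * h x) \<in> borel_measurable lborel"
    using J by (auto simp: has_stochastic_integral_def set_borel_measurable_def)
  show "sq_integrable M J"
    by (rule sq_integrable_limit(1)[OF step_integral_sq_integrable(1)[OF \<tau>] Jm limJ])
  show "sq_integrable lborel (\<lambda>x. indicator {0..t} x * h x)"
    by (rule sq_integrable_limit(1)[OF step_function_sq_integrable h lim])
  have "(\<lambda>m. expectation (step_integral (W i) (n m) (\<tau> m) (c m))) \<longlonglongrightarrow> expectation J"
    by (rule sq_integrable_limit_expectation[OF step_integral_sq_integrable(1)[OF \<tau>] Jm limJ])
  then show "expectation J = 0"
    using \<tau> by (simp add: step_integral_sq_integrable(2) LIMSEQ_const_iff)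
qed

text \<open>The polarized isometry with different end times. The step identity holds along the
  approximations, and its two sides are mean-square pairings, under \<open>M\<close> and under
  Lebesgue measure, which converge.\<close>

lemma stochastic_integral_covariance:
  assumes J: "has_stochastic_integral M (W i) h s J" and L: "has_stochastic_integral M (W j) k t L"
  shows "expectation (\<lambda>\<omega>. J \<omega> * L \<omega>)
    = (if i = j then \<integral>x. (indicator {0..s} x * h x) * (indicator {0..t} x * k x) \<partial>lborel else 0)"
proof -
  obtain n \<tau> c where \<tau>: "\<And>m. 0 \<le> \<tau> m 0" "\<And>m. \<forall>j<n m. \<tau> m j \<le> \<tau> m (Suc j)"
    and lim: "(\<lambda>m. \<integral>\<^sup>+x. ennreal ((step_function (n m) (\<tau> m) (c m) x - indicator {0..s} x * h x)\<^sup>2) \<partial>lborel) \<longlonglongrightarrow> 0"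
    and limJ: "(\<lambda>m. \<integral>\<^sup>+\<omega>. ennreal ((step_integral (W i) (n m) (\<tau> m) (c m) \<omega> - J \<omega>)\<^sup>2) \<partial>M) \<longlonglongrightarrow> 0"
    by (rule stochastic_integral_approximation[OF J]) blast
  obtain n' \<sigma> e where \<sigma>: "\<And>m. 0 \<le> \<sigma> m 0" "\<And>m. \<forall>j<n' m. \<sigma> m j \<le> \<sigma> m (Suc j)"
    and lim': "(\<lambda>m. \<integral>\<^sup>+x. ennreal ((step_function (n' m) (\<sigma> m) (e m) x - indicator {0..t} x * k x)\<^sup>2) \<partial>lborel) \<longlonglongrightarrow> 0"
    and limL: "(\<lambda>m. \<integral>\<^sup>+\<omega>. ennreal ((step_integral (W j) (n' m) (\<sigma> m) (e m) \<omega> - L \<omega>)\<^sup>2) \<partial>M) \<longlonglongrightarrow> 0"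
    by (rule stochastic_integral_approximation[OF L]) blast
  note m = sq_integrable_measurable[OF stochastic_integral_moments(1)] sq_integrable_measurable[OF stochastic_integral_moments(3)]
  have "(\<lambda>m. expectation (\<lambda>\<omega>. step_integral (W i) (n m) (\<tau> m) (c m) \<omega> * step_integral (W j) (n' m) (\<sigma> m) (e m) \<omega>))
      \<longlonglongrightarrow> expectation (\<lambda>\<omega>. J \<omega> * L \<omega>)"
    by (rule sq_integrable_limit_mult[OF step_integral_sq_integrable(1)[OF \<tau>] m(1)[OF J] limJ step_integral_sq_integrable(1)[OF \<sigma>] m(1)[OF L] limL])
  moreover have "(\<lambda>m. \<integral>x. step_function (n m) (\<tau> m) (c m) x * step_function (n' m) (\<sigma> m) (e m) x \<partial>lborel)
      \<longlonglongrightarrow> (\<integral>x. (indicator {0..s} x * h x) * (indicator {0..t} x * k x) \<partial>lborel)"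
    by (rule sq_integrable_limit_mult[OF step_function_sq_integrable m(2)[OF J] lim step_function_sq_integrable m(2)[OF L] lim'])
  ultimately show ?thesis
    using \<tau> \<sigma> by (cases "i = j") (auto simp: step_integral_covariance LIMSEQ_const_iff dest: LIMSEQ_unique)
qed

end

section \<open>Linear equations with additive noise\<close>

lemma (in prob_space) integrable_time_product:
  fixes F :: "real \<Rightarrow> 'a \<Rightarrow> real"
  assumes F: "(\<lambda>(s, \<omega>). F s \<omega>) \<in> borel_measurable (borel \<Otimes>\<^sub>M M)"
    and int: "\<And>s. s \<in> {0..t} \<Longrightarrow> integrable M (F s)"
    and bound: "\<And>s. s \<in> {0..t} \<Longrightarrow> expectation (\<lambda>\<omega>. \<bar>F s \<omega>\<bar>) \<le> B"
  shows "integrable (lborel \<Otimes>\<^sub>M M) (\<lambda>(s, \<omega>). indicator {0..t} s * F s \<omega>)"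
proof -
  interpret P: pair_sigma_finite lborel M ..
  have [measurable]: "(\<lambda>(s, \<omega>). F s \<omega>) \<in> borel_measurable (lborel \<Otimes>\<^sub>M M)"
    using F by (simp cong: measurable_cong_sets)
  show ?thesis
  proof (rule P.Fubini_integrable)
    show m: "(\<lambda>(s, \<omega>). indicator {0..t} s * F s \<omega>) \<in> borel_measurable (lborel \<Otimes>\<^sub>M M)"
      by measurable
    show "integrable lborel (\<lambda>s. \<integral>\<omega>. norm (case (s, \<omega>) of (s, \<omega>) \<Rightarrow> indicator {0..t} s * F s \<omega>) \<partial>M)"
    proof (rule Bochner_Integration.integrable_bound)
      show "integrable lborel (\<lambda>s. B * indicator {0..t} s :: real)"
        by (cases "0 \<le> t") auto
      show "(\<lambda>s. \<integral>\<omega>. norm (case (s, \<omega>) of (s, \<omega>) \<Rightarrow> indicator {0..t} s * F s \<omega>) \<partial>M) \<in> borel_measurable lborel"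
        by measurable
      have "\<bar>\<integral>\<omega>. \<bar>indicator {0..t} s * F s \<omega>\<bar> \<partial>M\<bar> \<le> \<bar>B * indicator {0..t} s\<bar>" for s
        using bound[of s] by (cases "s \<in> {0..t}") (auto simp: abs_of_nonneg)
      then show "AE s in lborel. norm (\<integral>\<omega>. norm (case (s, \<omega>) of (s, \<omega>) \<Rightarrow> indicator {0..t} s * F s \<omega>) \<partial>M)
          \<le> norm (B * indicator {0..t} s :: real)"
        by simp
    qed
    show "AE s in lborel. integrable M (\<lambda>\<omega>. case (s, \<omega>) of (s, \<omega>) \<Rightarrow> indicator {0..t} s * F s \<omega>)"
      using int by (auto split: split_indicator)
  qed
qed

context prob_space
begin

context
  fixes p :: "real \<Rightarrow> 'a \<Rightarrow> real" and t B :: real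
  assumes p: "(\<lambda>(s, \<omega>). p s \<omega>) \<in> borel_measurable (borel \<Otimes>\<^sub>M M)"
    and sq: "\<And>s. s \<in> {0..t} \<Longrightarrow> sq_integrable M (p s)"
    and B: "\<And>s. s \<in> {0..t} \<Longrightarrow> expectation (\<lambda>\<omega>. (p s \<omega>)\<^sup>2) \<le> B"
begin

interpretation P: pair_sigma_finite lborel M ..

lemma integrable_time_product_mult:
  assumes X: "sq_integrable M X"
  shows "integrable (lborel \<Otimes>\<^sub>M M) (\<lambda>(s, \<omega>). indicator {0..t} s * (X \<omega> * p s \<omega>))"
proof (rule integrable_time_product)
  note [measurable] = p sq_integrable_measurable[OF X]
  show "(\<lambda>(s, \<omega>). X \<omega> * p s \<omega>) \<in> borel_measurable (borel \<Otimes>\<^sub>M M)"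
    by measurable
  fix s assume s: "s \<in> {0..t}"
  show "integrable M (\<lambda>\<omega>. X \<omega> * p s \<omega>)"
    by (rule sq_integrable_mult[OF X sq[OF s]])
  have a: "sq_integrable M (\<lambda>\<omega>. \<bar>X \<omega>\<bar>)" "sq_integrable M (\<lambda>\<omega>. \<bar>p s \<omega>\<bar>)"
    using X sq[OF s] by (auto simp: sq_integrable_def)
  have "expectation (\<lambda>\<omega>. \<bar>X \<omega> * p s \<omega>\<bar>) \<le> sqrt (expectation (\<lambda>\<omega>. (X \<omega>)\<^sup>2)) * sqrt (expectation (\<lambda>\<omega>. (p s \<omega>)\<^sup>2))"
    using sq_integrable_Cauchy_Schwarz[OF a] by (simp add: abs_mult)
  also have "\<dots> \<le> sqrt (expectation (\<lambda>\<omega>. (X \<omega>)\<^sup>2)) * sqrt B"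
    using B[OF s] by (intro mult_left_mono) auto
  finally show "expectation (\<lambda>\<omega>. \<bar>X \<omega> * p s \<omega>\<bar>) \<le> sqrt (expectation (\<lambda>\<omega>. (X \<omega>)\<^sup>2)) * sqrt B" .
qed

lemma time_integral_sq_integrable: "sq_integrable M (\<lambda>\<omega>. LBINT s:{0..t}. p s \<omega>)"
proof -
  note [measurable] = p
  have [measurable]: "(\<lambda>(s, \<omega>). p s \<omega>) \<in> borel_measurable (lborel \<Otimes>\<^sub>M M)"
    using p by (simp cong: measurable_cong_sets)
  have U: "(\<lambda>\<omega>. LBINT s:{0..t}. p s \<omega>) \<in> borel_measurable M"
    unfolding set_lebesgue_integral_def by measurable
  have int: "integrable (lborel \<Otimes>\<^sub>M M) (\<lambda>(s, \<omega>). indicator {0..t} s * (p s \<omega>)\<^sup>2)"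
  proof (rule integrable_time_product)
    show "expectation (\<lambda>\<omega>. \<bar>(p s \<omega>)\<^sup>2\<bar>) \<le> B" if "s \<in> {0..t}" for s
      using B[OF that] by simp
    show "integrable M (\<lambda>\<omega>. (p s \<omega>)\<^sup>2)" if "s \<in> {0..t}" for s
      by (rule sq_integrable_square[OF sq[OF that]])
  qed measurable
  let ?i = "indicator {0..t} :: real \<Rightarrow> real"
  \<comment> \<open>The length of the interval, which is the constant from the Cauchy-Schwarz
    inequality against the indicator.\<close>
  define c where "c = (LBINT s. (?i s)\<^sup>2)"
  let ?G = "\<lambda>\<omega>. LBINT s. ?i s * (p s \<omega>)\<^sup>2"
  have i2: "sq_integrable lborel ?i"
    by (cases "0 \<le> t") (auto simp: sq_integrable_def power2_eq_square indicator_inter_arith[symmetric])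
  have G: "integrable M ?G"
    using P.integrable_snd[OF int] by simp
  have "AE \<omega> in M. integrable lborel (\<lambda>s. ?i s * (p s \<omega>)\<^sup>2)"
    using P.AE_integrable_snd[OF int] by simp
  \<comment> \<open>Fubini's theorem makes the path square integrable in time for almost every
    sample point, hence a bound that holds almost everywhere.\<close>
  then have "AE \<omega> in M. (LBINT s:{0..t}. p s \<omega>)\<^sup>2 \<le> c * ?G \<omega>"
  proof (rule AE_mp[OF _ AE_I2], intro impI)
    fix \<omega> assume \<omega>: "\<omega> \<in> space M" and "integrable lborel (\<lambda>s. ?i s * (p s \<omega>)\<^sup>2)"
    moreover have sqi: "(?i s * p s \<omega>)\<^sup>2 = ?i s * (p s \<omega>)\<^sup>2" for s
      by (simp split: split_indicator)
    moreover have "(\<lambda>s. ?i s * p s \<omega>) \<in> borel_measurable lborel"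
      using \<omega> by measurable
    ultimately have p2: "sq_integrable lborel (\<lambda>s. ?i s * p s \<omega>)"
      by (simp add: sq_integrable_def)
    have "(LBINT s:{0..t}. p s \<omega>) = (LBINT s. ?i s * (?i s * p s \<omega>))"
      unfolding set_lebesgue_integral_def by (intro Bochner_Integration.integral_cong) (auto split: split_indicator)
    then have "\<bar>LBINT s:{0..t}. p s \<omega>\<bar> \<le> sqrt c * sqrt (?G \<omega>)"
      using sq_integrable_Cauchy_Schwarz[OF i2 p2] by (simp add: c_def sqi)
    then have "\<bar>LBINT s:{0..t}. p s \<omega>\<bar>\<^sup>2 \<le> (sqrt c * sqrt (?G \<omega>))\<^sup>2"
      by (intro power_mono) auto
    also have "\<dots> = c * ?G \<omega>"
      by (simp add: power_mult_distrib c_def integral_nonneg)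
    finally show "(LBINT s:{0..t}. p s \<omega>)\<^sup>2 \<le> c * ?G \<omega>"
      by simp
  qed
  then have "AE \<omega> in M. norm ((LBINT s:{0..t}. p s \<omega>)\<^sup>2) \<le> norm (c * ?G \<omega>)"
    by eventually_elim auto
  then have "integrable M (\<lambda>\<omega>. (LBINT s:{0..t}. p s \<omega>)\<^sup>2)"
  proof (rule Bochner_Integration.integrable_bound[rotated 2])
    show "integrable M (\<lambda>\<omega>. c * ?G \<omega>)"
      by (rule integrable_mult_right[OF G])
    show "(\<lambda>\<omega>. (LBINT s:{0..t}. p s \<omega>)\<^sup>2) \<in> borel_measurable M"
      by (rule borel_measurable_power[OF U])
  qed
  with U show ?thesis
    by (simp add: sq_integrable_def)
qed

lemma expectation_time_integral:
  assumes X: "sq_integrable M X"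
  shows "set_integrable lborel {0..t} (\<lambda>s. expectation (\<lambda>\<omega>. X \<omega> * p s \<omega>))"
    and "expectation (\<lambda>\<omega>. X \<omega> * (LBINT s:{0..t}. p s \<omega>)) = (LBINT s:{0..t}. expectation (\<lambda>\<omega>. X \<omega> * p s \<omega>))"
proof -
  note int = integrable_time_product_mult[OF X]
  show "set_integrable lborel {0..t} (\<lambda>s. expectation (\<lambda>\<omega>. X \<omega> * p s \<omega>))"
    using P.integrable_fst'[OF int] by (simp add: set_integrable_def)
  have "expectation (\<lambda>\<omega>. LBINT s. indicator {0..t} s * (X \<omega> * p s \<omega>))
      = (LBINT s. expectation (\<lambda>\<omega>. indicator {0..t} s * (X \<omega> * p s \<omega>)))"
    using P.Fubini_integral[OF int] by simp
  moreover have "X \<omega> * (LBINT s:{0..t}. p s \<omega>) = (LBINT s. indicator {0..t} s * (X \<omega> * p s \<omega>))" for \<omega>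
    unfolding set_lebesgue_integral_def
    by (subst integral_mult_right_zero[symmetric]) (simp add: mult.left_commute)
  ultimately show "expectation (\<lambda>\<omega>. X \<omega> * (LBINT s:{0..t}. p s \<omega>)) = (LBINT s:{0..t}. expectation (\<lambda>\<omega>. X \<omega> * p s \<omega>))"
    by (simp add: set_lebesgue_integral_def)
qed

end

end

text \<open>The square is cut along its diagonal, a null set, and each triangle is integrated first
  along its shorter variable. For \<open>q\<close> of product form this is the integrated product
  rule for two indefinite integrals.\<close>

lemma triangle_Fubini:
  fixes q :: "real \<Rightarrow> real \<Rightarrow> real"
  assumes q: "(\<lambda>(s, r). q s r) \<in> borel_measurable (borel \<Otimes>\<^sub>M borel)"
    and bound: "\<And>s r. s \<in> {0..t} \<Longrightarrow> r \<in> {0..t} \<Longrightarrow> \<bar>q s r\<bar> \<le> B"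
  shows "set_integrable lborel {0..t} (\<lambda>s. LBINT r:{0..s}. q s r)"
    and "set_integrable lborel {0..t} (\<lambda>r. LBINT s:{0..r}. q s r)"
    and "(LBINT s:{0..t}. LBINT r:{0..t}. q s r)
      = (LBINT s:{0..t}. LBINT r:{0..s}. q s r) + (LBINT r:{0..t}. LBINT s:{0..r}. q s r)"
proof -
  let ?P = "lborel \<Otimes>\<^sub>M lborel :: (real \<times> real) measure"
  let ?i = "\<lambda>t. indicator {0..t} :: real \<Rightarrow> real"
  have [measurable]: "(\<lambda>(s, r). q s r) \<in> borel_measurable ?P"
    using q by (simp cong: measurable_cong_sets)
  have [measurable]: "(\<lambda>(s, r). ?i s r) \<in> borel_measurable ?P"
  proof -
    have "{z \<in> space ?P. 0 \<le> snd z \<and> snd z \<le> fst z} \<in> sets ?P"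
      by measurable
    then have "{z :: real \<times> real. 0 \<le> snd z \<and> snd z \<le> fst z} \<in> sets ?P"
      by (simp add: space_pair_measure)
    then have "indicator {z :: real \<times> real. 0 \<le> snd z \<and> snd z \<le> fst z} \<in> borel_measurable ?P"
      by measurable
    moreover have "(\<lambda>(s, r). ?i s r) = indicator {z :: real \<times> real. 0 \<le> snd z \<and> snd z \<le> fst z}"
      by (auto simp: fun_eq_iff split: split_indicator)
    ultimately show ?thesis by simp
  qed
  have [measurable]: "(\<lambda>(s, r). ?i r s) \<in> borel_measurable ?P"
    using measurable_compose[OF measurable_pair_swap' \<open>(\<lambda>(s, r). ?i s r) \<in> borel_measurable ?P\<close>]
    by (simp add: case_prod_beta')
  have square: "integrable ?P (\<lambda>(s, r). (?i t s * ?i t r) * B)"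
  proof -
    have "integrable ?P (indicator ({0..t} \<times> {0..t}) :: real \<times> real \<Rightarrow> real)"
      by (cases "0 \<le> t") (auto simp: lborel.emeasure_pair_measure_Times ennreal_mult_less_top)
    then have "integrable ?P (\<lambda>z. indicator ({0..t} \<times> {0..t}) z * B)"
      by (rule integrable_mult_left)
    moreover have "indicator ({0..t} \<times> {0..t}) z * B = (case z of (s, r) \<Rightarrow> (?i t s * ?i t r) * B)" for z :: "real \<times> real"
      by (cases z) (auto simp: indicator_def)
    ultimately show ?thesis by simp
  qed
  have lower: "integrable ?P (\<lambda>(s, r). ?i t s * (?i s r * q s r))"
  proof (rule Bochner_Integration.integrable_bound[OF square])
    show "(\<lambda>(s, r). ?i t s * (?i s r * q s r)) \<in> borel_measurable ?P" by measurable
    have "\<bar>?i t s * (?i s r * q s r)\<bar> \<le> \<bar>(?i t s * ?i t r) * B\<bar>" for s r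
      using bound[of s r] by (auto split: split_indicator)
    then show "AE z in ?P. norm (case z of (s, r) \<Rightarrow> ?i t s * (?i s r * q s r)) \<le> norm (case z of (s, r) \<Rightarrow> (?i t s * ?i t r) * B)"
      by auto
  qed
  have upper: "integrable ?P (\<lambda>(s, r). ?i t r * (?i r s * q s r))"
  proof (rule Bochner_Integration.integrable_bound[OF square])
    show "(\<lambda>(s, r). ?i t r * (?i r s * q s r)) \<in> borel_measurable ?P" by measurable
    have "\<bar>?i t r * (?i r s * q s r)\<bar> \<le> \<bar>(?i t s * ?i t r) * B\<bar>" for s r
      using bound[of s r] by (auto split: split_indicator)
    then show "AE z in ?P. norm (case z of (s, r) \<Rightarrow> ?i t r * (?i r s * q s r)) \<le> norm (case z of (s, r) \<Rightarrow> (?i t s * ?i t r) * B)"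
      by auto
  qed
  show "set_integrable lborel {0..t} (\<lambda>s. LBINT r:{0..s}. q s r)"
    using lborel_pair.integrable_fst'[OF lower] by (simp add: set_integrable_def set_lebesgue_integral_def)
  show "set_integrable lborel {0..t} (\<lambda>r. LBINT s:{0..r}. q s r)"
    using lborel_pair.integrable_snd[OF upper] by (simp add: set_integrable_def set_lebesgue_integral_def)
  have full: "integrable ?P (\<lambda>(s, r). ?i t s * (?i t r * q s r))"
  proof (rule Bochner_Integration.integrable_bound[OF square])
    show "(\<lambda>(s, r). ?i t s * (?i t r * q s r)) \<in> borel_measurable ?P" by measurable
    have "\<bar>?i t s * (?i t r * q s r)\<bar> \<le> \<bar>(?i t s * ?i t r) * B\<bar>" for s r
      using bound[of s r] by (auto split: split_indicator)
    then show "AE z in ?P. norm (case z of (s, r) \<Rightarrow> ?i t s * (?i t r * q s r)) \<le> norm (case z of (s, r) \<Rightarrow> (?i t s * ?i t r) * B)"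
      by auto
  qed
  have "(LBINT s:{0..t}. LBINT r:{0..t}. q s r) = (\<integral>z. (case z of (s, r) \<Rightarrow> ?i t s * (?i t r * q s r)) \<partial>?P)"
    using lborel_pair.integral_fst'[OF full] by (simp add: set_lebesgue_integral_def)
  also have "\<dots> = (\<integral>z. (case z of (s, r) \<Rightarrow> ?i t s * (?i s r * q s r)) + (case z of (s, r) \<Rightarrow> ?i t r * (?i r s * q s r)) \<partial>?P)"
  proof (rule integral_cong_AE)
    \<comment> \<open>The two closed triangles overlap in the diagonal, where the integrands would
      be counted twice.\<close>
    have "AE s in lborel. AE r in lborel. (s::real) \<noteq> r"
    proof (rule AE_I2)
      fix s :: real
      show "AE r in lborel. s \<noteq> r"
        using AE_lborel_singleton[of s] by eventually_elim auto
    qed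
    moreover have "{z \<in> space ?P. fst z \<noteq> snd z} \<in> sets ?P"
      by measurable
    ultimately have "AE z in ?P. fst z \<noteq> snd z"
      by (intro lborel_pair.AE_pair_measure) auto
    then show "AE z in ?P. (case z of (s, r) \<Rightarrow> ?i t s * (?i t r * q s r))
        = (case z of (s, r) \<Rightarrow> ?i t s * (?i s r * q s r)) + (case z of (s, r) \<Rightarrow> ?i t r * (?i r s * q s r))"
      by eventually_elim (auto split: split_indicator)
  qed measurable
  also have "\<dots> = (\<integral>z. (case z of (s, r) \<Rightarrow> ?i t s * (?i s r * q s r)) \<partial>?P) + (\<integral>z. (case z of (s, r) \<Rightarrow> ?i t r * (?i r s * q s r)) \<partial>?P)"
    by (rule Bochner_Integration.integral_add[OF lower upper])
  also have "(\<integral>z. (case z of (s, r) \<Rightarrow> ?i t s * (?i s r * q s r)) \<partial>?P) = (LBINT s:{0..t}. LBINT r:{0..s}. q s r)"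
    using lborel_pair.integral_fst'[OF lower] by (simp add: set_lebesgue_integral_def)
  also have "(\<integral>z. (case z of (s, r) \<Rightarrow> ?i t r * (?i r s * q s r)) \<partial>?P) = (LBINT r:{0..t}. LBINT s:{0..r}. q s r)"
    using lborel_pair.integral_snd[OF upper] by (simp add: set_lebesgue_integral_def)
  finally show "(LBINT s:{0..t}. LBINT r:{0..t}. q s r)
      = (LBINT s:{0..t}. LBINT r:{0..s}. q s r) + (LBINT r:{0..t}. LBINT s:{0..r}. q s r)" .
qed

text \<open>The product rule in expectation, obtained with the deterministic kernel
  \<open>E[p s * r u]\<close>. Its integral over the square is \<open>E[U t * R t]\<close>, and the
  inner integral over each triangle restores \<open>R s\<close> or \<open>U s\<close>.\<close>

lemma (in prob_space) expectation_time_integral_product: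
  fixes p r :: "real \<Rightarrow> 'a \<Rightarrow> real"
  assumes p: "(\<lambda>(s, \<omega>). p s \<omega>) \<in> borel_measurable (borel \<Otimes>\<^sub>M M)"
    and p_sq: "\<And>s. s \<in> {0..t} \<Longrightarrow> sq_integrable M (p s)"
    and p_B: "\<And>s. s \<in> {0..t} \<Longrightarrow> expectation (\<lambda>\<omega>. (p s \<omega>)\<^sup>2) \<le> B"
    and r: "(\<lambda>(s, \<omega>). r s \<omega>) \<in> borel_measurable (borel \<Otimes>\<^sub>M M)"
    and r_sq: "\<And>s. s \<in> {0..t} \<Longrightarrow> sq_integrable M (r s)"
    and r_B: "\<And>s. s \<in> {0..t} \<Longrightarrow> expectation (\<lambda>\<omega>. (r s \<omega>)\<^sup>2) \<le> B"
  defines "U \<equiv> \<lambda>t \<omega>. LBINT s:{0..t}. p s \<omega>" and "R \<equiv> \<lambda>t \<omega>. LBINT s:{0..t}. r s \<omega>"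
  shows "set_integrable lborel {0..t} (\<lambda>s. expectation (\<lambda>\<omega>. p s \<omega> * R s \<omega>))" (is ?i1)
    and "set_integrable lborel {0..t} (\<lambda>s. expectation (\<lambda>\<omega>. U s \<omega> * r s \<omega>))" (is ?i2)
    and "expectation (\<lambda>\<omega>. U t \<omega> * R t \<omega>) = (LBINT s:{0..t}. expectation (\<lambda>\<omega>. p s \<omega> * R s \<omega>))
      + (LBINT s:{0..t}. expectation (\<lambda>\<omega>. U s \<omega> * r s \<omega>))" (is ?eq)
proof -
  let ?q = "\<lambda>s u. expectation (\<lambda>\<omega>. p s \<omega> * r u \<omega>)"
  have q: "(\<lambda>(s, u). ?q s u) \<in> borel_measurable (borel \<Otimes>\<^sub>M borel)"
  proof -
    have "(\<lambda>z. (fst (fst z), snd z)) \<in> (borel \<Otimes>\<^sub>M borel) \<Otimes>\<^sub>M M \<rightarrow>\<^sub>M borel \<Otimes>\<^sub>M M"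
      "(\<lambda>z. (snd (fst z), snd z)) \<in> (borel \<Otimes>\<^sub>M borel) \<Otimes>\<^sub>M M \<rightarrow>\<^sub>M borel \<Otimes>\<^sub>M M"
      by measurable
    from measurable_compose[OF this(1) p] measurable_compose[OF this(2) r]
    have [measurable]: "(\<lambda>z. p (fst (fst z)) (snd z)) \<in> borel_measurable ((borel \<Otimes>\<^sub>M borel) \<Otimes>\<^sub>M M)"
      "(\<lambda>z. r (snd (fst z)) (snd z)) \<in> borel_measurable ((borel \<Otimes>\<^sub>M borel) \<Otimes>\<^sub>M M)"
      by simp_all
    have "(\<lambda>(z, \<omega>). p (fst z) \<omega> * r (snd z) \<omega>) \<in> borel_measurable ((borel \<Otimes>\<^sub>M borel) \<Otimes>\<^sub>M M)"
      unfolding case_prod_beta' by measurable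
    from borel_measurable_lebesgue_integral[OF this] show ?thesis
      by (simp add: case_prod_beta')
  qed
  have qB: "\<bar>?q s u\<bar> \<le> B" if s: "s \<in> {0..t}" and u: "u \<in> {0..t}" for s u
  proof -
    have B: "0 \<le> B"
      using p_B[OF s] by (rule order.trans[rotated]) (simp add: integral_nonneg)
    have "\<bar>?q s u\<bar> \<le> sqrt (expectation (\<lambda>\<omega>. (p s \<omega>)\<^sup>2)) * sqrt (expectation (\<lambda>\<omega>. (r u \<omega>)\<^sup>2))"
      by (rule sq_integrable_Cauchy_Schwarz[OF p_sq[OF s] r_sq[OF u]])
    also have "\<dots> \<le> sqrt B * sqrt B"
      using p_B[OF s] r_B[OF u] B by (intro mult_mono) (auto simp: integral_nonneg)
    finally show ?thesis using B by simp
  qed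
  have pR: "expectation (\<lambda>\<omega>. p s \<omega> * R v \<omega>) = (LBINT u:{0..v}. ?q s u)" if "s \<in> {0..t}" "v \<le> t" for s v
    unfolding R_def using that
    by (intro expectation_time_integral(2)[where B = B]) (auto intro: r r_sq r_B p_sq)
  have Ur: "expectation (\<lambda>\<omega>. U v \<omega> * r u \<omega>) = (LBINT s:{0..v}. ?q s u)" if "u \<in> {0..t}" "v \<le> t" for u v
  proof -
    have "expectation (\<lambda>\<omega>. r u \<omega> * U v \<omega>) = (LBINT s:{0..v}. expectation (\<lambda>\<omega>. r u \<omega> * p s \<omega>))"
      unfolding U_def using that
      by (intro expectation_time_integral(2)[where B = B]) (auto intro: p r_sq p_B p_sq)
    then show ?thesis by (simp add: mult.commute)
  qed
  note tri = triangle_Fubini[OF q qB]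
  show ?i1
    using tri(1) by (rule set_integrable_cong[THEN iffD1, rotated 3]) (auto simp: pR)
  show ?i2
    using tri(2) by (rule set_integrable_cong[THEN iffD1, rotated 3]) (auto simp: Ur)
  have "expectation (\<lambda>\<omega>. R t \<omega> * U t \<omega>) = (LBINT s:{0..t}. expectation (\<lambda>\<omega>. R t \<omega> * p s \<omega>))"
  proof -
    have "sq_integrable M (R t)"
      unfolding R_def by (rule time_integral_sq_integrable[OF r r_sq r_B])
    from expectation_time_integral(2)[OF p p_sq p_B this] show ?thesis
      unfolding U_def by simp
  qed
  also have "\<dots> = (LBINT s:{0..t}. LBINT u:{0..t}. ?q s u)"
    by (rule set_lebesgue_integral_cong) (auto simp: pR[symmetric] mult.commute)
  also have "\<dots> = (LBINT s:{0..t}. LBINT u:{0..s}. ?q s u) + (LBINT u:{0..t}. LBINT s:{0..u}. ?q s u)"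
    by (rule tri(3))
  also have "(LBINT s:{0..t}. LBINT u:{0..s}. ?q s u) = (LBINT s:{0..t}. expectation (\<lambda>\<omega>. p s \<omega> * R s \<omega>))"
    by (rule set_lebesgue_integral_cong) (auto simp: pR)
  also have "(LBINT u:{0..t}. LBINT s:{0..u}. ?q s u) = (LBINT s:{0..t}. expectation (\<lambda>\<omega>. U s \<omega> * r s \<omega>))"
    by (rule set_lebesgue_integral_cong) (auto simp: Ur)
  finally show ?eq by (simp add: mult.commute)
qed

text \<open>The bound contains an integral of \<open>n\<close> where a supremum would be usual: for
  random \<open>n\<close> the second moment of the integral follows from those of the values
  \<open>n t\<close>.\<close>

lemma Gronwall_integral:
  fixes y n :: "real \<Rightarrow> real"
  assumes y: "continuous_on {0..T} y" and n: "continuous_on {0..T} n"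
    and n0: "\<And>t. t \<in> {0..T} \<Longrightarrow> 0 \<le> n t" and L: "0 \<le> L"
    and le: "\<And>t. t \<in> {0..T} \<Longrightarrow> y t \<le> n t + L * integral {0..t} y" and t: "t \<in> {0..T}"
  shows "y t \<le> n t + L * exp (L * T) * integral {0..T} n"
proof -
  let ?w = "\<lambda>t. integral {0..t} y" and ?m = "\<lambda>t. integral {0..t} n"
  \<comment> \<open>By hypothesis \<open>y - L * ?w \<le> n\<close>, so the derivative of this
    function is at most \<open>(exp (- L * s) - 1) * n s\<close>, which is not positive.\<close>
  let ?\<phi> = "\<lambda>t. exp (- L * t) * ?w t - ?m t"
  have deriv: "(?\<phi> has_vector_derivative (exp (- L * s) * y s - L * exp (- L * s) * ?w s - n s)) (at s within {0..T})"
    if s: "s \<in> {0..T}" for s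
  proof -
    have "(?w has_real_derivative y s) (at s within {0..T})" "(?m has_real_derivative n s) (at s within {0..T})"
      using integral_has_vector_derivative[OF y s] integral_has_vector_derivative[OF n s]
      by (auto simp: has_real_derivative_iff_has_vector_derivative)
    then have "(?\<phi> has_real_derivative (exp (- L * s) * y s - L * exp (- L * s) * ?w s - n s)) (at s within {0..T})"
      by (auto intro!: derivative_eq_intros)
    then show ?thesis
      by (simp add: has_real_derivative_iff_has_vector_derivative)
  qed
  have nonpos: "exp (- L * s) * y s - L * exp (- L * s) * ?w s - n s \<le> 0" if s: "s \<in> {0..T}" for s
  proof -
    have "exp (- L * s) * (y s - L * ?w s) \<le> exp (- L * s) * n s"
      using le[OF s] by (intro mult_left_mono) auto
    also have "\<dots> \<le> 1 * n s"
      using s L n0[OF s] by (intro mult_right_mono) auto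
    finally show ?thesis by (simp add: algebra_simps)
  qed
  have "?\<phi> t - ?\<phi> 0 \<le> 0"
  proof -
    have "((\<lambda>s. exp (- L * s) * y s - L * exp (- L * s) * ?w s - n s) has_integral (?\<phi> t - ?\<phi> 0)) {0..t}"
      using t by (intro fundamental_theorem_of_calculus has_vector_derivative_within_subset[OF deriv]) auto
    from has_integral_le[OF this has_integral_0] show ?thesis
      using nonpos t by auto
  qed
  then have "exp (- L * t) * ?w t \<le> ?m t" by simp
  also have "\<dots> \<le> ?m T"
    using t n0 by (intro integral_subset_le integrable_continuous_real continuous_on_subset[OF n]) auto
  finally have "exp (L * t) * (exp (- L * t) * ?w t) \<le> exp (L * t) * ?m T"
    by (intro mult_left_mono) auto
  then have "?w t \<le> exp (L * t) * ?m T"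
    by (simp add: mult.assoc[symmetric] exp_add[symmetric])
  also have "\<dots> \<le> exp (L * T) * ?m T"
    using t L n0 by (intro mult_right_mono Henstock_Kurzweil_Integration.integral_nonneg integrable_continuous_real n) (auto intro: mult_left_mono)
  finally have "L * ?w t \<le> L * (exp (L * T) * ?m T)"
    using L by (rule mult_left_mono)
  with le[OF t] show ?thesis by (simp add: mult.assoc)
qed

text \<open>Rounding time down to a grid of mesh \<open>1 / Suc n\<close> leaves countably many
  times, for which joint measurability is immediate; continuous paths let the mesh tend to
  zero.\<close>

lemma borel_measurable_continuous_process:
  fixes V :: "real \<Rightarrow> 'w \<Rightarrow> real"
  assumes V [measurable]: "\<And>t. V t \<in> borel_measurable M"
    and cont: "\<And>\<omega>. \<omega> \<in> space M \<Longrightarrow> continuous_on UNIV (\<lambda>t. V t \<omega>)"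
  shows "(\<lambda>(s, \<omega>). V s \<omega>) \<in> borel_measurable (borel \<Otimes>\<^sub>M M)"
proof (rule borel_measurable_LIMSEQ_real)
  let ?g = "\<lambda>n s. of_int \<lfloor>real (Suc n) * s\<rfloor> / real (Suc n) :: real"
  show "(\<lambda>(s :: real, \<omega>). V (?g n s) \<omega>) \<in> borel_measurable (borel \<Otimes>\<^sub>M M)" for n
  proof -
    have "(\<lambda>z. V (of_int i / real (Suc n)) (snd z)) \<in> borel_measurable (borel \<Otimes>\<^sub>M M)" for i :: int
      by measurable
    moreover have "(\<lambda>z. \<lfloor>real (Suc n) * fst z\<rfloor>) \<in> borel \<Otimes>\<^sub>M M \<rightarrow>\<^sub>M count_space UNIV"
      by measurable
    ultimately show ?thesis
      unfolding case_prod_beta' by (rule measurable_compose_countable)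
  qed
  fix z :: "real \<times> 'w" assume z: "z \<in> space (borel \<Otimes>\<^sub>M M)"
  obtain s \<omega> where z_eq: "z = (s, \<omega>)" and \<omega>: "\<omega> \<in> space M"
    using z by (auto simp: space_pair_measure)
  have g: "(\<lambda>n. ?g n s) \<longlonglongrightarrow> s"
  proof (rule LIM_zero_cancel, rule Lim_null_comparison[OF always_eventually])
    show "(\<lambda>n. inverse (real (Suc n))) \<longlonglongrightarrow> 0"
      by (rule LIMSEQ_inverse_real_of_nat)
    have "\<bar>?g n s - s\<bar> \<le> inverse (real (Suc n))" for n
    proof -
      have "\<bar>of_int \<lfloor>real (Suc n) * s\<rfloor> - real (Suc n) * s\<bar> \<le> 1"
        by linarith
      then have "\<bar>of_int \<lfloor>real (Suc n) * s\<rfloor> - real (Suc n) * s\<bar> / real (Suc n) \<le> 1 / real (Suc n)"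
        by (intro divide_right_mono) auto
      also have "\<bar>of_int \<lfloor>real (Suc n) * s\<rfloor> - real (Suc n) * s\<bar> / real (Suc n) = \<bar>?g n s - s\<bar>"
      proof -
        have "?g n s - s = (of_int \<lfloor>real (Suc n) * s\<rfloor> - real (Suc n) * s) / real (Suc n)"
          by (simp only: diff_divide_distrib nonzero_mult_div_cancel_left of_nat_eq_0_iff nat.distinct not_False_eq_True)
        then show ?thesis
          by (simp only: abs_divide abs_of_nat)
      qed
      finally show ?thesis by (simp add: inverse_eq_divide)
    qed
    then show "\<forall>n. norm (?g n s - s) \<le> inverse (real (Suc n))"
      by simp
  qed
  have "(\<lambda>n. V (?g n s) \<omega>) \<longlonglongrightarrow> V s \<omega>"
    by (rule continuous_on_tendsto_compose[OF cont[OF \<omega>] g]) auto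
  then show "(\<lambda>n. case z of (s, \<omega>) \<Rightarrow> V (?g n s) \<omega>) \<longlonglongrightarrow> (case z of (s, \<omega>) \<Rightarrow> V s \<omega>)"
    by (simp add: z_eq)
qed

lemma sq_integrable_abs: "sq_integrable M X \<Longrightarrow> sq_integrable M (\<lambda>x. \<bar>X x\<bar>)"
  by (auto simp: sq_integrable_def)

lemma sq_integrable_bound:
  assumes H: "sq_integrable M H" and X [measurable]: "X \<in> borel_measurable M"
    and le: "\<And>x. x \<in> space M \<Longrightarrow> \<bar>X x\<bar> \<le> H x"
  shows "sq_integrable M X" and "(\<integral>x. (X x)\<^sup>2 \<partial>M) \<le> (\<integral>x. (H x)\<^sup>2 \<partial>M)"
proof -
  have sq: "(X x)\<^sup>2 \<le> (H x)\<^sup>2" if "x \<in> space M" for x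
    using le[OF that] by (simp add: abs_le_square_iff[symmetric])
  show X2: "sq_integrable M X"
    unfolding sq_integrable_def using sq
    by (auto intro!: Bochner_Integration.integrable_bound[OF sq_integrable_square[OF H]])
  show "(\<integral>x. (X x)\<^sup>2 \<partial>M) \<le> (\<integral>x. (H x)\<^sup>2 \<partial>M)"
    by (rule integral_mono[OF sq_integrable_square[OF X2] sq_integrable_square[OF H] sq])
qed

text \<open>The conditions hold for every sample point and every real time; a version of the process
  and a cut-off coefficient will meet them. No equation is assumed, since the noise is defined below
  as what remains of \<open>V\<close> after its drift.\<close>

locale linear_equation = prob_space M for M :: "'w measure" +
  fixes V :: "'d::finite \<Rightarrow> real \<Rightarrow> 'w \<Rightarrow> real" and A :: "'d \<Rightarrow> 'd \<Rightarrow> real \<Rightarrow> real"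
    and T K :: real
  assumes V_cont: "\<And>c \<omega>. \<omega> \<in> space M \<Longrightarrow> continuous_on UNIV (\<lambda>t. V c t \<omega>)"
    and V_measurable [measurable]: "\<And>c t. V c t \<in> borel_measurable M"
    and A_measurable [measurable]: "\<And>a c. A a c \<in> borel_measurable borel"
    and A_bound: "\<And>a c s. \<bar>A a c s\<bar> \<le> K"
begin

definition p :: "'d \<Rightarrow> real \<Rightarrow> 'w \<Rightarrow> real" where
  "p a s \<omega> = (\<Sum>c\<in>UNIV. A a c s * V c s \<omega>)"

definition U :: "'d \<Rightarrow> real \<Rightarrow> 'w \<Rightarrow> real" where
  "U a t \<omega> = (LBINT s:{0..t}. p a s \<omega>)"

text \<open>Defined by subtraction, so that \<open>V = N + U\<close> on every path and
  \<open>N\<close> has continuous paths. The sum of stochastic integrals agrees with it only almost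
  surely, for each fixed time.\<close>

definition N :: "'d \<Rightarrow> real \<Rightarrow> 'w \<Rightarrow> real" where
  "N a t \<omega> = V a t \<omega> - U a t \<omega>"

lemma K_nonneg: "0 \<le> K"
  using A_bound[of undefined undefined 0] by linarith

lemma V_joint [measurable]: "(\<lambda>(s, \<omega>). V c s \<omega>) \<in> borel_measurable (borel \<Otimes>\<^sub>M M)"
  by (rule borel_measurable_continuous_process[OF V_measurable V_cont])

lemma p_joint: "(\<lambda>(s, \<omega>). p a s \<omega>) \<in> borel_measurable (borel \<Otimes>\<^sub>M M)"
  unfolding p_def by measurable

text \<open>The upper limit varies as well, so the condition \<open>s \<le> t\<close> is put into an
  integrand of the three variables time, sample point and \<open>s\<close>; integrating out
  \<open>s\<close> preserves measurability.\<close>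

lemma U_joint: "(\<lambda>(t, \<omega>). U a t \<omega>) \<in> borel_measurable (borel \<Otimes>\<^sub>M M)"
proof -
  have "(\<lambda>w. (snd w, snd (fst w))) \<in> (borel \<Otimes>\<^sub>M M) \<Otimes>\<^sub>M (lborel :: real measure) \<rightarrow>\<^sub>M borel \<Otimes>\<^sub>M M"
    by measurable
  from measurable_compose[OF this p_joint]
  have [measurable]: "(\<lambda>w. p a (snd w) (snd (fst w))) \<in> borel_measurable ((borel \<Otimes>\<^sub>M M) \<Otimes>\<^sub>M (lborel :: real measure))"
    by simp
  have "(\<lambda>(z, s). if 0 \<le> s \<and> s \<le> fst z then p a s (snd z) else 0)
      \<in> borel_measurable ((borel \<Otimes>\<^sub>M M) \<Otimes>\<^sub>M (lborel :: real measure))"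
    unfolding case_prod_beta' by measurable
  from lborel.borel_measurable_lebesgue_integral[OF this]
  show ?thesis
    unfolding U_def set_lebesgue_integral_def
    by (simp add: case_prod_beta' indicator_def if_distrib cong: if_cong)
qed

lemma N_joint: "(\<lambda>(t, \<omega>). N a t \<omega>) \<in> borel_measurable (borel \<Otimes>\<^sub>M M)"
  using U_joint[of a] unfolding N_def case_prod_beta' by measurable

lemma joint_section:
  assumes "(\<lambda>(t, \<omega>). F t \<omega>) \<in> borel_measurable (borel \<Otimes>\<^sub>M M)"
  shows "F t \<in> borel_measurable M"
  using measurable_Pair2[OF assms, of t] by simp

context
  fixes \<omega> assumes \<omega>: "\<omega> \<in> space M"
begin

lemma p_set_integrable: "set_integrable lborel {0..t} (\<lambda>s. p a s \<omega>)"
proof -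
  have "set_integrable lborel {0..t} (\<lambda>s. A a c s * V c s \<omega>)" for c
  proof (rule set_integrable_bound)
    have cont: "continuous_on UNIV (\<lambda>s. V c s \<omega>)"
      by (rule V_cont[OF \<omega>])
    then show "set_integrable lborel {0..t} (\<lambda>s. K * V c s \<omega>)"
      by (intro borel_integrable_atLeastAtMost' continuous_intros) (auto intro: continuous_on_subset)
    have [measurable]: "(\<lambda>s. V c s \<omega>) \<in> borel_measurable borel"
      by (rule borel_measurable_continuous_onI[OF cont])
    show "set_borel_measurable lborel {0..t} (\<lambda>s. A a c s * V c s \<omega>)"
      unfolding set_borel_measurable_def by measurable
    show "AE s in lborel. s \<in> {0..t} \<longrightarrow> norm (A a c s * V c s \<omega>) \<le> norm (K * V c s \<omega>)"
      using A_bound K_nonneg by (auto simp: abs_mult intro!: mult_right_mono)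
  qed
  then show ?thesis
    unfolding p_def set_integrable_def scaleR_sum_right by (intro Bochner_Integration.integrable_sum)
qed

lemma U_eq_integral: "U a t \<omega> = integral {0..t} (\<lambda>s. p a s \<omega>)"
  unfolding U_def by (rule set_borel_integral_eq_integral(2)[OF p_set_integrable])

lemma U_cont: "continuous_on {0..T} (\<lambda>t. U a t \<omega>)"
  unfolding U_eq_integral
  by (rule indefinite_integral_continuous_1[OF set_borel_integral_eq_integral(1)[OF p_set_integrable]])

lemma N_cont: "continuous_on {0..T} (\<lambda>t. N a t \<omega>)"
  unfolding N_def by (intro continuous_on_diff U_cont continuous_on_subset[OF V_cont[OF \<omega>]]) auto

lemma V_path_bound:
  assumes t: "t \<in> {0..T}"
  shows "\<bar>V a t \<omega>\<bar> \<le> (\<Sum>c\<in>UNIV. \<bar>N c t \<omega>\<bar>)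
    + (CARD('d) * K) * exp (CARD('d) * K * T) * (LBINT s:{0..T}. (\<Sum>c\<in>UNIV. \<bar>N c s \<omega>\<bar>))"
proof -
  \<comment> \<open>Gronwall's inequality is applied to the sum of the absolute components. Each
    drift component is at most \<open>K\<close> times its integral, and summing over the components
    gives the factor \<open>CARD('d)\<close>.\<close>
  let ?y = "\<lambda>t. \<Sum>c\<in>UNIV. \<bar>V c t \<omega>\<bar>" and ?n = "\<lambda>t. \<Sum>c\<in>UNIV. \<bar>N c t \<omega>\<bar>" and ?L = "CARD('d) * K"
  have y: "continuous_on S ?y" for S
    by (intro continuous_intros continuous_on_subset[OF V_cont[OF \<omega>]]) auto
  have n: "continuous_on {0..T} ?n"
    by (intro continuous_intros N_cont)
  have U: "\<bar>U b s \<omega>\<bar> \<le> K * integral {0..s} ?y" for b s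
  proof -
    have "norm (integral {0..s} (\<lambda>r. p b r \<omega>)) \<le> integral {0..s} (\<lambda>r. K * ?y r)"
    proof (rule integral_norm_bound_integral)
      show "(\<lambda>r. p b r \<omega>) integrable_on {0..s}"
        by (rule set_borel_integral_eq_integral(1)[OF p_set_integrable])
      show "(\<lambda>r. K * ?y r) integrable_on {0..s}"
        by (intro integrable_continuous_real continuous_intros y)
      show "norm (p b r \<omega>) \<le> K * ?y r" for r
        unfolding p_def sum_distrib_left real_norm_def
        by (rule order.trans[OF sum_abs sum_mono]) (auto simp: abs_mult intro!: mult_right_mono A_bound)
    qed
    then show ?thesis by (simp add: U_eq_integral)
  qed
  have "?y t \<le> ?n t + ?L * exp (?L * T) * integral {0..T} ?n"
  proof (rule Gronwall_integral[OF y n _ _ _ t])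
    fix s assume "s \<in> {0..T}"
    have "?y s \<le> (\<Sum>c\<in>UNIV. \<bar>N c s \<omega>\<bar> + K * integral {0..s} ?y)"
    proof (rule sum_mono)
      fix c
      have "V c s \<omega> = N c s \<omega> + U c s \<omega>"
        by (simp add: N_def)
      then show "\<bar>V c s \<omega>\<bar> \<le> \<bar>N c s \<omega>\<bar> + K * integral {0..s} ?y"
        using U[of c s] by linarith
    qed
    then show "?y s \<le> ?n s + ?L * integral {0..s} ?y"
      by (simp add: sum.distrib)
  qed (use K_nonneg in \<open>auto intro: sum_nonneg\<close>)
  moreover have "\<bar>V a t \<omega>\<bar> \<le> ?y t"
    by (rule member_le_sum[of a UNIV "\<lambda>c. \<bar>V c t \<omega>\<bar>"]) auto
  moreover have "integral {0..T} ?n = (LBINT s:{0..T}. ?n s)"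
    by (rule set_borel_integral_eq_integral(2)[OF borel_integrable_atLeastAtMost'[OF n], symmetric])
  ultimately show ?thesis by simp
qed

end

end

text \<open>The noise enters through its first two moments. Its covariance has
  uncorrelated-increment form, depending on \<open>min s t\<close>, with density
  \<open>\<rho>\<close> that will be the matrix \<open>B B'\<close>.\<close>

locale linear_sde = linear_equation M V A T K
  for M :: "'w measure" and V :: "'d::finite \<Rightarrow> real \<Rightarrow> 'w \<Rightarrow> real" and A T K +
  fixes \<rho> :: "'d \<Rightarrow> 'd \<Rightarrow> real \<Rightarrow> real"
  assumes N_sq: "\<And>a t. t \<in> {0..T} \<Longrightarrow> sq_integrable M (N a t)"
    and N_mean: "\<And>a t. t \<in> {0..T} \<Longrightarrow> expectation (N a t) = 0"
    and \<rho>_integrable: "\<And>a b. set_integrable lborel {0..T} (\<rho> a b)"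
    and N_covariance: "\<And>a b s t. s \<in> {0..T} \<Longrightarrow> t \<in> {0..T} \<Longrightarrow>
      expectation (\<lambda>\<omega>. N a s \<omega> * N b t \<omega>) = (LBINT x:{0..min s t}. \<rho> a b x)"
begin

lemma V_moments:
  obtains B where "\<And>a t. t \<in> {0..T} \<Longrightarrow> sq_integrable M (V a t)"
    and "\<And>a t. t \<in> {0..T} \<Longrightarrow> expectation (\<lambda>\<omega>. (V a t \<omega>)\<^sup>2) \<le> B"
proof -
  let ?n = "\<lambda>t \<omega>. \<Sum>c\<in>UNIV. \<bar>N c t \<omega>\<bar>"
  \<comment> \<open>The variance of \<open>N a t\<close> is the integral of
    \<open>\<rho> a a\<close> up to \<open>t\<close>. Taking the absolute value and the full
    interval gives one bound for all \<open>t\<close>; in \<open>B0\<close> the factor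
    \<open>CARD('d)\<close> comes from squaring a sum of that many terms.\<close>
  define R where "R a = (LBINT x:{0..T}. \<bar>\<rho> a a x\<bar>)" for a
  define B0 where "B0 = (\<Sum>a\<in>UNIV. R a) * CARD('d)"
  have n_sq: "sq_integrable M (?n t)" if "t \<in> {0..T}" for t
    using that by (intro sq_integrable_sum sq_integrable_abs N_sq)
  have n_B: "expectation (\<lambda>\<omega>. (?n t \<omega>)\<^sup>2) \<le> B0" if t: "t \<in> {0..T}" for t
  proof -
    have "expectation (\<lambda>\<omega>. (N a t \<omega>)\<^sup>2) \<le> R a" for a
    proof -
      have i: "set_integrable lborel {0..t} (\<rho> a a)"
        using t by (intro set_integrable_subset[OF \<rho>_integrable]) auto
      have "expectation (\<lambda>\<omega>. (N a t \<omega>)\<^sup>2) = (LBINT x:{0..t}. \<rho> a a x)"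
        using N_covariance[OF t t, of a a] by (simp add: power2_eq_square)
      also have "\<dots> \<le> (LBINT x:{0..t}. \<bar>\<rho> a a x\<bar>)"
        by (intro set_integral_mono i set_integrable_abs) auto
      also have "\<dots> \<le> R a"
        unfolding R_def set_lebesgue_integral_def using t
        by (intro integral_mono set_integrable_abs[OF i, unfolded set_integrable_def]
            set_integrable_abs[OF \<rho>_integrable, unfolded set_integrable_def])
          (auto split: split_indicator)
      finally show ?thesis .
    qed
    then have *: "(\<Sum>a\<in>UNIV. expectation (\<lambda>\<omega>. (N a t \<omega>)\<^sup>2)) * CARD('d) \<le> B0"
      unfolding B0_def by (intro mult_right_mono sum_mono) auto
    have "expectation (\<lambda>\<omega>. (?n t \<omega>)\<^sup>2) \<le> expectation (\<lambda>\<omega>. (\<Sum>a\<in>UNIV. (N a t \<omega>)\<^sup>2) * CARD('d))"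
      using sum_squared_le_sum_of_squares[of "\<lambda>a. \<bar>N a t \<omega>\<bar>" UNIV for \<omega>]
      by (intro integral_mono sq_integrable_square[OF n_sq[OF t]] integrable_mult_left
          Bochner_Integration.integrable_sum sq_integrable_square[OF N_sq[OF t]]) auto
    also have "\<dots> = (\<Sum>a\<in>UNIV. expectation (\<lambda>\<omega>. (N a t \<omega>)\<^sup>2)) * CARD('d)"
      using sq_integrable_square[OF N_sq[OF t]] by simp
    finally show ?thesis using * by linarith
  qed
  have n_joint: "(\<lambda>(t, \<omega>). ?n t \<omega>) \<in> borel_measurable (borel \<Otimes>\<^sub>M M)"
    using N_joint unfolding case_prod_beta' by (intro borel_measurable_sum borel_measurable_abs)
  define I where "I \<omega> = (LBINT s:{0..T}. ?n s \<omega>)" for \<omega>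
  have I: "sq_integrable M I"
    unfolding I_def by (rule time_integral_sq_integrable[OF n_joint n_sq n_B])
  \<comment> \<open>\<open>C\<close> is the constant of the pathwise Gronwall bound
    \<open>?n t + C * I\<close>, and \<open>B\<close> is the result of squaring it with
    \<open>(x + y)^2 \<le> 2 x^2 + 2 y^2\<close>.\<close>
  define C where "C = (CARD('d) * K) * exp (CARD('d) * K * T)"
  define B where "B = 2 * B0 + 2 * C\<^sup>2 * expectation (\<lambda>\<omega>. (I \<omega>)\<^sup>2)"
  have H: "sq_integrable M (\<lambda>\<omega>. ?n t \<omega> + C * I \<omega>)" if "t \<in> {0..T}" for t
    by (intro sq_integrable_add n_sq[OF that] sq_integrable_cmult I)
  have V: "\<bar>V a t \<omega>\<bar> \<le> ?n t \<omega> + C * I \<omega>" if "t \<in> {0..T}" "\<omega> \<in> space M" for a t \<omega>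
    using V_path_bound[OF that(2,1)] by (simp add: C_def I_def)
  have "expectation (\<lambda>\<omega>. (V a t \<omega>)\<^sup>2) \<le> B" if t: "t \<in> {0..T}" for a t
  proof -
    have "expectation (\<lambda>\<omega>. (V a t \<omega>)\<^sup>2) \<le> expectation (\<lambda>\<omega>. (?n t \<omega> + C * I \<omega>)\<^sup>2)"
      by (rule sq_integrable_bound(2)[OF H[OF t] V_measurable V[OF t]])
    also have "\<dots> \<le> expectation (\<lambda>\<omega>. 2 * (?n t \<omega>)\<^sup>2 + 2 * C\<^sup>2 * (I \<omega>)\<^sup>2)"
    proof (rule integral_mono)
      show "integrable M (\<lambda>\<omega>. (?n t \<omega> + C * I \<omega>)\<^sup>2)"
        by (rule sq_integrable_square[OF H[OF t]])
      show "integrable M (\<lambda>\<omega>. 2 * (?n t \<omega>)\<^sup>2 + 2 * C\<^sup>2 * (I \<omega>)\<^sup>2)"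
        by (intro Bochner_Integration.integrable_add integrable_mult_right sq_integrable_square n_sq t I)
      have "(x + C * i)\<^sup>2 \<le> 2 * x\<^sup>2 + 2 * C\<^sup>2 * i\<^sup>2" for x i :: real
        using zero_le_power2[of "x - C * i"] by (simp add: power2_diff power2_sum power_mult_distrib)
      then show "(?n t \<omega> + C * I \<omega>)\<^sup>2 \<le> 2 * (?n t \<omega>)\<^sup>2 + 2 * C\<^sup>2 * (I \<omega>)\<^sup>2" for \<omega> .
    qed
    also have "\<dots> = 2 * expectation (\<lambda>\<omega>. (?n t \<omega>)\<^sup>2) + 2 * C\<^sup>2 * expectation (\<lambda>\<omega>. (I \<omega>)\<^sup>2)"
      using sq_integrable_square[OF n_sq[OF t]] sq_integrable_square[OF I] by simp
    finally show ?thesis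
      using n_B[OF t] by (simp add: B_def)
  qed
  moreover have "sq_integrable M (V a t)" if t: "t \<in> {0..T}" for a t
    by (rule sq_integrable_bound(1)[OF H[OF t] V_measurable V[OF t]])
  ultimately show ?thesis
    using that by blast
qed

lemma V_sq: "t \<in> {0..T} \<Longrightarrow> sq_integrable M (V a t)"
  by (rule V_moments)

lemma p_moments:
  obtains B where "\<And>a t. t \<in> {0..T} \<Longrightarrow> sq_integrable M (p a t)"
    and "\<And>a t. t \<in> {0..T} \<Longrightarrow> expectation (\<lambda>\<omega>. (p a t \<omega>)\<^sup>2) \<le> B"
proof -
  obtain B where B: "\<And>a t. t \<in> {0..T} \<Longrightarrow> expectation (\<lambda>\<omega>. (V a t \<omega>)\<^sup>2) \<le> B"
    by (rule V_moments) blast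
  have sq: "sq_integrable M (p a t)" if "t \<in> {0..T}" for a t
    unfolding p_def[abs_def] using that by (intro sq_integrable_sum sq_integrable_cmult V_sq)
  have "expectation (\<lambda>\<omega>. (p a t \<omega>)\<^sup>2) \<le> K\<^sup>2 * (CARD('d) * B) * CARD('d)" if t: "t \<in> {0..T}" for a t
  proof -
    note V2 = sq_integrable_square[OF V_sq[OF t]]
    have "expectation (\<lambda>\<omega>. (p a t \<omega>)\<^sup>2) \<le> expectation (\<lambda>\<omega>. K\<^sup>2 * (\<Sum>c\<in>UNIV. (V c t \<omega>)\<^sup>2) * CARD('d))"
    proof (rule integral_mono[OF sq_integrable_square[OF sq[OF t]]])
      show "integrable M (\<lambda>\<omega>. K\<^sup>2 * (\<Sum>c\<in>UNIV. (V c t \<omega>)\<^sup>2) * CARD('d))"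
        by (intro integrable_mult_left integrable_mult_right Bochner_Integration.integrable_sum V2)
      fix \<omega>
      have "(p a t \<omega>)\<^sup>2 \<le> (\<Sum>c\<in>UNIV. (A a c t * V c t \<omega>)\<^sup>2) * CARD('d)"
        unfolding p_def by (rule sum_squared_le_sum_of_squares)
      also have "\<dots> \<le> (\<Sum>c\<in>UNIV. K\<^sup>2 * (V c t \<omega>)\<^sup>2) * CARD('d)"
        unfolding power_mult_distrib using A_bound K_nonneg
        by (intro mult_right_mono sum_mono) (auto simp: abs_le_square_iff[symmetric])
      finally show "(p a t \<omega>)\<^sup>2 \<le> K\<^sup>2 * (\<Sum>c\<in>UNIV. (V c t \<omega>)\<^sup>2) * CARD('d)"
        by (simp add: sum_distrib_left)
    qed
    also have "\<dots> = K\<^sup>2 * (\<Sum>c\<in>UNIV. expectation (\<lambda>\<omega>. (V c t \<omega>)\<^sup>2)) * CARD('d)"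
      using V2 by simp
    also have "\<dots> \<le> K\<^sup>2 * (\<Sum>c\<in>(UNIV :: 'd set). B) * CARD('d)"
      using B[OF t] by (intro mult_right_mono mult_left_mono sum_mono) auto
    finally show ?thesis by simp
  qed
  with sq that show ?thesis by blast
qed

section \<open>The covariance equation\<close>

lemma expectation_mult_p:
  assumes X: "sq_integrable M X" and t: "t \<in> {0..T}"
  shows "expectation (\<lambda>\<omega>. X \<omega> * p a t \<omega>) = (\<Sum>c\<in>UNIV. A a c t * expectation (\<lambda>\<omega>. X \<omega> * V c t \<omega>))"
proof -
  have "integrable M (\<lambda>\<omega>. A a c t * (X \<omega> * V c t \<omega>))" for c
    by (intro integrable_mult_right sq_integrable_mult X V_sq t)
  then show ?thesis
    by (simp add: p_def sum_distrib_left mult.left_commute[of "X _"])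
qed

lemma expectation_mult_U:
  assumes X: "sq_integrable M X" and t: "t \<in> {0..T}"
  shows "set_integrable lborel {0..t} (\<lambda>s. expectation (\<lambda>\<omega>. X \<omega> * p a s \<omega>))"
    and "expectation (\<lambda>\<omega>. X \<omega> * U a t \<omega>) = (LBINT s:{0..t}. expectation (\<lambda>\<omega>. X \<omega> * p a s \<omega>))"
proof -
  obtain B where B: "\<And>a t. t \<in> {0..T} \<Longrightarrow> sq_integrable M (p a t)"
    "\<And>a t. t \<in> {0..T} \<Longrightarrow> expectation (\<lambda>\<omega>. (p a t \<omega>)\<^sup>2) \<le> B"
    by (rule p_moments) blast
  have "sq_integrable M (p a s)" "expectation (\<lambda>\<omega>. (p a s \<omega>)\<^sup>2) \<le> B" if "s \<in> {0..t}" for s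
    using B that t by auto
  note e = expectation_time_integral[OF p_joint this X]
  show "set_integrable lborel {0..t} (\<lambda>s. expectation (\<lambda>\<omega>. X \<omega> * p a s \<omega>))"
    by (rule e(1)) auto
  show "expectation (\<lambda>\<omega>. X \<omega> * U a t \<omega>) = (LBINT s:{0..t}. expectation (\<lambda>\<omega>. X \<omega> * p a s \<omega>))"
    unfolding U_def by (rule e(2)) auto
qed

lemma U_sq: "t \<in> {0..T} \<Longrightarrow> sq_integrable M (U a t)"
  using sq_integrable_diff[OF V_sq[of t a] N_sq[of t a]] by (simp add: N_def)

text \<open>
  Orthogonality to the noise passes to the solution by Gronwall's inequality for the moments
  \<open>E[X V]\<close>; this replaces any measurability of \<open>V\<close> with respect to the past of the noise.
\<close>

lemma orthogonal_solution:
  assumes X: "sq_integrable M X" and R: "R \<in> {0..T}"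
    and orth: "\<And>c t. t \<in> {0..R} \<Longrightarrow> expectation (\<lambda>\<omega>. X \<omega> * N c t \<omega>) = 0"
    and t: "t \<in> {0..R}"
  shows "expectation (\<lambda>\<omega>. X \<omega> * V a t \<omega>) = 0"
proof -
  define u where "u c s = expectation (\<lambda>\<omega>. X \<omega> * V c s \<omega>)" for c s
  define g where "g c s = expectation (\<lambda>\<omega>. X \<omega> * p c s \<omega>)" for c s
  have g: "g c s = (\<Sum>b\<in>UNIV. A c b s * u b s)" if "s \<in> {0..R}" for c s
    unfolding g_def u_def using R that by (intro expectation_mult_p X) auto
  have g_int: "set_integrable lborel {0..s} (g c)" if "s \<in> {0..R}" for c s
    unfolding g_def using R that by (intro expectation_mult_U X) auto
  have u: "u c s = integral {0..s} (g c)" if s: "s \<in> {0..R}" for c s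
  proof -
    have sT: "s \<in> {0..T}" using R s by auto
    have "u c s = expectation (\<lambda>\<omega>. X \<omega> * N c s \<omega> + X \<omega> * U c s \<omega>)"
      by (simp add: u_def N_def algebra_simps)
    also have "\<dots> = expectation (\<lambda>\<omega>. X \<omega> * U c s \<omega>)"
      using sq_integrable_mult[OF X N_sq[OF sT]] sq_integrable_mult[OF X U_sq[OF sT]] orth[OF s] by simp
    also have "\<dots> = (LBINT r:{0..s}. g c r)"
      unfolding g_def by (rule expectation_mult_U(2)[OF X sT])
    also have "\<dots> = integral {0..s} (g c)"
      by (rule set_borel_integral_eq_integral(2)[OF g_int[OF s]])
    finally show ?thesis .
  qed
  have "continuous_on {0..R} (\<lambda>s. integral {0..s} (g c))" for c
    using R by (intro indefinite_integral_continuous_1 set_borel_integral_eq_integral(1) g_int) auto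
  then have u_cont: "continuous_on {0..R} (u c)" for c
    by (rule continuous_on_cong[THEN iffD1, rotated 2]) (auto simp: u)
  let ?y = "\<lambda>s. \<Sum>c\<in>UNIV. \<bar>u c s\<bar>" and ?L = "CARD('d) * K"
  have y: "continuous_on {0..R} ?y"
    by (intro continuous_intros u_cont)
  have "?y t \<le> 0 + ?L * exp (?L * R) * integral {0..R} (\<lambda>_. 0)"
  proof (rule Gronwall_integral[OF y _ _ _ _ t])
    fix s assume s: "s \<in> {0..R}"
    have "\<bar>u c s\<bar> \<le> K * integral {0..s} ?y" for c
    proof -
      have "norm (integral {0..s} (g c)) \<le> integral {0..s} (\<lambda>r. K * ?y r)"
      proof (rule integral_norm_bound_integral)
        show "g c integrable_on {0..s}"
          by (rule set_borel_integral_eq_integral(1)[OF g_int[OF s]])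
        show "(\<lambda>r. K * ?y r) integrable_on {0..s}"
          using s by (intro integrable_continuous_real continuous_on_mult_left continuous_on_subset[OF y]) auto
        show "norm (g c r) \<le> K * ?y r" if "r \<in> {0..s}" for r
        proof -
          have "g c r = (\<Sum>b\<in>UNIV. A c b r * u b r)"
            using that s by (intro g) auto
          then show ?thesis
            unfolding sum_distrib_left real_norm_def
            by (simp only:) (rule order.trans[OF sum_abs sum_mono], auto simp: abs_mult intro!: mult_right_mono A_bound)
        qed
      qed
      then show ?thesis by (simp add: u[OF s])
    qed
    then have "?y s \<le> (\<Sum>c\<in>(UNIV :: 'd set). K * integral {0..s} ?y)"
      by (intro sum_mono)
    then show "?y s \<le> 0 + ?L * integral {0..s} ?y"
      by simp
  qed (use K_nonneg in auto)
  then have "?y t \<le> 0" by simp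
  moreover have "\<bar>u a t\<bar> \<le> ?y t"
    by (rule member_le_sum[of a UNIV "\<lambda>c. \<bar>u c t\<bar>"]) auto
  ultimately show ?thesis
    by (simp add: u_def)
qed

lemma V_mean:
  assumes "t \<in> {0..T}"
  shows "expectation (V a t) = 0"
  using orthogonal_solution[OF sq_integrable_const[of 1], where R = T and a = a and t = t] N_mean assms by auto

lemma expectation_N_V:
  assumes s: "s \<in> {0..t}" and t: "t \<in> {0..T}"
  shows "expectation (\<lambda>\<omega>. N a t \<omega> * V c s \<omega>) = expectation (\<lambda>\<omega>. N a s \<omega> * V c s \<omega>)"
proof -
  have sT: "s \<in> {0..T}" using s t by auto
  have "expectation (\<lambda>\<omega>. (N a t \<omega> - N a s \<omega>) * V c s \<omega>) = 0"
  proof (rule orthogonal_solution[of _ s])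
    show "sq_integrable M (\<lambda>\<omega>. N a t \<omega> - N a s \<omega>)"
      by (intro sq_integrable_diff N_sq sT t)
    fix b r assume r: "r \<in> {0..s}"
    then have rT: "r \<in> {0..T}" using sT by auto
    have "expectation (\<lambda>\<omega>. (N a t \<omega> - N a s \<omega>) * N b r \<omega>)
        = expectation (\<lambda>\<omega>. N a t \<omega> * N b r \<omega>) - expectation (\<lambda>\<omega>. N a s \<omega> * N b r \<omega>)"
      using sq_integrable_mult[OF N_sq[OF t] N_sq[OF rT]] sq_integrable_mult[OF N_sq[OF sT] N_sq[OF rT]]
      by (simp add: left_diff_distrib)
    also have "\<dots> = 0"
      \<comment> \<open>For \<open>r \<le> s \<le> t\<close> both minima equal \<open>r\<close>, so
        the two covariances cancel.\<close>
      unfolding N_covariance[OF t rT] N_covariance[OF sT rT] using s r by (simp add: min_absorb2)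
    finally show "expectation (\<lambda>\<omega>. (N a t \<omega> - N a s \<omega>) * N b r \<omega>) = 0" .
  qed (use s sT in auto)
  then show ?thesis
    using sq_integrable_mult[OF N_sq[OF t] V_sq[OF sT]] sq_integrable_mult[OF N_sq[OF sT] V_sq[OF sT]]
    by (simp add: left_diff_distrib)
qed

text \<open>Under the time integral the terminal value \<open>N a t\<close> is replaced by
  \<open>N a s\<close>, using orthogonality of the later increment. The integrand no longer depends
  on \<open>t\<close>, as an integral equation for the covariance requires.\<close>

lemma expectation_N_U:
  assumes t: "t \<in> {0..T}"
  shows "set_integrable lborel {0..t} (\<lambda>s. expectation (\<lambda>\<omega>. N a s \<omega> * p b s \<omega>))"
    and "expectation (\<lambda>\<omega>. N a t \<omega> * U b t \<omega>) = (LBINT s:{0..t}. expectation (\<lambda>\<omega>. N a s \<omega> * p b s \<omega>))"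
proof -
  have eq: "expectation (\<lambda>\<omega>. N a t \<omega> * p b s \<omega>) = expectation (\<lambda>\<omega>. N a s \<omega> * p b s \<omega>)" if s: "s \<in> {0..t}" for s
  proof -
    have sT: "s \<in> {0..T}" using s t by auto
    show ?thesis
      by (simp add: expectation_mult_p[OF N_sq[OF t] sT] expectation_mult_p[OF N_sq[OF sT] sT] expectation_N_V[OF s t])
  qed
  show "set_integrable lborel {0..t} (\<lambda>s. expectation (\<lambda>\<omega>. N a s \<omega> * p b s \<omega>))"
    using expectation_mult_U(1)[OF N_sq[OF t] t, where a1 = a and a = b]
    by (rule set_integrable_cong[THEN iffD1, rotated 3]) (auto simp: eq)
  show "expectation (\<lambda>\<omega>. N a t \<omega> * U b t \<omega>) = (LBINT s:{0..t}. expectation (\<lambda>\<omega>. N a s \<omega> * p b s \<omega>))"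
    unfolding expectation_mult_U(2)[OF N_sq[OF t] t]
    by (rule set_lebesgue_integral_cong) (auto simp: eq)
qed

text \<open>Of the four terms of \<open>(N + U) (N + U)'\<close>, the pure noise term integrates
  \<open>\<rho>\<close>. Every other contribution is a time integral of an expectation with one
  factor \<open>p\<close>, and these are regrouped by that factor.\<close>

lemma covariance_equation:
  fixes a b t
  defines "S \<equiv> \<lambda>a b s. expectation (\<lambda>\<omega>. V a s \<omega> * V b s \<omega>)"
  defines "h \<equiv> \<lambda>s. \<rho> a b s + (\<Sum>c\<in>UNIV. A a c s * S c b s) + (\<Sum>c\<in>UNIV. S a c s * A b c s)"
  assumes t: "t \<in> {0..T}"
  shows "set_integrable lborel {0..t} h" and "S a b t = (LBINT s:{0..t}. h s)"
proof -
  obtain B where B: "\<And>a t. t \<in> {0..T} \<Longrightarrow> sq_integrable M (p a t)"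
    "\<And>a t. t \<in> {0..T} \<Longrightarrow> expectation (\<lambda>\<omega>. (p a t \<omega>)\<^sup>2) \<le> B"
    by (rule p_moments) blast
  have B': "sq_integrable M (p a s)" "expectation (\<lambda>\<omega>. (p a s \<omega>)\<^sup>2) \<le> B" if "s \<in> {0..t}" for s a
    using B that t by auto
  let ?NU = "\<lambda>s. expectation (\<lambda>\<omega>. N a s \<omega> * p b s \<omega>)" and ?UN = "\<lambda>s. expectation (\<lambda>\<omega>. N b s \<omega> * p a s \<omega>)"
  let ?pU = "\<lambda>s. expectation (\<lambda>\<omega>. p a s \<omega> * U b s \<omega>)" and ?Up = "\<lambda>s. expectation (\<lambda>\<omega>. U a s \<omega> * p b s \<omega>)"
  have UU: "set_integrable lborel {0..t} ?pU" "set_integrable lborel {0..t} ?Up"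
    "expectation (\<lambda>\<omega>. U a t \<omega> * U b t \<omega>) = (LBINT s:{0..t}. ?pU s) + (LBINT s:{0..t}. ?Up s)"
    unfolding U_def by (rule expectation_time_integral_product[OF p_joint _ _ p_joint]; fact B')+
  have i: "set_integrable lborel {0..t} (\<rho> a b)"
    using t by (intro set_integrable_subset[OF \<rho>_integrable]) auto
  note ints = i expectation_N_U(1)[OF t, of a b] expectation_N_U(1)[OF t, of b a] UU(1,2)
  have h: "h s = \<rho> a b s + ((?UN s + ?pU s) + (?NU s + ?Up s))" if s: "s \<in> {0..t}" for s
  proof -
    have sT: "s \<in> {0..T}" using s t by auto
    have V: "V c s \<omega> = N c s \<omega> + U c s \<omega>" for c \<omega>
      by (simp add: N_def)
    \<comment> \<open>The noise part and the drift part of \<open>V b\<close> recombine against the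
      same \<open>p a\<close>, leaving \<open>A\<close> and second moments of
      \<open>V\<close>.\<close>
    have 1: "?UN s + ?pU s = expectation (\<lambda>\<omega>. V b s \<omega> * p a s \<omega>)"
      using sq_integrable_mult[OF N_sq[OF sT] B(1)[OF sT], of b a] sq_integrable_mult[OF U_sq[OF sT] B(1)[OF sT], of b a]
      by (simp add: V ring_distribs mult.commute[of "p _ _ _"])
    have 2: "?NU s + ?Up s = expectation (\<lambda>\<omega>. V a s \<omega> * p b s \<omega>)"
      using sq_integrable_mult[OF N_sq[OF sT] B(1)[OF sT], of a b] sq_integrable_mult[OF U_sq[OF sT] B(1)[OF sT], of a b]
      by (simp add: V ring_distribs)
    show ?thesis
      unfolding 1 2 expectation_mult_p[OF V_sq[OF sT] sT]
      by (simp add: h_def S_def mult.commute)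
  qed
  have "set_integrable lborel {0..t} (\<lambda>s. \<rho> a b s + ((?UN s + ?pU s) + (?NU s + ?Up s)))"
    by (intro set_integral_add ints)
  then show "set_integrable lborel {0..t} h"
    by (rule set_integrable_cong[THEN iffD1, rotated 3]) (auto simp: h)
  have "S a b t = expectation (\<lambda>\<omega>. N a t \<omega> * N b t \<omega> + (N b t \<omega> * U a t \<omega> + (N a t \<omega> * U b t \<omega> + U a t \<omega> * U b t \<omega>)))"
    unfolding S_def by (rule Bochner_Integration.integral_cong) (auto simp: N_def algebra_simps)
  also have "\<dots> = expectation (\<lambda>\<omega>. N a t \<omega> * N b t \<omega>) + (expectation (\<lambda>\<omega>. N b t \<omega> * U a t \<omega>)
      + (expectation (\<lambda>\<omega>. N a t \<omega> * U b t \<omega>) + expectation (\<lambda>\<omega>. U a t \<omega> * U b t \<omega>)))"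
    using sq_integrable_mult[OF N_sq[OF t] N_sq[OF t]] sq_integrable_mult[OF N_sq[OF t] U_sq[OF t]]
      sq_integrable_mult[OF U_sq[OF t] U_sq[OF t]] by simp
  also have "\<dots> = (LBINT s:{0..t}. \<rho> a b s) + ((LBINT s:{0..t}. ?UN s) + ((LBINT s:{0..t}. ?NU s)
      + ((LBINT s:{0..t}. ?pU s) + (LBINT s:{0..t}. ?Up s))))"
    using t by (simp add: N_covariance expectation_N_U UU(3))
  also have "\<dots> = (LBINT s:{0..t}. \<rho> a b s + ((?UN s + ?pU s) + (?NU s + ?Up s)))"
    using ints by (simp add: set_integral_add)
  also have "\<dots> = (LBINT s:{0..t}. h s)"
    by (rule set_lebesgue_integral_cong) (auto simp: h)
  finally show "S a b t = (LBINT s:{0..t}. h s)" .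
qed

end

section \<open>The moment equations\<close>

lemma borel_measurable_vec_componentwise:
  fixes f :: "'a \<Rightarrow> ('b::euclidean_space) ^ 'n"
  assumes "\<And>i. (\<lambda>x. f x $ i) \<in> borel_measurable M"
  shows "f \<in> borel_measurable M"
  using assms by (subst borel_measurable_euclidean_space) (auto simp: Basis_vec_def inner_axis)

lemma has_vector_derivative_vec_componentwise:
  fixes f :: "real \<Rightarrow> ('b::euclidean_space) ^ 'n"
  assumes "\<And>i. ((\<lambda>x. f x $ i) has_vector_derivative f' $ i) (at t within S)"
  shows "(f has_vector_derivative f') (at t within S)"
  unfolding has_vector_derivative_def
proof (subst has_derivative_componentwise_within, safe)
  fix b :: "'b ^ 'n" assume "b \<in> Basis"
  then obtain i u where b: "b = axis i u"
    by (auto simp: Basis_vec_def)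
  have "((\<lambda>x. f x $ i \<bullet> u) has_derivative (\<lambda>x. (x *\<^sub>R f' $ i) \<bullet> u)) (at t within S)"
    using assms[of i] unfolding has_vector_derivative_def by (rule has_derivative_inner_left)
  then show "((\<lambda>x. f x \<bullet> b) has_derivative (\<lambda>x. (x *\<^sub>R f') \<bullet> b)) (at t within S)"
    by (simp add: b inner_axis)
qed

text \<open>At the left end only integrability of \<open>h\<close> is available. At a positive
  \<open>t\<close> the interval \<open>{0..T}\<close> agrees locally with \<open>{0<..T}\<close>,
  where \<open>h\<close> is continuous.\<close>

lemma integral_has_derivative_interior:
  fixes h :: "real \<Rightarrow> 'a::banach"
  assumes h: "h integrable_on {0..T}" and cont: "continuous_on {0<..T} h" and t: "t \<in> {0<..T}"
  shows "((\<lambda>u. integral {0..u} h) has_vector_derivative h t) (at t within {0..T})"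
proof -
  have "at t within {0..T} = at t within {0<..T}"
    by (rule at_within_nhd[of t "{0<..}"]) (use t in auto)
  then have "continuous (at t within {0..T}) h"
    using cont t by (auto simp: continuous_on_eq_continuous_within)
  then show ?thesis
    using integral_has_vector_derivative_continuous_at[OF h, of t "{}"] t by simp
qed


theorem proposition3:
  fixes T :: real
    and x0 :: "real ^ 'd"
    and l :: "'k::finite \<Rightarrow> int ^ 'd"
    and f :: "'k \<Rightarrow> real \<Rightarrow> real ^ 'd \<Rightarrow> real"
    and M :: "'w measure"
    and W :: "'k \<Rightarrow> real \<Rightarrow> 'w \<Rightarrow> real"
    and J :: "'k \<Rightarrow> real \<Rightarrow> 'w \<Rightarrow> real"
    and Z :: "real \<Rightarrow> real ^ 'd"
    and V Y :: "real \<Rightarrow> 'w \<Rightarrow> real ^ 'd"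
    and \<Sigma> :: "real \<Rightarrow> real ^ 'd ^ 'd"
  assumes T: "0 \<le> T"
    and f_cont: "\<And>i. continuous_on ({0..T} \<times> UNIV) (\<lambda>(t, x). f i t x)"
    and f_growth: "\<And>i. \<exists>C. \<forall>t\<in>{0..T}. \<forall>x. \<bar>f i t x\<bar> \<le> C * (1 + norm x)"
    and F_lipschitz:
      "\<exists>K. \<forall>t\<in>{0..T}. \<forall>x y. norm (drift l f t x - drift l f t y) \<le> K * norm (x - y)"
    and M: "prob_space M"
    and W: "independent_brownian_motions M W"
    and V_rv: "\<And>t. t \<in> {0..T} \<Longrightarrow> V t \<in> borel_measurable M"
    and Z_cont: "continuous_on {0..T} Z"
    and V_cont: "AE \<omega> in M. continuous_on {0..T} (\<lambda>t. V t \<omega>)"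
    and \<Sigma>_second_moment:
      "\<And>t. t \<in> {0..T} \<Longrightarrow> integrable M (\<lambda>\<omega>. (norm (V t \<omega>))\<^sup>2)"
    and \<Sigma>_cov: "\<And>t. t \<in> {0..T} \<Longrightarrow> \<Sigma> t = cov_matrix M (V t) (V t)"
    and \<Sigma>_pos: "\<And>t. t \<in> {0<..T} \<Longrightarrow> positive_definite (\<Sigma> t)"
    and g_nonneg: "\<And>i t. t \<in> {0..T} \<Longrightarrow> 0 \<le> gauss_rate f i t (Z t) (\<Sigma> t)"
    and Z_eq: "\<And>t. t \<in> {0..T} \<Longrightarrow>
      Z t = x0 + (\<Sum>i\<in>UNIV. integral {0..t} (\<lambda>s. gauss_rate f i s (Z s) (\<Sigma> s)) *\<^sub>R real_vec (l i))"
    and J: "\<And>i t. t \<in> {0..T} \<Longrightarrow>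
      has_stochastic_integral M (W i) (\<lambda>s. sqrt (gauss_rate f i s (Z s) (\<Sigma> s))) t (J i t)"
    and V_eq: "\<And>t. t \<in> {0..T} \<Longrightarrow> AE \<omega> in M.
      V t \<omega> = (\<Sum>i\<in>UNIV. J i t \<omega> *\<^sub>R real_vec (l i))
        + integral {0..t} (\<lambda>s. drift_jacobian l f Z \<Sigma> s *v V s \<omega>)"
    and Y: "\<And>t \<omega>. t \<in> {0..T} \<Longrightarrow> Y t \<omega> = Z t + V t \<omega>"
  shows "(\<forall>t\<in>{0..T}.
            integrable M (Y t) \<and> integrable M (\<lambda>\<omega>. (norm (Y t \<omega>))\<^sup>2) \<and>
            prob_space.expectation M (Y t) = Z t \<and>
            cov_matrix M (Y t) (Y t) = cov_matrix M (V t) (V t) \<and>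
            cov_matrix M (V t) (V t) = \<Sigma> t) \<and>
         Z 0 = x0 \<and> \<Sigma> 0 = 0 \<and>
         (\<forall>t\<in>{0<..T}.
            (Z has_vector_derivative
               (\<Sum>i\<in>UNIV. gauss_rate f i t (Z t) (\<Sigma> t) *\<^sub>R real_vec (l i)))
              (at t within {0..T}) \<and>
            (\<Sigma> has_vector_derivative
               (drift_jacobian l f Z \<Sigma> t ** \<Sigma> t
                + \<Sigma> t ** transpose (drift_jacobian l f Z \<Sigma> t)
                + diffusion_matrix l f Z \<Sigma> t ** transpose (diffusion_matrix l f Z \<Sigma> t)))
              (at t within {0..T}))"
proof -
  interpret prob_space M by (rule M)
  obtain C where C: "\<And>i t x. t \<in> {0..T} \<Longrightarrow> \<bar>f i t x\<bar> \<le> C i * (1 + norm x)"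
    using f_growth by metis
  obtain K0 where K0: "\<And>t x y. t \<in> {0..T} \<Longrightarrow> norm (drift l f t x - drift l f t y) \<le> K0 * norm (x - y)"
    using F_lipschitz by blast
  \<comment> \<open>The bound by \<open>K\<close> must also hold where the coefficient is cut off to
    zero, hence the maximum with \<open>0\<close>.\<close>
  define K where "K = max K0 0"
  interpret rate_functions T l f C K
  proof
    fix t :: real and x y :: "real^'d" assume t: "t \<in> {0..T}"
    have "K0 * norm (x - y) \<le> K * norm (x - y)"
      by (intro mult_right_mono) (auto simp: K_def)
    then show "norm (drift l f t x - drift l f t y) \<le> K * norm (x - y)"
      using K0[OF t, of x y] by linarith
  qed (use f_cont C in auto)
  let ?g = "\<lambda>i t. gauss_rate f i t (Z t) (\<Sigma> t)"
  let ?r = "\<lambda>i a. real_vec (l i) $ a"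
  let ?A = "drift_jacobian l f Z \<Sigma>"

  \<comment> \<open>A version of \<open>V\<close> with continuous paths for every sample point and
    all real times is built: zero on the null set \<open>E\<close>, and frozen outside
    \<open>{0..T}\<close>.\<close>
  obtain E where E: "{\<omega> \<in> space M. \<not> continuous_on {0..T} (\<lambda>t. V t \<omega>)} \<subseteq> E" "emeasure M E = 0" "E \<in> sets M"
    using V_cont by (rule AE_E)
  define clamp where "clamp t = max 0 (min t T)" for t
  have clamp: "clamp t \<in> {0..T}" for t
    using T by (auto simp: clamp_def)
  define V' where "V' c t \<omega> = (if \<omega> \<in> E then 0 else V (clamp t) \<omega> $ c)" for c t \<omega>
  have V'_eq: "V' c t \<omega> = V t \<omega> $ c" if "\<omega> \<notin> E" "t \<in> {0..T}" for c t \<omega>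
    using that by (simp add: V'_def clamp_def)
  have not_E: "AE \<omega> in M. \<omega> \<notin> E"
    using E by (intro AE_not_in) auto
  have V'_cont: "continuous_on UNIV (\<lambda>t. V' c t \<omega>)" if "\<omega> \<in> space M" for c \<omega>
  proof (cases "\<omega> \<in> E")
    case False
    then have "continuous_on {0..T} (\<lambda>t. V t \<omega>)"
      using E that by blast
    then have "continuous_on UNIV (\<lambda>t. V (clamp t) \<omega>)"
      by (rule continuous_on_compose2) (use clamp in \<open>auto simp: clamp_def intro!: continuous_intros\<close>)
    then show ?thesis
      using False by (auto simp: V'_def intro!: continuous_intros)
  qed (simp add: V'_def)
  have V_comp_meas: "(\<lambda>\<omega>. V t \<omega> $ c) \<in> borel_measurable M" if "t \<in> {0..T}" for c t
    by (rule measurable_compose[OF V_rv[OF that] borel_measurable_continuous_onI]) (intro continuous_intros)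
  have V'_meas: "V' c t \<in> borel_measurable M" for c t
  proof -
    have "(\<lambda>\<omega>. V (clamp t) \<omega> $ c) \<in> borel_measurable M"
      by (rule V_comp_meas[OF clamp])
    then show ?thesis
      unfolding V'_def using E(3) by (intro measurable_If_set) auto
  qed
  have V'_AE: "AE \<omega> in M. V' c t \<omega> = V t \<omega> $ c" if "t \<in> {0..T}" for c t
    using not_E by eventually_elim (rule V'_eq[OF _ that])

  have V_sq_comp: "sq_integrable M (\<lambda>\<omega>. V t \<omega> $ c)" if "t \<in> {0..T}" for c t
    unfolding sq_integrable_def
  proof
    show "integrable M (\<lambda>\<omega>. (V t \<omega> $ c)\<^sup>2)"
    proof (rule Bochner_Integration.integrable_bound[OF \<Sigma>_second_moment[OF that]])
      have "(V t \<omega> $ c)\<^sup>2 \<le> (norm (V t \<omega>))\<^sup>2" for \<omega>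
        using component_le_norm_cart[of "V t \<omega>" c] by (simp add: abs_le_square_iff[symmetric])
      then show "AE \<omega> in M. norm ((V t \<omega> $ c)\<^sup>2) \<le> norm ((norm (V t \<omega>))\<^sup>2)"
        by simp
    qed (use V_comp_meas[OF that] in measurable)
  qed (rule V_comp_meas[OF that])
  \<comment> \<open>The product of the means stays in the formula; that it vanishes is known only
    once \<open>V_mean\<close> is available.\<close>
  have \<Sigma>_moments: "\<Sigma> t $ a $ b = expectation (\<lambda>\<omega>. V' a t \<omega> * V' b t \<omega>) - expectation (V' a t) * expectation (V' b t)"
    if t: "t \<in> {0..T}" for a b t
  proof -
    note sq = V_sq_comp[OF t]
    note m = V_comp_meas[OF t] V'_meas
    have 1: "expectation (V' c t) = expectation (\<lambda>\<omega>. V t \<omega> $ c)" for c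
      by (rule integral_cong_AE[OF V'_meas V_comp_meas[OF t] V'_AE[OF t]])
    have 2: "expectation (\<lambda>\<omega>. V' a t \<omega> * V' b t \<omega>) = expectation (\<lambda>\<omega>. V t \<omega> $ a * V t \<omega> $ b)"
      using V'_AE[OF t, of a] V'_AE[OF t, of b] by (intro integral_cong_AE borel_measurable_times m) auto
    have "\<Sigma> t $ a $ b = expectation (\<lambda>\<omega>. (V t \<omega> $ a - expectation (\<lambda>\<omega>. V t \<omega> $ a)) * (V t \<omega> $ b - expectation (\<lambda>\<omega>. V t \<omega> $ b)))"
      by (simp add: \<Sigma>_cov[OF t] cov_matrix_def)
    also have "\<dots> = expectation (\<lambda>\<omega>. V t \<omega> $ a * V t \<omega> $ b - expectation (\<lambda>\<omega>. V t \<omega> $ b) * V t \<omega> $ a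
        - expectation (\<lambda>\<omega>. V t \<omega> $ a) * V t \<omega> $ b + expectation (\<lambda>\<omega>. V t \<omega> $ a) * expectation (\<lambda>\<omega>. V t \<omega> $ b))"
      by (simp add: algebra_simps)
    also have "\<dots> = expectation (\<lambda>\<omega>. V t \<omega> $ a * V t \<omega> $ b) - expectation (\<lambda>\<omega>. V t \<omega> $ b) * expectation (\<lambda>\<omega>. V t \<omega> $ a)
        - expectation (\<lambda>\<omega>. V t \<omega> $ a) * expectation (\<lambda>\<omega>. V t \<omega> $ b) + expectation (\<lambda>\<omega>. V t \<omega> $ a) * expectation (\<lambda>\<omega>. V t \<omega> $ b)"
      using sq_integrable_mult[OF sq sq] sq_integrable_integrable[OF sq] by (simp add: prob_space)
    finally show ?thesis by (simp add: 1 2)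
  qed

  \<comment> \<open>Joint measurability of the continuous version makes its moments measurable in
    time.\<close>
  have \<Sigma>_meas: "\<Sigma> \<in> borel_measurable (restrict_space borel {0<..T})"
  proof (intro borel_measurable_vec_componentwise)
    fix a b
    have [measurable]: "(\<lambda>(s, \<omega>). V' c s \<omega>) \<in> borel_measurable (borel \<Otimes>\<^sub>M M)" for c
      by (rule borel_measurable_continuous_process[OF V'_meas V'_cont])
    have "(\<lambda>t. expectation (\<lambda>\<omega>. V' a t \<omega> * V' b t \<omega>) - expectation (V' a t) * expectation (V' b t)) \<in> borel_measurable borel"
      by measurable
    then have "(\<lambda>t. expectation (\<lambda>\<omega>. V' a t \<omega> * V' b t \<omega>) - expectation (V' a t) * expectation (V' b t))
        \<in> borel_measurable (restrict_space borel {0<..T})"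
      by (rule measurable_restrict_space1)
    then show "(\<lambda>t. \<Sigma> t $ a $ b) \<in> borel_measurable (restrict_space borel {0<..T})"
      by (rule measurable_cong[THEN iffD2, rotated]) (auto simp: space_restrict_space \<Sigma>_moments)
  qed

  \<comment> \<open>At time \<open>0\<close> the covariance vanishes and the Jacobian carries no
    information. Within \<open>{0..T}\<close> the cutoff affects this single point.\<close>
  define A' where "A' a c s = (if s \<in> {0<..T} then ?A s $ a $ c else 0)" for a c s
  have A'_meas: "A' a c \<in> borel_measurable borel" for a c
  proof -
    have "(\<lambda>s. ?A s $ a $ c) \<in> borel_measurable (restrict_space borel {0<..T})"
      by (rule drift_jacobian_measurable[OF Z_cont \<Sigma>_meas \<Sigma>_pos])
    then have "(\<lambda>s. indicator {0<..T} s *\<^sub>R ?A s $ a $ c) \<in> borel_measurable borel"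
      by (subst (asm) borel_measurable_restrict_space_iff) auto
    moreover have "A' a c = (\<lambda>s. indicator {0<..T} s *\<^sub>R ?A s $ a $ c)"
      by (auto simp: A'_def fun_eq_iff)
    ultimately show ?thesis by simp
  qed
  have A'_bound: "\<bar>A' a c s\<bar> \<le> K" for a c s
    using drift_jacobian_bound[of s \<Sigma> Z a c] \<Sigma>_pos by (auto simp: A'_def K_def)

  interpret linear_equation M V' A' T K
    by unfold_locales (use V'_cont V'_meas A'_meas A'_bound in auto)

  have N_eq: "AE \<omega> in M. (\<Sum>i\<in>UNIV. ?r i a * J i t \<omega>) = N a t \<omega>" if t: "t \<in> {0..T}" for a t
    using V_eq[OF t] not_E AE_space
  proof eventually_elim
    case (elim \<omega>)
    have int: "(\<lambda>s. (?A s *v V s \<omega>) $ b) integrable_on {0..t}" "integral {0..t} (\<lambda>s. (?A s *v V s \<omega>) $ b) = U b t \<omega>" for b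
    proof -
      \<comment> \<open>Off the point \<open>0\<close> the integrand of the assumed equation is
        \<open>p\<close>, and one point changes neither integrability nor the integral.\<close>
      have eq: "(?A s *v V s \<omega>) $ b = p b s \<omega>" if "s \<in> {0..t} - {0}" for s
        using that t elim by (auto simp: p_def A'_def V'_eq matrix_vector_mult_def)
      show "(\<lambda>s. (?A s *v V s \<omega>) $ b) integrable_on {0..t}"
        by (rule integrable_spike[OF set_borel_integral_eq_integral(1)[OF p_set_integrable[OF elim(3)]], of "{0}" _ _ b]) (use eq in auto)
      show "integral {0..t} (\<lambda>s. (?A s *v V s \<omega>) $ b) = U b t \<omega>"
        unfolding U_eq_integral[OF elim(3)] by (rule integral_spike[of "{0}"]) (use eq in auto)
    qed
    \<comment> \<open>Components may be taken out of the vector-valued integral once its integrand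
      is known to be integrable.\<close>
    have "(\<lambda>s. ?A s *v V s \<omega>) integrable_on {0..t}"
      by (subst integrable_componentwise_iff) (auto simp: Basis_vec_def inner_axis int)
    from integral_component_eq_cart[OF this, of a]
    have "integral {0..t} (\<lambda>s. ?A s *v V s \<omega>) $ a = U a t \<omega>"
      by (simp add: int)
    with elim have "V t \<omega> $ a = (\<Sum>i\<in>UNIV. J i t \<omega> * ?r i a) + U a t \<omega>"
      by simp
    then show ?case
      by (simp add: N_def V'_eq[OF elim(2) t] mult.commute)
  qed

  note J_moments = stochastic_integral_moments[OF W J]
  have N_meas: "N a t \<in> borel_measurable M" for a t
    by (rule joint_section[OF N_joint])
  have J_sum_sq: "sq_integrable M (\<lambda>\<omega>. \<Sum>i\<in>UNIV. ?r i a * J i t \<omega>)" if "t \<in> {0..T}" for a t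
    by (intro sq_integrable_sum sq_integrable_cmult J_moments(1) that)
  \<comment> \<open>Existence of the stochastic integral forces its integrand \<open>sqrt g\<close>
    to be square integrable, which for nonnegative \<open>g\<close> is integrability of
    \<open>g\<close>.\<close>
  have g_int: "set_integrable lborel {0..T} (?g i)" for i
  proof -
    have "integrable lborel (\<lambda>x. (indicator {0..T} x * sqrt (?g i x))\<^sup>2)"
      using T by (intro sq_integrable_square J_moments(3)) auto
    moreover have "(indicator {0..T} x * sqrt (?g i x))\<^sup>2 = indicator {0..T} x *\<^sub>R ?g i x" for x
      using g_nonneg[of x i] by (auto simp: indicator_def)
    ultimately show ?thesis
      unfolding set_integrable_def by simp
  qed
  \<comment> \<open>The entry \<open>(a, b)\<close> of \<open>B B'\<close>.\<close>
  define \<rho> where "\<rho> a b x = (\<Sum>i\<in>UNIV. (?r i a * ?r i b) * ?g i x)" for a b x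
  interpret linear_sde M V' A' T K \<rho>
  proof
    fix a t assume t: "t \<in> {0..T}"
    show "sq_integrable M (N a t)"
      by (rule sq_integrable_cong_AE[OF J_sum_sq[OF t] N_eq[OF t] N_meas])
    have "expectation (N a t) = expectation (\<lambda>\<omega>. \<Sum>i\<in>UNIV. ?r i a * J i t \<omega>)"
      by (rule integral_cong_AE[OF sq_integrable_measurable[OF J_sum_sq[OF t]] N_meas N_eq[OF t], symmetric])
    then show "expectation (N a t) = 0"
      using J_moments(1,2)[OF t] by (simp add: sq_integrable_integrable)
  next
    show "set_integrable lborel {0..T} (\<rho> a b)" for a b
      unfolding \<rho>_def using g_int
      by (auto simp: set_integrable_def sum_distrib_left mult.left_commute[of "indicator _ _"] intro!: Bochner_Integration.integrable_sum)
  next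
    fix a b s t assume s: "s \<in> {0..T}" and t: "t \<in> {0..T}"
    \<comment> \<open>On \<open>{0..min s t}\<close> the two square roots multiply back to the rate;
      distinct Brownian motions are uncorrelated.\<close>
    have JJ: "expectation (\<lambda>\<omega>. J i s \<omega> * J j t \<omega>) = (if i = j then LBINT x:{0..min s t}. ?g i x else 0)" for i j
    proof -
      have "(LBINT x. (indicator {0..s} x * sqrt (?g i x)) * (indicator {0..t} x * sqrt (?g i x))) = (LBINT x:{0..min s t}. ?g i x)"
        unfolding set_lebesgue_integral_def using g_nonneg s t
        by (intro Bochner_Integration.integral_cong) (auto split: split_indicator)
      then show ?thesis
        using stochastic_integral_covariance[OF W J[OF s] J[OF t], of i j] by (cases "i = j") simp_all
    qed
    have gi: "set_integrable lborel {0..min s t} (?g i)" for i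
      by (rule set_integrable_subset[OF g_int]) (use s t in auto)
    have "expectation (\<lambda>\<omega>. N a s \<omega> * N b t \<omega>)
        = expectation (\<lambda>\<omega>. (\<Sum>i\<in>UNIV. ?r i a * J i s \<omega>) * (\<Sum>j\<in>UNIV. ?r j b * J j t \<omega>))"
    proof (rule integral_cong_AE)
      show "AE \<omega> in M. N a s \<omega> * N b t \<omega> = (\<Sum>i\<in>UNIV. ?r i a * J i s \<omega>) * (\<Sum>j\<in>UNIV. ?r j b * J j t \<omega>)"
        using N_eq[OF s, of a] N_eq[OF t, of b] by eventually_elim simp
    qed (intro borel_measurable_times N_meas sq_integrable_measurable[OF J_sum_sq] s t)+
    also have "\<dots> = expectation (\<lambda>\<omega>. \<Sum>i\<in>UNIV. \<Sum>j\<in>UNIV. (?r i a * ?r j b) * (J i s \<omega> * J j t \<omega>))"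
      by (simp add: sum_product ac_simps)
    also have "\<dots> = (\<Sum>i\<in>UNIV. \<Sum>j\<in>UNIV. (?r i a * ?r j b) * expectation (\<lambda>\<omega>. J i s \<omega> * J j t \<omega>))"
      using sq_integrable_mult[OF J_moments(1)[OF s] J_moments(1)[OF t]] by simp
    also have "\<dots> = (\<Sum>i\<in>UNIV. (?r i a * ?r i b) * (LBINT x:{0..min s t}. ?g i x))"
      by (simp add: JJ if_distrib cong: if_cong)
    also have "\<dots> = (LBINT x:{0..min s t}. \<rho> a b x)"
      unfolding \<rho>_def using gi by (simp add: set_lebesgue_integral_def set_integrable_def sum_distrib_left mult.left_commute[of "indicator _ _"])
    finally show "expectation (\<lambda>\<omega>. N a s \<omega> * N b t \<omega>) = (LBINT x:{0..min s t}. \<rho> a b x)" .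
  qed

  \<comment> \<open>The mean is now known to vanish, so covariance and second moment
    coincide.\<close>
  have \<Sigma>_eq: "\<Sigma> t $ a $ b = expectation (\<lambda>\<omega>. V' a t \<omega> * V' b t \<omega>)" if "t \<in> {0..T}" for a b t
    using V_mean[OF that] by (simp add: \<Sigma>_moments[OF that])
  have \<Sigma>_sym: "\<Sigma> t $ a $ b = \<Sigma> t $ b $ a" if "t \<in> {0..T}" for a b t
    by (simp add: \<Sigma>_eq[OF that] mult.commute)
  define h where "h a b s = \<rho> a b s + (\<Sum>c\<in>UNIV. A' a c s * expectation (\<lambda>\<omega>. V' c s \<omega> * V' b s \<omega>))
      + (\<Sum>c\<in>UNIV. expectation (\<lambda>\<omega>. V' a s \<omega> * V' c s \<omega>) * A' b c s)" for a b s
  have h_int: "set_integrable lborel {0..t} (h a b)" and \<Sigma>_integral: "\<Sigma> t $ a $ b = integral {0..t} (h a b)"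
    if t: "t \<in> {0..T}" for a b t
  proof -
    show i: "set_integrable lborel {0..t} (h a b)"
      unfolding h_def by (rule covariance_equation(1)[OF t])
    have "\<Sigma> t $ a $ b = (LBINT s:{0..t}. h a b s)"
      unfolding \<Sigma>_eq[OF t] h_def by (rule covariance_equation(2)[OF t])
    then show "\<Sigma> t $ a $ b = integral {0..t} (h a b)"
      by (simp add: set_borel_integral_eq_integral(2)[OF i])
  qed
  have h_eq: "h a b t = \<rho> a b t + (?A t ** \<Sigma> t) $ a $ b + (?A t ** \<Sigma> t) $ b $ a" if t: "t \<in> {0<..T}" for a b t
  proof -
    have tT: "t \<in> {0..T}" using t by auto
    show ?thesis
      using t by (simp add: h_def A'_def matrix_matrix_mult_def \<Sigma>_eq[OF tT] mult.commute)
  qed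

  have \<Sigma>_cont: "continuous_on {0..T} \<Sigma>"
  proof -
    have "continuous_on {0..T} (\<lambda>t. \<chi> a b. integral {0..t} (h a b))"
      using T by (intro continuous_on_vec_lambda indefinite_integral_continuous_1 set_borel_integral_eq_integral(1) h_int) auto
    then show ?thesis
      by (rule continuous_on_cong[THEN iffD2, rotated 2]) (auto simp: vec_eq_iff \<Sigma>_integral)
  qed
  have path: "continuous_on {0<..T} (\<lambda>t. ((t, Z t), \<Sigma> t))"
    by (intro continuous_intros continuous_on_subset[OF Z_cont] continuous_on_subset[OF \<Sigma>_cont]) auto
  have path_sub: "(\<lambda>t. ((t, Z t), \<Sigma> t)) ` {0<..T} \<subseteq> ({0..T} \<times> UNIV) \<times> Collect positive_definite"
    using \<Sigma>_pos by auto
  have g_cont: "continuous_on {0<..T} (?g i)" for i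
    using continuous_on_compose2[OF continuous_on_gauss_rate[of i] path path_sub] by simp
  have moment_cont: "continuous_on {0<..T} (\<lambda>t. moment i t (Z t) (\<Sigma> t) b)" for i b
    using continuous_on_compose2[OF continuous_on_moment[of i b] path path_sub] by simp
  \<comment> \<open>\<open>h\<close> contains the Jacobian only through \<open>A \<Sigma>\<close>
    and its transpose. These are sums of moments along a continuous path of positive definite
    matrices, so continuity of \<open>A\<close> itself does not come up.\<close>
  have h_cont: "continuous_on {0<..T} (h a b)" for a b
  proof -
    have "continuous_on {0<..T} (\<lambda>t. \<rho> a b t + (\<Sum>i\<in>UNIV. moment i t (Z t) (\<Sigma> t) b * ?r i a)
        + (\<Sum>i\<in>UNIV. moment i t (Z t) (\<Sigma> t) a * ?r i b))"
      unfolding \<rho>_def by (intro continuous_intros g_cont moment_cont)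
    moreover have "h a b t = \<rho> a b t + (\<Sum>i\<in>UNIV. moment i t (Z t) (\<Sigma> t) b * ?r i a)
        + (\<Sum>i\<in>UNIV. moment i t (Z t) (\<Sigma> t) a * ?r i b)" if t: "t \<in> {0<..T}" for t
      using drift_jacobian_mult[of t \<Sigma> Z] t \<Sigma>_pos[OF t] by (simp add: h_eq[OF t])
    ultimately show ?thesis
      by (rule continuous_on_cong[OF refl, THEN iffD2, rotated]) blast
  qed

  have Z_deriv: "(Z has_vector_derivative (\<Sum>i\<in>UNIV. ?g i t *\<^sub>R real_vec (l i))) (at t within {0..T})"
    if t: "t \<in> {0<..T}" for t
  proof -
    have "((\<lambda>u. x0 + (\<Sum>i\<in>UNIV. integral {0..u} (?g i) *\<^sub>R real_vec (l i))) has_vector_derivative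
        0 + (\<Sum>i\<in>UNIV. ?g i t *\<^sub>R real_vec (l i))) (at t within {0..T})"
      by (intro has_vector_derivative_add has_vector_derivative_const has_vector_derivative_sum
          bounded_linear.has_vector_derivative[OF bounded_linear_scaleR_left]
          integral_has_derivative_interior set_borel_integral_eq_integral(1) g_int g_cont t)
    then show ?thesis
      using t by (intro has_vector_derivative_transform[of t "{0..T}" Z]) (auto simp: Z_eq)
  qed

  have \<Sigma>_deriv: "(\<Sigma> has_vector_derivative (?A t ** \<Sigma> t + \<Sigma> t ** transpose (?A t)
      + diffusion_matrix l f Z \<Sigma> t ** transpose (diffusion_matrix l f Z \<Sigma> t))) (at t within {0..T})"
    if t: "t \<in> {0<..T}" for t
  proof (intro has_vector_derivative_vec_componentwise)
    fix a b
    have tT: "t \<in> {0..T}" using t by auto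
    have "((\<lambda>u. integral {0..u} (h a b)) has_vector_derivative h a b t) (at t within {0..T})"
      using T by (intro integral_has_derivative_interior set_borel_integral_eq_integral(1) h_int h_cont t) auto
    then have "((\<lambda>u. \<Sigma> u $ a $ b) has_vector_derivative h a b t) (at t within {0..T})"
      using tT by (rule has_vector_derivative_transform[rotated 2]) (auto simp: \<Sigma>_integral)
    moreover have "h a b t = (?A t ** \<Sigma> t + \<Sigma> t ** transpose (?A t)
      + diffusion_matrix l f Z \<Sigma> t ** transpose (diffusion_matrix l f Z \<Sigma> t)) $ a $ b"
    proof -
      \<comment> \<open>By symmetry of \<open>\<Sigma> t\<close> the second product is the transpose
        of the first.\<close>
      have "(\<Sigma> t ** transpose (?A t)) $ a $ b = (?A t ** \<Sigma> t) $ b $ a"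
        using \<Sigma>_sym[OF tT] by (simp add: matrix_matrix_mult_def transpose_def mult.commute)
      moreover have "(diffusion_matrix l f Z \<Sigma> t ** transpose (diffusion_matrix l f Z \<Sigma> t)) $ a $ b = \<rho> a b t"
        unfolding \<rho>_def matrix_matrix_mult_def transpose_def diffusion_matrix_def using g_nonneg[OF tT]
        by (auto intro!: sum.cong simp: algebra_simps)
      ultimately show ?thesis
        by (simp add: h_eq[OF t])
    qed
    ultimately show "((\<lambda>u. \<Sigma> u $ a $ b) has_vector_derivative (?A t ** \<Sigma> t + \<Sigma> t ** transpose (?A t)
      + diffusion_matrix l f Z \<Sigma> t ** transpose (diffusion_matrix l f Z \<Sigma> t)) $ a $ b) (at t within {0..T})"
      by simp
  qed

  have Y_props: "integrable M (Y t) \<and> integrable M (\<lambda>\<omega>. (norm (Y t \<omega>))\<^sup>2) \<and> expectation (Y t) = Z t \<and>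
      cov_matrix M (Y t) (Y t) = cov_matrix M (V t) (V t) \<and> cov_matrix M (V t) (V t) = \<Sigma> t"
    if t: "t \<in> {0..T}" for t
  proof -
    have Yt: "Y t = (\<lambda>\<omega>. Z t + V t \<omega>)"
      using Y[OF t] by auto
    have V_int: "integrable M (V t)"
    proof (rule Bochner_Integration.integrable_bound[of _ "\<lambda>\<omega>. 1 + (norm (V t \<omega>))\<^sup>2"])
      show "integrable M (\<lambda>\<omega>. 1 + (norm (V t \<omega>))\<^sup>2)"
        using \<Sigma>_second_moment[OF t] by simp
      have "x \<le> 1 + x\<^sup>2" for x :: real
      proof -
        have "2 * x \<le> 1 + x\<^sup>2"
          using zero_le_power2[of "x - 1"] by (simp add: power2_diff)
        then show ?thesis
          using zero_le_power2[of x] by linarith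
      qed
      then show "AE \<omega> in M. norm (V t \<omega>) \<le> norm (1 + (norm (V t \<omega>))\<^sup>2)"
        by simp
    qed (rule V_rv[OF t])
    have mean0: "expectation (\<lambda>\<omega>. V t \<omega> $ a) = 0" for a
      using integral_cong_AE[OF V'_meas V_comp_meas[OF t] V'_AE[OF t], of a] V_mean[OF t, of a] by simp
    have V_mean_vec: "expectation (V t) = 0"
      using mean0 integral_bounded_linear[OF bounded_linear_vec_nth V_int] by (simp add: vec_eq_iff)
    have "integrable M (\<lambda>\<omega>. (norm (Y t \<omega>))\<^sup>2)"
    proof (rule Bochner_Integration.integrable_bound[of _ "\<lambda>\<omega>. 2 * (norm (Z t))\<^sup>2 + 2 * (norm (V t \<omega>))\<^sup>2"])
      show "integrable M (\<lambda>\<omega>. 2 * (norm (Z t))\<^sup>2 + 2 * (norm (V t \<omega>))\<^sup>2)"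
        using \<Sigma>_second_moment[OF t] by simp
      show "(\<lambda>\<omega>. (norm (Y t \<omega>))\<^sup>2) \<in> borel_measurable M"
        using V_rv[OF t] unfolding Yt by measurable
      have "(norm (Z t + V t \<omega>))\<^sup>2 \<le> 2 * (norm (Z t))\<^sup>2 + 2 * (norm (V t \<omega>))\<^sup>2" for \<omega>
        using zero_le_power2[of "norm (Z t - V t \<omega>)"]
        by (simp add: power2_norm_eq_inner inner_add_left inner_add_right inner_diff_left inner_diff_right inner_commute)
      then show "AE \<omega> in M. norm ((norm (Y t \<omega>))\<^sup>2) \<le> norm (2 * (norm (Z t))\<^sup>2 + 2 * (norm (V t \<omega>))\<^sup>2)"
        by (simp add: Yt)
    qed
    moreover have "expectation (\<lambda>\<omega>. Z t $ a + V t \<omega> $ a) = Z t $ a" for a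
      using sq_integrable_integrable[OF V_sq_comp[OF t]] mean0 by (simp add: prob_space)
    ultimately show ?thesis
      using V_int V_mean_vec mean0 by (simp add: Yt cov_matrix_def \<Sigma>_cov[OF t] prob_space)
  qed
  have "Z 0 = x0"
    using Z_eq[of 0] T by simp
  moreover have "\<Sigma> 0 = 0"
    using \<Sigma>_integral[of 0] T by (simp add: vec_eq_iff)
  ultimately show ?thesis
    using Y_props Z_deriv \<Sigma>_deriv by blast
qed

end
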